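(* Let $A$ be a finite abelian group. If $\mathcal G_1$ is a surface group and $1\to A\to\Gamma\to\mathcal G_1\to1$ is a central extension, then there is a finite index subgroup $H<\mathcal G_1$ with $[\mathcal G_1:H]\le e(A)$ such that the induced extension of $H$ by $A$ is trivial. Moreover, we can take $H\unlhd\mathcal G_1$ with $\mathcal G_1/H$ cyclic.
   Context: A surface group is the fundamental group of a closed orientable surface of genus at least $2$. $e(A)$ is the exponent of $A$. The induced extension of a subgroup $H$ is the restriction $1\to A\to\phi^{-1}(H)\to H\to1$, where $\phi:\Gamma\to\mathcal G_1$ is the given surjection. A central extension is trivial if it is isomorphic, as an extension, to the product extension $1\to A\to A\times H\to H\to1$. *)

theory Defs
  imports "HOL-Analysis.Analysis" "HOL-Algebra.Elementary_Groups"
begin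

text \<open>The fundamental group of \<open>S\<close> at \<open>x\<close>: loops modulo homotopy rel endpoints.\<close>

definition based_loops :: "'a::topological_space set \<Rightarrow> 'a \<Rightarrow> (real \<Rightarrow> 'a) set"
  where "based_loops S x =
    {p. path p \<and> path_image p \<subseteq> S \<and> pathstart p = x \<and> pathfinish p = x}"

definition path_class :: "'a::topological_space set \<Rightarrow> (real \<Rightarrow> 'a) \<Rightarrow> (real \<Rightarrow> 'a) set"
  where "path_class S p = {q. homotopic_paths S p q}"

definition fundamental_group :: "'a::topological_space set \<Rightarrow> 'a \<Rightarrow> (real \<Rightarrow> 'a) set monoid"
  where "fundamental_group S x =
    \<lparr>carrier = path_class S ` based_loops S x,
     mult = (\<lambda>P Q. \<Union>p\<in>P. \<Union>q\<in>Q. path_class S (p +++ q)),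
     one = path_class S (\<lambda>_. x)\<rparr>"

text \<open>
  The closed orientable surface of genus \<open>g \<ge> 1\<close> is obtained from a \<open>4g\<close>-gon by gluing its sides in
  pairs according to the boundary word
  \<open>a\<^sub>1 b\<^sub>1 a\<^sub>1\<^sup>-\<^sup>1 b\<^sub>1\<^sup>-\<^sup>1 \<dots> a\<^sub>g b\<^sub>g a\<^sub>g\<^sup>-\<^sup>1 b\<^sub>g\<^sup>-\<^sup>1\<close>. The polygon is the closed unit disc
  with its boundary circle divided into \<open>4g\<close> equal arcs; sides are numbered from \<open>0\<close>
  counterclockwise, and \<open>t \<in> [0,1]\<close> parametrizes each of them counterclockwise.
\<close>

definition polygon_side :: "nat \<Rightarrow> nat \<Rightarrow> real \<Rightarrow> complex"
  where "polygon_side g k t = cis (2 * pi * (real k + t) / (4 * real g))"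

inductive side_pairing :: "nat \<Rightarrow> complex \<Rightarrow> complex \<Rightarrow> bool" for g :: nat
  where
    pair_a: "j < g \<Longrightarrow> 0 \<le> t \<Longrightarrow> t \<le> 1 \<Longrightarrow>
      side_pairing g (polygon_side g (4 * j) t) (polygon_side g (4 * j + 2) (1 - t))"
  | pair_b: "j < g \<Longrightarrow> 0 \<le> t \<Longrightarrow> t \<le> 1 \<Longrightarrow>
      side_pairing g (polygon_side g (4 * j + 1) t) (polygon_side g (4 * j + 3) (1 - t))"

text \<open>
  Stating this through a quotient map, rather than for one particular quotient space, makes the
  notion invariant under homeomorphism.
\<close>

definition closed_orientable_surface :: "nat \<Rightarrow> 'a::topological_space set \<Rightarrow> bool"
  where "closed_orientable_surface g S \<longleftrightarrow>
    1 \<le> g \<and>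
    (\<exists>q. quotient_map (top_of_set (cball (0::complex) 1)) (top_of_set S) q \<and>
      (\<forall>z\<in>cball 0 1. \<forall>w\<in>cball 0 1. q z = q w \<longleftrightarrow> equivclp (side_pairing g) z w))"

definition group_exponent :: "('a, 'm) monoid_scheme \<Rightarrow> nat"
  where "group_exponent A = (LEAST n. 0 < n \<and> (\<forall>a\<in>carrier A. a [^]\<^bsub>A\<^esub> n = \<one>\<^bsub>A\<^esub>))"

definition central_extension ::
    "'a monoid \<Rightarrow> ('a \<Rightarrow> 'e) \<Rightarrow> 'e monoid \<Rightarrow> ('e \<Rightarrow> 'g) \<Rightarrow> 'g monoid \<Rightarrow> bool"
  where "central_extension A \<iota> \<Gamma> \<phi> G \<longleftrightarrow>
    group A \<and> group \<Gamma> \<and> group G \<and>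
    \<iota> \<in> mon A \<Gamma> \<and> \<phi> \<in> epi \<Gamma> G \<and>
    \<iota> ` carrier A = kernel \<Gamma> G \<phi> \<and>
    (\<forall>a\<in>carrier A. \<forall>x\<in>carrier \<Gamma>. \<iota> a \<otimes>\<^bsub>\<Gamma>\<^esub> x = x \<otimes>\<^bsub>\<Gamma>\<^esub> \<iota> a)"

definition extensions_isomorphic ::
    "'a monoid \<Rightarrow> ('a \<Rightarrow> 'e) \<Rightarrow> 'e monoid \<Rightarrow> ('e \<Rightarrow> 'g) \<Rightarrow>
      ('a \<Rightarrow> 'f) \<Rightarrow> 'f monoid \<Rightarrow> ('f \<Rightarrow> 'g) \<Rightarrow> bool"
  where "extensions_isomorphic A \<iota> \<Gamma> \<phi> \<iota>' \<Gamma>' \<phi>' \<longleftrightarrow>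
    (\<exists>\<theta>\<in>iso \<Gamma> \<Gamma>'. (\<forall>a\<in>carrier A. \<theta> (\<iota> a) = \<iota>' a) \<and> (\<forall>x\<in>carrier \<Gamma>. \<phi>' (\<theta> x) = \<phi> x))"

definition trivial_extension ::
    "'a monoid \<Rightarrow> ('a \<Rightarrow> 'e) \<Rightarrow> 'e monoid \<Rightarrow> ('e \<Rightarrow> 'g) \<Rightarrow> 'g monoid \<Rightarrow> bool"
  where "trivial_extension A \<iota> \<Gamma> \<phi> G \<longleftrightarrow>
    extensions_isomorphic A \<iota> \<Gamma> \<phi> (\<lambda>a. (a, \<one>\<^bsub>G\<^esub>)) (A \<times>\<times> G) snd"

definition preimage_group :: "'e monoid \<Rightarrow> ('e \<Rightarrow> 'g) \<Rightarrow> 'g set \<Rightarrow> 'e monoid"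
  where "preimage_group \<Gamma> \<phi> H = \<Gamma>\<lparr>carrier := {x \<in> carrier \<Gamma>. \<phi> x \<in> H}\<rparr>"

end

theory Submission
  imports Defs "HOL-Algebra.Multiplicative_Group"
begin

text \<open>
  Let \<open>a\<^sub>j, b\<^sub>j\<close> be the edge generators of the surface group \<open>G\<close>. Lifting them to \<open>\<Gamma>\<close>, the surface
  relator becomes a central element \<open>z = \<iota> c\<close>. On \<open>\<Gamma> \<times> \<int> \<times> \<int>\<close> consider the multiplication
  \<open>(r, i, j) (r', i', j') = (r r' z\<^bsup>i j'\<^esup>, i + i', j + j')\<close>, a quotient of the product of \<open>\<Gamma>\<close> with an
  integral Heisenberg group. Giving the lifts of \<open>a\<^sub>0\<close> and \<open>b\<^sub>0\<close> the coordinates \<open>(1, 0)\<close> and \<open>(0, 1)\<close>, and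
  all others \<open>(0, 0)\<close>, changes the relator by \<open>z\<^sup>-\<^sup>1\<close>, so the surface relation holds and \<open>G\<close> maps to the twisted
  product, compatibly with \<open>\<phi>\<close>. On the kernel \<open>H\<close> of the \<open>i\<close>-coordinate modulo the exponent of \<open>A\<close>
  the twisting disappears, and the first coordinate is a splitting.

  The universal property of the surface group is obtained from the polygon by a van Kampen argument:
  the surface is covered by the open disc, one strip per edge and a star around the vertex; each
  of them is contractible, and locally constant transition data on this cover with values in a group
  determine a homotopy invariant, multiplicative holonomy of paths.
\<close>

section \<open>Homotopies of paths\<close>

text \<open>Behind the construction stands cohomology: for a surface group H^2(G, A) = A, and
  \<open>c\<close> corresponds to the class of the extension. The factor z^(i j') is the cup product
  of the two integral classes given by the coordinates of \<open>a\<^sub>0\<close> and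
  \<open>b\<^sub>0\<close>. It represents a generator, so twisting by it can cancel \<open>c\<close>
  exactly. A cup product vanishes modulo e as soon as one of its factors does. Restricting one
  coordinate modulo e(A) is therefore enough, which explains both the bound on the index and the
  cyclic quotient.

  The obstacle is that the surface group is given by loops in a quotient space, without generators.
  The isomorphism with \<open>G\<close> is turned into a functor on the paths of \<open>S\<close>;
  its transitions across the edges serve as generators, and the same charts with lifted transitions
  give the functor into the twisted product. That it lifts the identity of \<open>G\<close> is a
  uniqueness statement: functors that agree on all paths inside charts agree everywhere.\<close>

lemma (in group) inv_cancel_left [simp]:
  "x \<in> carrier G \<Longrightarrow> y \<in> carrier G \<Longrightarrow> inv x \<otimes> (x \<otimes> y) = y"
  "x \<in> carrier G \<Longrightarrow> y \<in> carrier G \<Longrightarrow> x \<otimes> (inv x \<otimes> y) = y"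
  by (simp_all flip: m_assoc)

text \<open>All homotopies of this section come from the convexity of the unit interval: two
  parameter paths with common endpoints are linearly homotopic, and \<open>p\<close> carries the
  homotopy to \<open>S\<close>. Constant pieces and backtracking are allowed, so units and inverses
  are instances.\<close>

lemma homotopic_paths_interval_reparametrization:
  fixes a b :: "real \<Rightarrow> real"
  assumes "path p" "path_image p \<subseteq> S" "path a" "path b" "path_image a \<subseteq> {0..1}" "path_image b \<subseteq> {0..1}"
    and "pathstart a = pathstart b" "pathfinish a = pathfinish b"
  shows "homotopic_paths S (p \<circ> a) (p \<circ> b)"
proof (rule homotopic_paths_continuous_image)
  show "homotopic_paths {0..1} a b"
    using assms(3-8) unfolding path_image_def
    by (intro homotopic_paths_linear closed_segment_subset) (auto simp del: atLeastAtMost_iff)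
  show "continuous_on {0..1} p" "p \<in> {0..1} \<rightarrow> S"
    using assms(1,2) by (auto simp: path_def path_image_def)
qed

lemma path_const: "path (\<lambda>_. x)" "x \<in> S \<Longrightarrow> path_image (\<lambda>_. x) \<subseteq> S"
  "pathstart (\<lambda>_. x) = x" "pathfinish (\<lambda>_. x) = x" "reversepath (\<lambda>_. x) = (\<lambda>_. x)"
  by (auto simp: path_def path_image_def pathstart_def pathfinish_def reversepath_def)

lemma homotopic_paths_const_left:
  assumes "path p" "path_image p \<subseteq> S" "pathstart p = x"
  shows "homotopic_paths S ((\<lambda>_. x) +++ p) p"
proof -
  have "homotopic_paths S (p \<circ> ((\<lambda>_. 0) +++ linepath 0 1)) (p \<circ> linepath 0 1)"
    using assms by (intro homotopic_paths_interval_reparametrization)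
      (auto simp: path_const path_image_join closed_segment_eq_real_ivl intro: path_join_imp)
  moreover have "p \<circ> ((\<lambda>_. 0) +++ linepath 0 1) = (\<lambda>_. x) +++ p" "p \<circ> linepath 0 1 = p"
    using assms(3) by (auto simp: fun_eq_iff joinpaths_def linepath_def pathstart_def)
  ultimately show ?thesis by simp
qed

lemma homotopic_paths_reversepath_right:
  assumes "path p" "path_image p \<subseteq> S"
  shows "homotopic_paths S (p +++ reversepath p) (\<lambda>_. pathstart p)"
proof -
  have "homotopic_paths S (p \<circ> (linepath 0 1 +++ linepath 1 0)) (p \<circ> (\<lambda>_. 0))"
    using assms by (intro homotopic_paths_interval_reparametrization)
      (auto simp: path_const path_image_join closed_segment_eq_real_ivl intro: path_join_imp)
  moreover have "p \<circ> (linepath 0 1 +++ linepath 1 0) = p +++ reversepath p"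
    by (auto simp: fun_eq_iff joinpaths_def linepath_def reversepath_def)
  moreover have "p \<circ> (\<lambda>_::real. 0) = (\<lambda>_. pathstart p)" by (simp add: fun_eq_iff pathstart_def)
  ultimately show ?thesis by metis
qed

lemma homotopic_paths_const_right:
  assumes "path p" "path_image p \<subseteq> S" "pathfinish p = x"
  shows "homotopic_paths S (p +++ (\<lambda>_. x)) p"
  using homotopic_paths_const_left[of "reversepath p" S x] assms
    homotopic_paths_reversepath[of S "p +++ (\<lambda>_. x)" p]
  by (simp add: reversepath_joinpaths path_const)

section \<open>Holonomy of a flat atlas\<close>

text \<open>A functor from the fundamental groupoid of \<open>S\<close> to the group
  \<open>K\<close>, seen as a category with one object, but written on paths instead of homotopy
  classes.\<close>

locale path_functor = group K for K :: "('k, 'm) monoid_scheme" (structure) +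
  fixes S :: "'s::topological_space set" and u :: "(real \<Rightarrow> 's) \<Rightarrow> 'k"
  assumes closed: "path p \<Longrightarrow> path_image p \<subseteq> S \<Longrightarrow> u p \<in> carrier K"
    and join: "path p \<Longrightarrow> path_image p \<subseteq> S \<Longrightarrow> path q \<Longrightarrow> path_image q \<subseteq> S \<Longrightarrow>
      pathfinish p = pathstart q \<Longrightarrow> u (p +++ q) = u p \<otimes> u q"
    and homotopic: "homotopic_paths S p q \<Longrightarrow> u p = u q"

text \<open>\<open>d c\<close> is a potential on the chart \<open>U c\<close>. Condition
  \<open>agree\<close> says that the transition \<open>d c' y \<otimes> inv (d c y)\<close> is
  constant along paths in an overlap. It refers to paths because overlaps may be disconnected, and
  it controls only quotients because the potentials themselves may jump.\<close>

locale flat_atlas = group K for K :: "('k, 'm) monoid_scheme" (structure) +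
  fixes S :: "'s::topological_space set" and I :: "'i set" and U :: "'i \<Rightarrow> 's set"
    and d :: "'i \<Rightarrow> 's \<Rightarrow> 'k"
  assumes open_chart: "c \<in> I \<Longrightarrow> openin (top_of_set S) (U c)"
    and cover: "S \<subseteq> (\<Union>c\<in>I. U c)"
    and potential_closed: "c \<in> I \<Longrightarrow> y \<in> U c \<Longrightarrow> d c y \<in> carrier K"
    and agree: "c \<in> I \<Longrightarrow> c' \<in> I \<Longrightarrow> path r \<Longrightarrow> path_image r \<subseteq> U c \<inter> U c' \<Longrightarrow>
      inv (d c (pathstart r)) \<otimes> d c (pathfinish r) = inv (d c' (pathstart r)) \<otimes> d c' (pathfinish r)"
begin

section \<open>Development of a path along a subdivision\<close>

definition small :: "(real \<Rightarrow> 's) \<Rightarrow> real \<Rightarrow> real \<Rightarrow> bool"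
  where "small p a b \<longleftrightarrow> (\<exists>c\<in>I. p ` {a..b} \<subseteq> U c)"

text \<open>The chart is an arbitrary choice; by \<open>agree\<close> the value does not depend on
  it when \<open>p\<close> is continuous on the interval.\<close>

definition seg :: "(real \<Rightarrow> 's) \<Rightarrow> real \<Rightarrow> real \<Rightarrow> 'k"
  where "seg p a b = (let c = SOME c. c \<in> I \<and> p ` {a..b} \<subseteq> U c in inv (d c (p a)) \<otimes> d c (p b))"

lemma seg_eq:
  assumes "a \<le> b" "c \<in> I" "continuous_on {a..b} p" "p ` {a..b} \<subseteq> U c"
  shows "seg p a b = inv (d c (p a)) \<otimes> d c (p b)"
proof -
  define c' where "c' = (SOME c. c \<in> I \<and> p ` {a..b} \<subseteq> U c)"
  have c': "c' \<in> I \<and> p ` {a..b} \<subseteq> U c'"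
    unfolding c'_def using assms(2,4) by (intro someI2[where Q = "\<lambda>c. c \<in> I \<and> p ` {a..b} \<subseteq> U c", of _ c]) auto
  define r where "r = (\<lambda>t. p (a + t * (b - a)))"
  have im: "(\<lambda>t. a + t * (b - a)) ` {0..1} \<subseteq> {a..b}"
  proof clarify
    fix t :: real assume t: "t \<in> {0..1}"
    then have "t * (b - a) \<le> 1 * (b - a)" using assms(1) by (intro mult_right_mono) auto
    then show "a + t * (b - a) \<in> {a..b}" using t assms(1) by auto
  qed
  have "path r"
    unfolding path_def r_def
    by (rule continuous_on_compose2[OF assms(3) _ im]) (intro continuous_intros)
  moreover have "path_image r \<subseteq> U c' \<inter> U c"
    using im c' assms(4) unfolding path_image_def r_def by blast
  ultimately have "inv (d c' (r 0)) \<otimes> d c' (r 1) = inv (d c (r 0)) \<otimes> d c (r 1)"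
    using agree[of c' c r] c' assms(2) by (simp add: pathstart_def pathfinish_def)
  then show ?thesis
    unfolding seg_def Let_def c'_def[symmetric] by (simp add: r_def)
qed

lemma seg_closed:
  assumes "a \<le> b" "small p a b"
  shows "seg p a b \<in> carrier K"
proof -
  define c' where "c' = (SOME c. c \<in> I \<and> p ` {a..b} \<subseteq> U c)"
  have c': "c' \<in> I \<and> p ` {a..b} \<subseteq> U c'"
    unfolding c'_def using assms(2) unfolding small_def by (metis (mono_tags, lifting) someI_ex)
  then have "p a \<in> U c'" "p b \<in> U c'" using assms(1) by auto
  then show ?thesis
    unfolding seg_def Let_def c'_def[symmetric] using c' potential_closed by auto
qed

lemma small_subset: "small p a b \<Longrightarrow> {a'..b'} \<subseteq> {a..b} \<Longrightarrow> small p a' b'"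
  unfolding small_def by (meson image_mono order_trans)

lemma seg_trans:
  assumes "a \<le> b" "b \<le> b'" "small p a b'" "continuous_on {a..b'} p"
  shows "seg p a b \<otimes> seg p b b' = seg p a b'"
proof -
  obtain c where c: "c \<in> I" "p ` {a..b'} \<subseteq> U c" using assms unfolding small_def by auto
  have sub: "{a..b} \<subseteq> {a..b'}" "{b..b'} \<subseteq> {a..b'}" using assms by auto
  have "p a \<in> U c" "p b \<in> U c" "p b' \<in> U c" using c assms by auto
  note cl = this[THEN potential_closed[OF c(1)]]
  have "seg p a b = inv (d c (p a)) \<otimes> d c (p b)" "seg p b b' = inv (d c (p b)) \<otimes> d c (p b')"
    "seg p a b' = inv (d c (p a)) \<otimes> d c (p b')"
    using c assms sub
    by (auto intro!: seg_eq elim: continuous_on_subset)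
  then show ?thesis using cl by (simp add: m_assoc)
qed

lemma seg_const:
  assumes "a \<le> b" "small p a b" "continuous_on {a..b} p" "p a = p b"
  shows "seg p a b = \<one>"
proof -
  obtain c where c: "c \<in> I" "p ` {a..b} \<subseteq> U c" using assms unfolding small_def by auto
  then have "p a \<in> U c" using assms by auto
  then show ?thesis using seg_eq[OF assms(1) c(1) assms(3) c(2)] potential_closed[OF c(1)] assms(4)
    by simp
qed

text \<open>The chart is chosen from the image alone, so a reparametrised piece gives literally the
  same value.\<close>

lemma seg_cong:
  assumes "p ` {a..b} = q ` {a'..b'}" "p a = q a'" "p b = q b'"
  shows "seg p a b = seg q a' b'"
  unfolding seg_def assms ..

fun dev :: "(real \<Rightarrow> 's) \<Rightarrow> nat \<Rightarrow> nat \<Rightarrow> 'k" where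
  "dev p n 0 = \<one>"
| "dev p n (Suc k) = dev p n k \<otimes> seg p (k / n) (Suc k / n)"

definition fits :: "(real \<Rightarrow> 's) \<Rightarrow> nat \<Rightarrow> bool"
  where "fits p n \<longleftrightarrow> 0 < n \<and> (\<forall>k<n. small p (k / n) (Suc k / n))"

lemma dev_closed: "fits p n \<Longrightarrow> k \<le> n \<Longrightarrow> dev p n k \<in> carrier K"
  by (induction k) (auto simp: fits_def divide_right_mono intro!: seg_closed)

lemma subdivision_bounds:
  fixes n m j k :: nat
  assumes "0 < n" "0 < m" "j \<le> m"
  shows "k / n \<le> real (k * m + j) / real (n * m)" "real (k * m + j) / real (n * m) \<le> Suc k / n"
proof -
  have "real k / n = real (k * m) / (n * m)" "real (Suc k) / n = real (Suc k * m) / (n * m)"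
    using assms by (auto simp: field_simps)
  then show "k / n \<le> real (k * m + j) / real (n * m)" "real (k * m + j) / real (n * m) \<le> Suc k / n"
    using assms by (auto intro!: divide_right_mono simp flip: of_nat_mult of_nat_add)
qed

text \<open>The walk through the \<open>m\<close> fine pieces inside the coarse piece
  \<open>k\<close>. The last hypothesis is the induction hypothesis of \<open>dev_refine\<close>, so
  that the induction here runs over \<open>j\<close> alone.\<close>

lemma dev_refine_aux:
  assumes "fits p n" "path p" "0 < m" "k < n" "j \<le> m" "dev p (n * m) (k * m) = dev p n k"
  shows "dev p (n * m) (k * m + j) = dev p n k \<otimes> seg p (k / n) (real (k * m + j) / real (n * m))"
  using assms(5)
proof (induction j)
  case 0
  have n: "0 < n" using assms fits_def by auto
  have e: "real (k * m) / real (n * m) = k / n" using assms by auto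
  have "small p (k / n) (k / n)"
    using assms(1,4) n unfolding fits_def by (auto intro: small_subset simp: divide_right_mono)
  then have "seg p (k / n) (k / n) = \<one>" by (intro seg_const) auto
  then show ?case using assms e dev_closed[OF assms(1), of k] by simp
next
  case (Suc j)
  have n: "0 < n" using assms fits_def by auto
  let ?t = "\<lambda>i. real (k * m + i) / real (n * m)"
  have b: "k / n \<le> ?t j" "?t j \<le> ?t (Suc j)" "?t (Suc j) \<le> Suc k / n"
    using subdivision_bounds(1)[OF n assms(3), of j k] subdivision_bounds(2)[OF n assms(3), of "Suc j" k]
      Suc.prems by (auto intro!: divide_right_mono simp flip: of_nat_add of_nat_mult)
  have sm: "small p (k / n) (Suc k / n)" using assms unfolding fits_def by auto
  have sub: "{k / n..?t (Suc j)} \<subseteq> {k / n..Suc k / n}" "{?t j..?t (Suc j)} \<subseteq> {k / n..Suc k / n}"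
    "{k / n..?t j} \<subseteq> {k / n..Suc k / n}"
    using b by auto
  have "{k / n..?t (Suc j)} \<subseteq> {0..1}"
  proof -
    have "real (Suc k) / n \<le> 1" using assms(4) n by (simp add: divide_simps)
    moreover have "0 \<le> real k / n" by simp
    ultimately show ?thesis using b(3) unfolding atLeastatMost_subset_iff by linarith
  qed
  then have ct: "continuous_on {k / n..?t (Suc j)} p"
    using assms(2) unfolding path_def by (rule continuous_on_subset[rotated])
  have "dev p (n * m) (k * m + Suc j) = dev p n k \<otimes> seg p (k / n) (?t j) \<otimes> seg p (?t j) (?t (Suc j))"
    using Suc by simp
  also have "\<dots> = dev p n k \<otimes> (seg p (k / n) (?t j) \<otimes> seg p (?t j) (?t (Suc j)))"
    using sm sub b dev_closed[OF assms(1), of k] assms(4)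
    by (intro m_assoc) (auto intro!: seg_closed intro: small_subset)
  also have "seg p (k / n) (?t j) \<otimes> seg p (?t j) (?t (Suc j)) = seg p (k / n) (?t (Suc j))"
    using sm sub b ct by (intro seg_trans) (auto intro: small_subset)
  finally show ?case .
qed

lemma dev_refine:
  assumes "fits p n" "path p" "0 < m" "k \<le> n"
  shows "dev p (n * m) (k * m) = dev p n k"
  using assms(4)
proof (induction k)
  case (Suc k)
  have "real (k * m + m) / real (n * m) = Suc k / n"
  proof -
    have "k * m + m = Suc k * m" by simp
    then show ?thesis using assms(3) by (simp del: of_nat_Suc add_Suc_right mult_Suc of_nat_add)
  qed
  then show ?case
    using dev_refine_aux[OF assms(1-3), of k m] Suc by (simp add: add.commute)
qed simp

lemma fits_refine:
  assumes "fits p n" "0 < m"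
  shows "fits p (n * m)"
proof -
  have n: "0 < n" using assms fits_def by auto
  have "small p (i / (n * m)) (Suc i / (n * m))" if "i < n * m" for i
  proof -
    define k j where "k = i div m" and "j = i mod m"
    have i: "i = k * m + j" "j < m" using assms unfolding k_def j_def by auto
    have "k < n" using that assms unfolding k_def by (simp add: less_mult_imp_div_less)
    then have "small p (k / n) (Suc k / n)" using assms unfolding fits_def by auto
    then show ?thesis
      using subdivision_bounds(1)[OF n assms(2), of j k] subdivision_bounds(2)[OF n assms(2), of "Suc j" k] i
      by (auto elim!: small_subset)
  qed
  then show ?thesis unfolding fits_def using n assms by auto
qed

definition holonomy :: "(real \<Rightarrow> 's) \<Rightarrow> 'k"
  where "holonomy p = (let n = SOME n. fits p n in dev p n n)"

text \<open>Two subdivisions have the common refinement \<open>n * m\<close>, on which both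
  developments can be computed.\<close>

lemma holonomy_eq:
  assumes "path p" "fits p n"
  shows "holonomy p = dev p n n"
proof -
  define m where "m = (SOME n. fits p n)"
  have m: "fits p m" unfolding m_def using assms(2) by (rule someI)
  then have "0 < m" "0 < n" using assms(2) unfolding fits_def by auto
  then have "dev p (n * m) (n * m) = dev p n n" "dev p (m * n) (m * n) = dev p m m"
    using dev_refine[OF assms(2,1), of m n] dev_refine[OF m assms(1), of n m] by auto
  then show ?thesis unfolding holonomy_def Let_def m_def[symmetric] by (simp add: mult.commute)
qed

lemma square_subdivision:
  assumes "continuous_on ({0..1} \<times> {0..1}) h" "h ` ({0..1} \<times> {0..1}) \<subseteq> S"
  obtains n :: nat where "0 < n"
    "\<And>i j. i < n \<Longrightarrow> j < n \<Longrightarrow>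
      \<exists>c\<in>I. h ` ({i / n..Suc i / n} \<times> {j / n..Suc j / n}) \<subseteq> U c"
proof -
  let ?Q = "{0..1::real} \<times> {0..1::real}"
  define \<C> where "\<C> = {T. open T \<and> (\<exists>c\<in>I. h ` (T \<inter> ?Q) \<subseteq> U c)}"
  have cov: "?Q \<subseteq> \<Union>\<C>"
  proof
    fix z assume z: "z \<in> ?Q"
    then obtain c where c: "c \<in> I" "h z \<in> U c" using assms(2) cover by blast
    have "openin (top_of_set ?Q) (?Q \<inter> h -` U c)"
      using continuous_openin_preimage[OF assms(1) _ open_chart[OF c(1)]] assms(2) by blast
    then obtain T where "open T" "?Q \<inter> h -` U c = ?Q \<inter> T"
      by (auto simp: openin_open)
    then have "T \<in> \<C>" "z \<in> T" using c z unfolding \<C>_def by auto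
    then show "z \<in> \<Union>\<C>" by blast
  qed
  have "\<C> \<noteq> {}"
  proof
    assume "\<C> = {}" then have "?Q \<subseteq> {}" using cov by simp
    moreover have "(0,0) \<in> ?Q" by simp
    ultimately show False by blast
  qed
  then obtain \<delta> where \<delta>: "0 < \<delta>" "\<And>T. T \<subseteq> ?Q \<Longrightarrow> diameter T < \<delta> \<Longrightarrow> \<exists>B\<in>\<C>. T \<subseteq> B"
  proof -
    have "\<And>B. B \<in> \<C> \<Longrightarrow> open B" unfolding \<C>_def by blast
    then show ?thesis
      using Lebesgue_number_lemma[OF compact_Times[OF compact_Icc compact_Icc] \<open>\<C> \<noteq> {}\<close> cov] that by blast
  qed
  \<comment> \<open>A subsquare of side \<open>1 / n\<close> has diameter at most the sum of two
    sides, whence \<open>2 / n\<close>.\<close>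
  obtain n :: nat where n: "0 < n" "2 / n < \<delta>"
  proof -
    obtain n :: nat where "2 / \<delta> < n" using reals_Archimedean2 by blast
    moreover then have "0 < real n" using \<delta>(1) by (meson divide_pos_pos less_trans zero_less_numeral)
    ultimately show thesis using that[of n] \<delta>(1) by (simp add: divide_simps mult.commute)
  qed
  have "\<exists>c\<in>I. h ` ({i / n..Suc i / n} \<times> {j / n..Suc j / n}) \<subseteq> U c" if "i < n" "j < n" for i j
  proof -
    let ?T = "{i / n..Suc i / n} \<times> {j / n..Suc j / n}"
    have "Suc i / n \<le> 1" "Suc j / n \<le> 1" "0 \<le> i / n" "0 \<le> j / n"
      using that n by (auto simp: divide_simps)
    then have sub: "?T \<subseteq> ?Q" by (intro Sigma_mono) (auto simp del: of_nat_Suc)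
    have "diameter ?T \<le> 2 / n"
    proof (rule diameter_le)
      show "norm (x - y) \<le> 2 / n" if "x \<in> ?T" "y \<in> ?T" for x y
      proof -
        have w: "real (Suc i) / n = i / n + 1 / n" "real (Suc j) / n = j / n + 1 / n"
          by (simp_all add: add_divide_distrib)
        have "\<bar>fst x - fst y\<bar> \<le> 1 / n" "\<bar>snd x - snd y\<bar> \<le> 1 / n"
          using that unfolding w mem_Times_iff atLeastAtMost_iff by linarith+
        then show ?thesis
          using norm_Pair_le[of "fst x - fst y" "snd x - snd y"] by (simp add: minus_prod_def)
      qed
    qed (use n in auto)
    then obtain B where "B \<in> \<C>" "?T \<subseteq> B" using \<delta>(2)[OF sub] n by (meson le_less_trans)
    then show ?thesis using sub unfolding \<C>_def by blast
  qed
  then show thesis using that n(1) by blast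
qed

lemma fits_exists:
  assumes "path p" "path_image p \<subseteq> S"
  obtains n where "fits p n"
proof -
  \<comment> \<open>The path is viewed as a homotopy constant in its first variable, so that the
    subdivision of the square also serves for paths.\<close>
  define h where "h = (\<lambda>z::real\<times>real. p (snd z))"
  have a: "continuous_on ({0..1} \<times> {0..1}) h"
    using assms(1) unfolding path_def h_def by (rule continuous_on_compose2) (auto intro!: continuous_intros)
  have b: "h ` ({0..1} \<times> {0..1}) \<subseteq> S"
    using assms(2) unfolding path_image_def h_def by auto
  obtain n :: nat where n: "0 < n" "\<And>i j. i < n \<Longrightarrow> j < n \<Longrightarrow>
      \<exists>c\<in>I. h ` ({i / n..Suc i / n} \<times> {j / n..Suc j / n}) \<subseteq> U c"
    by (rule square_subdivision[OF a b]) (erule that, blast)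
  have "small p (j / n) (Suc j / n)" if "j < n" for j
  proof -
    have "p ` {j / n..Suc j / n} \<subseteq> h ` ({0 / n..Suc 0 / n} \<times> {j / n..Suc j / n})"
    proof clarify
      fix x assume "x \<in> {j / n..Suc j / n}"
      then show "p x \<in> h ` ({0 / n..Suc 0 / n} \<times> {j / n..Suc j / n})"
        by (intro image_eqI[of _ _ "(0, x)"]) (auto simp: h_def)
    qed
    then show ?thesis using n(2)[OF n(1) that] unfolding small_def of_nat_0 by (meson order_trans)
  qed
  then show thesis using that n(1) unfolding fits_def by blast
qed

lemma holonomy_closed: "path p \<Longrightarrow> path_image p \<subseteq> S \<Longrightarrow> holonomy p \<in> carrier K"
  by (metis dev_closed fits_exists holonomy_eq le_refl)

lemma holonomy_chart:
  assumes "path p" "c \<in> I" "path_image p \<subseteq> U c"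
  shows "holonomy p = inv (d c (pathstart p)) \<otimes> d c (pathfinish p)"
proof -
  have "fits p 1" using assms unfolding fits_def small_def path_image_def by auto
  then have "holonomy p = \<one> \<otimes> seg p 0 1" using holonomy_eq[OF assms(1), of 1] by simp
  moreover have "seg p 0 1 = inv (d c (p 0)) \<otimes> d c (p 1)"
    using assms unfolding path_def path_image_def by (intro seg_eq) auto
  moreover have "p 0 \<in> U c" "p 1 \<in> U c" using assms(3) unfolding path_image_def by auto
  ultimately show ?thesis
    using potential_closed[OF assms(2)] by (simp add: pathstart_def pathfinish_def)
qed

lemma joinpaths_image:
  fixes k n :: nat
  assumes "pathfinish p = pathstart q" "k < n"
  shows "(p +++ q) ` {k / (2 * n)..Suc k / (2 * n)} = p ` {k / n..Suc k / n}"
    "(p +++ q) ` {(n + k) / (2 * n)..Suc (n + k) / (2 * n)} = q ` {k / n..Suc k / n}"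
proof -
  have n: "0 < real n" "real (Suc k) \<le> n" using assms by auto
  have e: "{k / n..Suc k / n} = (\<lambda>x. 2 * x + 0) ` {k / (2 * n)..Suc k / (2 * n)}"
    unfolding image_affinity_atLeastAtMost using n(1) by (auto simp: field_simps)
  have f: "(p +++ q) x = p (2 * x + 0)" if "x \<in> {k / (2 * n)..Suc k / (2 * n)}" for x
  proof -
    have "real (Suc k) / (2 * n) \<le> 1 / 2" using n by (simp add: divide_simps)
    then show ?thesis using that by (simp add: joinpaths_def del: of_nat_Suc)
  qed
  show "(p +++ q) ` {k / (2 * n)..Suc k / (2 * n)} = p ` {k / n..Suc k / n}"
    unfolding e image_image using f by (rule image_cong[OF refl])
  have e: "{k / n..Suc k / n} = (\<lambda>x. 2 * x + (- 1)) ` {(n + k) / (2 * n)..Suc (n + k) / (2 * n)}"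
    unfolding image_affinity_atLeastAtMost using n by (auto simp: field_simps)
  have f: "(p +++ q) x = q (2 * x + (- 1))" if "x \<in> {(n + k) / (2 * n)..Suc (n + k) / (2 * n)}" for x
  proof -
    have "1 / 2 \<le> (n + k) / (2 * n)" using n by (simp add: divide_simps)
    then have "1 / 2 \<le> x" using that by (meson atLeastAtMost_iff order_trans)
    \<comment> \<open>At \<open>1 / 2\<close> the join is defined by \<open>p\<close>; the common
      endpoint turns this into the value of \<open>q\<close>.\<close>
    then consider "x = 1 / 2" | "1 / 2 < x" by linarith
    then show ?thesis
    proof cases
      case 1
      show ?thesis using assms(1) unfolding 1 by (simp add: joinpaths_def pathfinish_def pathstart_def)
    qed (simp add: joinpaths_def)
  qed
  show "(p +++ q) ` {(n + k) / (2 * n)..Suc (n + k) / (2 * n)} = q ` {k / n..Suc k / n}"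
    unfolding e image_image using f by (rule image_cong[OF refl])
qed

lemma holonomy_join:
  assumes p: "path p" "path_image p \<subseteq> S" and q: "path q" "path_image q \<subseteq> S"
    and pq: "pathfinish p = pathstart q"
  shows "holonomy (p +++ q) = holonomy p \<otimes> holonomy q"
proof -
  obtain n1 n2 where "fits p n1" "fits q n2" using fits_exists p q by metis
  then obtain n where n: "fits p n" "fits q n"
  proof -
    assume f: "fits p n1" "fits q n2"
    then have "0 < n1" "0 < n2" unfolding fits_def by auto
    then show thesis using that[of "n1 * n2"] fits_refine[OF f(1)] fits_refine[OF f(2), of n1]
      by (simp add: mult.commute)
  qed
  then have n0: "0 < n" unfolding fits_def by auto
  note im = joinpaths_image[OF pq]
  have f: "fits (p +++ q) (2 * n)"
    unfolding fits_def
  proof (intro conjI allI impI)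
    fix k assume k: "k < 2 * n"
    show "small (p +++ q) (k / real (2 * n)) (Suc k / real (2 * n))"
    proof (cases "k < n")
      case True
      then show ?thesis using im(1)[OF True] n(1) unfolding fits_def small_def by simp
    next
      case False
      define j where "j = k - n"
      have "j < n" "k = n + j" using k False unfolding j_def by auto
      then show ?thesis using im(2)[of j n] n(2) unfolding fits_def small_def by simp
    qed
  qed (use n0 in simp)
  have s1: "seg (p +++ q) (k / real (2 * n)) (Suc k / real (2 * n)) = seg p (k / n) (Suc k / n)" if "k < n" for k
  proof (rule seg_cong)
    have "2 * (k / real (2 * n)) = k / n" "2 * (Suc k / real (2 * n)) = Suc k / n"
      "k / real (2 * n) \<le> 1 / 2" "Suc k / real (2 * n) \<le> 1 / 2"
      using that n0 by (auto simp: divide_simps)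
    then show "(p +++ q) (k / real (2 * n)) = p (k / n)"
      "(p +++ q) (Suc k / real (2 * n)) = p (Suc k / n)"
      by (auto simp: joinpaths_def simp del: of_nat_Suc)
  qed (use im(1)[OF that] in simp)
  have s2: "seg (p +++ q) ((n + k) / real (2 * n)) (Suc (n + k) / real (2 * n)) = seg q (k / n) (Suc k / n)" if "k < n" for k
  proof (rule seg_cong)
    have e: "2 * ((n + k) / real (2 * n)) - 1 = k / n" "2 * (Suc (n + k) / real (2 * n)) - 1 = Suc k / n"
      "1 / 2 < Suc (n + k) / real (2 * n)" "1 / 2 \<le> (n + k) / real (2 * n)"
      using that n0 by (auto simp: divide_simps)
    have p1: "p 1 = q 0" using pq by (simp add: pathstart_def pathfinish_def)
    show "(p +++ q) ((n + k) / real (2 * n)) = q (k / n)"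
    proof (cases "(n + k) / real (2 * n) = 1/2")
      case True
      then have "k / n = 0" using e(1) by simp
      then show ?thesis using p1 n0 unfolding joinpaths_def True by auto
    next
      case False
      then have "\<not> (n + k) / real (2 * n) \<le> 1/2" using e(4) by linarith
      then show ?thesis unfolding joinpaths_def by (simp only: if_False e(1))
    qed
    have "\<not> Suc (n + k) / real (2 * n) \<le> 1/2" using e(3) by linarith
    then show "(p +++ q) (Suc (n + k) / real (2 * n)) = q (Suc k / n)"
      unfolding joinpaths_def by (simp only: if_False e(2))
  qed (use im(2)[OF that] in simp)
  have d1: "dev (p +++ q) (2 * n) k = dev p n k" if "k \<le> n" for k
    using that by (induction k) (use s1 in auto)
  have d2: "dev (p +++ q) (2 * n) (n + k) = dev p n n \<otimes> dev q n k" if "k \<le> n" for k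
    using that
  proof (induction k)
    case 0 then show ?case using d1 dev_closed[OF n(1)] by simp
  next
    case (Suc k)
    then have "seg q (k / n) (Suc k / n) \<in> carrier K"
      using n(2) unfolding fits_def by (intro seg_closed) (auto simp: divide_right_mono)
    then show ?case using Suc s2[of k] dev_closed[OF n(1), of n] dev_closed[OF n(2), of k]
      by (simp add: m_assoc)
  qed
  have "path (p +++ q)" using p q pq by simp
  then show ?thesis
    using holonomy_eq[OF _ f] holonomy_eq[OF p(1) n(1)] holonomy_eq[OF q(1) n(2)] d2[of n]
    by (simp add: mult_2)
qed

text \<open>On a fine grid every small square lies in one chart, so the development round its
  boundary is trivial. A strip of squares compares two neighbouring rows of the homotopy, and the
  outer columns contribute nothing because the endpoints stay fixed.\<close>

lemma holonomy_homotopic: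
  assumes "homotopic_paths S p q"
  shows "holonomy p = holonomy q"
proof -
  obtain h :: "real \<times> real \<Rightarrow> 's" where "continuous_on ({0..1} \<times> {0..1}) h" "h \<in> {0..1} \<times> {0..1} \<rightarrow> S"
    "\<forall>x\<in>{0..1}. h (0, x) = p x" "\<forall>x\<in>{0..1}. h (1, x) = q x"
    "\<forall>t\<in>{0..1}. pathstart (h \<circ> Pair t) = pathstart p \<and> pathfinish (h \<circ> Pair t) = pathfinish p"
    using assms unfolding homotopic_paths by blast
  then have h: "continuous_on ({0..1} \<times> {0..1}) h" "h ` ({0..1} \<times> {0..1}) \<subseteq> S"
    "\<And>x. x \<in> {0..1} \<Longrightarrow> h (0, x) = p x" "\<And>x. x \<in> {0..1} \<Longrightarrow> h (1, x) = q x"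
    "\<And>t. t \<in> {0..1} \<Longrightarrow> h (t, 0) = pathstart p \<and> h (t, 1) = pathfinish p"
    by (simp_all add: image_subset_iff_funcset pathstart_def pathfinish_def)
  obtain n :: nat where n: "0 < n" "\<And>i j. i < n \<Longrightarrow> j < n \<Longrightarrow>
      \<exists>c\<in>I. h ` ({i / n..Suc i / n} \<times> {j / n..Suc j / n}) \<subseteq> U c"
    by (rule square_subdivision[OF h(1,2)]) (erule that, blast)
  let ?row = "\<lambda>t x. h (t, x)" and ?col = "\<lambda>x t. h (t, x)"
  have st: "real i / n \<in> {0..1}" if "i \<le> n" for i using that n(1) by (simp add: divide_simps)
  have iv: "{i / n..Suc i / n} \<subseteq> {0..1}" if "i < n" for i
  proof -
    have "Suc i / n \<le> 1" "0 \<le> i / n" using that n(1) by (auto simp: divide_simps)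
    then show ?thesis by (auto simp del: of_nat_Suc)
  qed
  have le: "i / n \<le> Suc i / n" for i by (intro divide_right_mono) auto
  have crow: "continuous_on A (?row t)" if "t \<in> {0..1}" "A \<subseteq> {0..1}" for t A
    using that by (intro continuous_on_compose2[OF h(1)] continuous_intros) auto
  have ccol: "continuous_on A (?col x)" if "x \<in> {0..1}" "A \<subseteq> {0..1}" for x A
    using that by (intro continuous_on_compose2[OF h(1)] continuous_intros) auto
  have fits_row: "fits (?row (i / n)) n" if "i \<le> n" for i
    unfolding fits_def small_def
  proof (intro conjI allI impI)
    fix j assume "j < n"
    \<comment> \<open>The last row \<open>i = n\<close> starts no square; it is the far side of
      square \<open>n - 1\<close>.\<close>
    obtain i' where i': "i' < n" "i / n \<in> {i' / n..Suc i' / n}"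
    proof (cases "i < n")
      case True then show ?thesis using that le by auto
    next
      case False
      then show ?thesis using \<open>i \<le> n\<close> n(1) le[of "n - 1"] that[of "n - 1"] by auto
    qed
    obtain c where c: "c \<in> I" "h ` ({i' / n..Suc i' / n} \<times> {j / n..Suc j / n}) \<subseteq> U c"
      using n(2)[OF i'(1) \<open>j < n\<close>] by blast
    have "?row (i / n) ` {j / n..Suc j / n} \<subseteq> h ` ({i' / n..Suc i' / n} \<times> {j / n..Suc j / n})"
      using i'(2) by blast
    with c show "\<exists>c\<in>I. ?row (i / n) ` {j / n..Suc j / n} \<subseteq> U c" by blast
  qed (use n in simp)
  have smallcol: "small (?col (j / n)) (i / n) (Suc i / n)" if "i < n" "j \<le> n" for i j
  proof -
    obtain j' where j': "j' < n" "j / n \<in> {j' / n..Suc j' / n}"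
    proof (cases "j < n")
      case True then show ?thesis using that le by auto
    next
      case False
      then show ?thesis using \<open>j \<le> n\<close> n(1) le[of "n - 1"] that[of "n - 1"] by auto
    qed
    obtain c where c: "c \<in> I" "h ` ({i / n..Suc i / n} \<times> {j' / n..Suc j' / n}) \<subseteq> U c"
      using n(2)[OF \<open>i < n\<close> j'(1)] by blast
    have "?col (j / n) ` {i / n..Suc i / n} \<subseteq> h ` ({i / n..Suc i / n} \<times> {j' / n..Suc j' / n})"
      using j'(2) by blast
    with c show ?thesis unfolding small_def by blast
  qed
  have colcl: "seg (?col (j / n)) (i / n) (Suc i / n) \<in> carrier K" if "i < n" "j \<le> n" for i j
    using smallcol[OF that] le by (intro seg_closed) auto
  have square: "seg (?row (i / n)) (j / n) (Suc j / n) \<otimes> seg (?col (Suc j / n)) (i / n) (Suc i / n)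
      = seg (?col (j / n)) (i / n) (Suc i / n) \<otimes> seg (?row (Suc i / n)) (j / n) (Suc j / n)"
    if ij: "i < n" "j < n" for i j
  proof -
    let ?a = "i / n" and ?a' = "Suc i / n" and ?b = "j / n" and ?b' = "Suc j / n"
    obtain c where c: "c \<in> I" "h ` ({?a..?a'} \<times> {?b..?b'}) \<subseteq> U c"
      using n(2)[OF ij] by blast
    have m: "?a \<in> {?a..?a'}" "?a' \<in> {?a..?a'}" "?b \<in> {?b..?b'}" "?b' \<in> {?b..?b'}" using le by auto
    have U: "?row ?a ` {?b..?b'} \<subseteq> U c" "?row ?a' ` {?b..?b'} \<subseteq> U c"
      "?col ?b ` {?a..?a'} \<subseteq> U c" "?col ?b' ` {?a..?a'} \<subseteq> U c"
      using c(2) m by blast+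
    have "h (?a, ?b) \<in> U c" "h (?a', ?b) \<in> U c" "h (?a, ?b') \<in> U c" "h (?a', ?b') \<in> U c"
      using c(2) m by blast+
    note cl = this[THEN potential_closed[OF c(1)]]
    have m01: "?a \<in> {0..1}" "?a' \<in> {0..1}" "?b \<in> {0..1}" "?b' \<in> {0..1}"
      using st[of i] st[of "Suc i"] st[of j] st[of "Suc j"] ij by auto
    show ?thesis
      using seg_eq[OF le c(1) crow[OF m01(1) iv[OF ij(2)]] U(1)]
        seg_eq[OF le c(1) crow[OF m01(2) iv[OF ij(2)]] U(2)]
        seg_eq[OF le c(1) ccol[OF m01(3) iv[OF ij(1)]] U(3)]
        seg_eq[OF le c(1) ccol[OF m01(4) iv[OF ij(1)]] U(4)] cl
      by (simp add: m_assoc)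
  qed
  \<comment> \<open>Commuting past \<open>j\<close> squares: along row \<open>i\<close> and then
    across equals across at column \<open>0\<close> and then along row \<open>i + 1\<close>.\<close>
  have rows: "dev (?row (i / n)) n j \<otimes> seg (?col (j / n)) (i / n) (Suc i / n)
      = seg (?col (0 / n)) (i / n) (Suc i / n) \<otimes> dev (?row (Suc i / n)) n j"
    if "i < n" "j \<le> n" for i j
    using that(2)
  proof (induction j)
    case 0 then show ?case using colcl[of i 0] that(1) by simp
  next
    case (Suc j)
    let ?r = "\<lambda>i. seg (?row (i / n)) (j / n) (Suc j / n)"
    have cl: "?r i \<in> carrier K" "?r (Suc i) \<in> carrier K"
      using fits_row[of i] fits_row[of "Suc i"] that Suc(2) le unfolding fits_def
      by (auto intro!: seg_closed simp del: of_nat_Suc)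
    have "dev (?row (i / n)) n (Suc j) \<otimes> seg (?col (Suc j / n)) (i / n) (Suc i / n)
      = dev (?row (i / n)) n j \<otimes> (?r i \<otimes> seg (?col (Suc j / n)) (i / n) (Suc i / n))"
      using cl colcl[of i "Suc j"] dev_closed[OF fits_row[of i], of j] that Suc
      by (simp add: m_assoc del: of_nat_Suc)
    also have "\<dots> = (dev (?row (i / n)) n j \<otimes> seg (?col (j / n)) (i / n) (Suc i / n)) \<otimes> ?r (Suc i)"
      unfolding square[OF that(1), of j, OF Suc_le_lessD[OF Suc.prems]]
      using cl colcl[of i j] dev_closed[OF fits_row[of i], of j] that(1) Suc(2)
      by (simp add: m_assoc del: of_nat_Suc)
    also have "\<dots> = seg (?col (0 / n)) (i / n) (Suc i / n) \<otimes> dev (?row (Suc i / n)) n (Suc j)"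
      using Suc cl colcl[of i 0] dev_closed[OF fits_row[of "Suc i"], of j] that
      by (simp add: m_assoc del: of_nat_Suc)
    finally show ?case .
  qed
  have ends: "seg (?col (0 / n)) (i / n) (Suc i / n) = \<one>" "seg (?col (n / n)) (i / n) (Suc i / n) = \<one>"
    if "i < n" for i
    using smallcol[OF that, of 0] smallcol[OF that, of n] le st[of i] st[of "Suc i"] n(1) that h(5)
      ccol[of 0, OF _ iv[OF that]] ccol[of 1, OF _ iv[OF that]]
    by (auto intro!: seg_const simp del: of_nat_Suc)
  have step: "dev (?row (i / n)) n n = dev (?row (Suc i / n)) n n" if "i < n" for i
    using rows[OF that le_refl] ends[OF that] dev_closed[OF fits_row[of i], of n]
      dev_closed[OF fits_row[of "Suc i"], of n] that by simp
  have "dev (?row (i / n)) n n = dev (?row (0 / n)) n n" if "i \<le> n" for i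
    using that by (induction i) (use step in auto)
  from this[of n] have eq: "dev (?row 1) n n = dev (?row 0) n n" using n(1) by simp
  \<comment> \<open>\<open>h\<close> agrees with \<open>p\<close> and \<open>q\<close> only on the
    unit interval, so the developments are compared there.\<close>
  have devcong: "fits r n \<and> dev r n n = dev r' n n" if r: "fits r' n" "\<And>x. x \<in> {0..1} \<Longrightarrow> r' x = r x" for r r'
  proof -
    have im: "r' ` {k / n..Suc k / n} = r ` {k / n..Suc k / n}" if "k < n" for k
      using iv[OF that] r(2) by (intro image_cong refl) blast
    have "seg r (k / n) (Suc k / n) = seg r' (k / n) (Suc k / n)" if "k < n" for k
      using im[OF that] r(2)[of "k / n"] r(2)[of "Suc k / n"] st[of k] st[of "Suc k"] that
      by (intro seg_cong) (auto simp del: of_nat_Suc)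
    then have "k \<le> n \<Longrightarrow> dev r n k = dev r' n k" for k by (induction k) auto
    then show ?thesis using r(1) im unfolding fits_def small_def by auto
  qed
  have p: "fits p n \<and> dev p n n = dev (?row 0) n n" using devcong[OF _ h(3)] fits_row[of 0] by auto
  have q: "fits q n \<and> dev q n n = dev (?row 1) n n" using devcong[OF _ h(4)] fits_row[of n] n(1) by auto
  have "path p" "path q" using assms homotopic_paths_imp_path by auto
  then show ?thesis using p q eq holonomy_eq by metis
qed

text \<open>The uniqueness half of the van Kampen argument: every path is homotopic to the join of
  its small pieces, so the values on paths inside charts determine a functor. Two functors are
  compared later by checking this hypothesis for both.\<close>

lemma path_functor_eq_holonomy:
  assumes "path_functor K S v"
    and chart: "\<And>c p. c \<in> I \<Longrightarrow> path p \<Longrightarrow> path_image p \<subseteq> U c \<Longrightarrow>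
      v p = inv (d c (pathstart p)) \<otimes> d c (pathfinish p)"
    and p: "path p" "path_image p \<subseteq> S"
  shows "v p = holonomy p"
proof -
  interpret v: path_functor K S v by fact
  obtain n where n: "fits p n" using fits_exists[OF p] by blast
  then have n0: "0 < n" unfolding fits_def by simp
  define sub where "sub a b = p \<circ> linepath a b" for a b :: real
  have im: "path_image (linepath a b) \<subseteq> {0..1}" if "a \<in> {0..1}" "b \<in> {0..1}" for a b :: real
    using that unfolding path_image_linepath by (intro closed_segment_subset) auto
  have sp: "path (sub a b)" "path_image (sub a b) \<subseteq> S" if "a \<in> {0..1}" "b \<in> {0..1}" for a b
  proof -
    show "path (sub a b)" unfolding sub_def
      using p(1) im[OF that] by (intro path_continuous_image) (auto simp: path_def elim: continuous_on_subset)
    show "path_image (sub a b) \<subseteq> S" unfolding sub_def path_image_compose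
      using p(2) im[OF that] by (auto simp: path_image_def)
  qed
  have ends: "pathstart (sub a b) = p a" "pathfinish (sub a b) = p b" for a b
    by (simp_all add: sub_def pathstart_compose pathfinish_compose)
  have seg: "v (sub a b) = seg p a b" if ab: "0 \<le> a" "a \<le> b" "b \<le> 1" "small p a b" for a b
  proof -
    obtain c where c: "c \<in> I" "p ` {a..b} \<subseteq> U c" using ab unfolding small_def by auto
    have "continuous_on {a..b} p" using p(1) ab unfolding path_def by (auto elim: continuous_on_subset)
    moreover have "path_image (sub a b) \<subseteq> U c"
      using c(2) ab by (simp add: sub_def path_image_compose closed_segment_eq_real_ivl)
    ultimately show ?thesis
      using seg_eq[OF ab(2) c(1) _ c(2)] chart[OF c(1), of "sub a b"] sp[of a b] ab ends by simp
  qed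
  have "k \<le> n \<Longrightarrow> v (sub 0 (k / n)) = dev p n k" for k
  proof (induction k)
    case 0
    have "small p (real 0 / n) (Suc 0 / n)" using n n0 unfolding fits_def by blast
    then have "small p 0 0" by (rule small_subset) simp
    then show ?case using seg[of 0 0] seg_const[of 0 0 p] by simp
  next
    case (Suc k)
    have b: "0 \<le> k / n" "k / n \<le> Suc k / n" "Suc k / n \<le> 1"
      using Suc.prems by (auto simp: divide_simps)
    have sm: "small p (k / n) (Suc k / n)" using n Suc.prems unfolding fits_def by auto
    have m: "0 \<in> {0..1::real}" "k / n \<in> {0..1}" "Suc k / n \<in> {0..1}"
      using b by (auto simp del: of_nat_Suc)
    have "homotopic_paths S (p \<circ> (linepath 0 (k / n) +++ linepath (k / n) (Suc k / n))) (p \<circ> linepath 0 (Suc k / n))"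
      using p im[OF m(1,2)] im[OF m(2,3)] im[OF m(1,3)]
      by (intro homotopic_paths_interval_reparametrization) (simp_all add: path_image_join del: of_nat_Suc)
    then have "v (sub 0 (Suc k / n)) = v (sub 0 (k / n) +++ sub (k / n) (Suc k / n))"
      unfolding sub_def by (metis v.homotopic path_compose_join)
    also have "\<dots> = v (sub 0 (k / n)) \<otimes> v (sub (k / n) (Suc k / n))"
      using sp[OF m(1,2)] sp[OF m(2,3)] ends by (intro v.join) auto
    finally show ?case using Suc seg[OF b sm] by simp
  qed
  from this[of n] have "v (sub 0 1) = holonomy p" using n0 holonomy_eq[OF p(1) n] by simp
  moreover have "sub 0 1 = p" by (auto simp: sub_def fun_eq_iff linepath_def)
  ultimately show ?thesis by simp
qed

lemma path_functor_holonomy: "path_functor K S holonomy"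
  by unfold_locales (auto intro: holonomy_closed holonomy_join holonomy_homotopic)

end

section \<open>Path functors and the fundamental group\<close>

context path_functor
begin

lemma const: "x \<in> S \<Longrightarrow> u (\<lambda>_. x) = \<one>"
proof -
  assume "x \<in> S"
  note x = path_const(1) path_const(2)[OF this]
  have "(\<lambda>_. x) +++ (\<lambda>_. x) = (\<lambda>_::real. x)" by (simp add: joinpaths_def)
  then have "u (\<lambda>_. x) = u (\<lambda>_. x) \<otimes> u (\<lambda>_. x)"
    using join[OF x x] by (simp add: path_const)
  then show ?thesis using closed[OF x] by simp
qed

lemma cong: "path p \<Longrightarrow> path_image p \<subseteq> S \<Longrightarrow> (\<And>t. t \<in> {0..1} \<Longrightarrow> p t = q t) \<Longrightarrow> u p = u q"
  by (intro homotopic homotopic_paths_eq)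

lemma reverse:
  assumes "path p" "path_image p \<subseteq> S"
  shows "u (reversepath p) = inv (u p)"
proof -
  have "u p \<otimes> u (reversepath p) = u (\<lambda>_. pathstart p)"
    using homotopic[OF homotopic_paths_reversepath_right[OF assms]] join[of p "reversepath p"] assms by simp
  also have "\<dots> = \<one>" using assms by (intro const) (auto intro: pathstart_in_path_image)
  finally show ?thesis
    using closed assms by (metis inv_equality inv_closed inv_inv path_image_reversepath path_reversepath)
qed

text \<open>The square \<open>(s, l) \<mapsto> h (l, p s)\<close> has \<open>p\<close> on one side,
  the tracks of the endpoints on the adjacent sides and the constant path at \<open>c\<close> on the
  last. So over a contractible chart \<open>u\<close> has a potential, the inverse of its value
  along the track.\<close>

lemma contraction:
  assumes h: "continuous_on ({0..1} \<times> V) h" "h ` ({0..1} \<times> V) \<subseteq> S"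
    and h0: "\<And>y. y \<in> V \<Longrightarrow> h (0, y) = y" and h1: "\<And>y. y \<in> V \<Longrightarrow> h (1, y) = c"
    and p: "path p" "path_image p \<subseteq> V"
  shows "u p = u (\<lambda>t. h (t, pathstart p)) \<otimes> inv (u (\<lambda>t. h (t, pathfinish p)))"
proof -
  define k where "k = (\<lambda>z::real\<times>real. h (snd z, p (fst z)))"
  let ?Q = "{0..1::real} \<times> {0..1::real}"
  have pV: "p s \<in> V" if "s \<in> {0..1}" for s using p(2) that unfolding path_image_def by auto
  have "continuous_on ?Q (\<lambda>z. p (fst z))"
    using p(1) unfolding path_def by (rule continuous_on_compose2) (auto intro!: continuous_intros)
  then have ck: "continuous_on ?Q k"
    unfolding k_def using pV
    by (intro continuous_on_compose2[OF h(1)] continuous_intros) auto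
  have kS: "k \<in> ?Q \<rightarrow> S" using h(2) pV unfolding k_def by auto
  define e where "e = (\<lambda>a b :: real \<times> real. k \<circ> linepath a b)"
  have seg: "path_image (linepath a b) \<subseteq> ?Q" if "a \<in> ?Q" "b \<in> ?Q" for a b
    using that by (simp add: closed_segment_subset convex_Times)
  have e: "path (e a b)" "path_image (e a b) \<subseteq> S" if "a \<in> ?Q" "b \<in> ?Q" for a b
    unfolding e_def using seg[OF that] ck kS
    by (auto simp: path_image_compose intro!: path_continuous_image elim: continuous_on_subset)
  have ee: "pathstart (e a b) = k a" "pathfinish (e a b) = k b" for a b
    unfolding e_def by (simp_all add: pathstart_compose pathfinish_compose)
  have "homotopic_paths ?Q (linepath (0,0) (1,0) +++ linepath (1,0) (1,1)) (linepath (0,0) (0,1) +++ linepath (0,1) (1,1))"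
  proof (rule homotopic_paths_linear)
    fix t :: real assume t: "t \<in> {0..1}"
    have "(linepath (0,0) (1,0) +++ linepath (1,0) (1,1)) t \<in> ?Q"
      "(linepath (0,0) (0,1) +++ linepath (0,1) (1,1)) t \<in> ?Q"
      using t by (auto simp: joinpaths_def linepath_def)
    then show "closed_segment ((linepath (0,0) (1,0) +++ linepath (1,0) (1,1)) t)
      ((linepath (0,0) (0,1) +++ linepath (0,1) (1,1)) t) \<subseteq> ?Q"
      by (simp add: closed_segment_subset convex_Times)
  qed auto
  then have "homotopic_paths S (e (0,0) (1,0) +++ e (1,0) (1,1)) (e (0,0) (0,1) +++ e (0,1) (1,1))"
    using homotopic_paths_continuous_image[OF _ ck kS] unfolding e_def by (metis path_compose_join)
  then have eq: "u (e (0,0) (1,0)) \<otimes> u (e (1,0) (1,1)) = u (e (0,0) (0,1)) \<otimes> u (e (0,1) (1,1))"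
    using homotopic join e ee by (metis (no_types, lifting) SigmaI atLeastAtMost_iff order_refl zero_le_one)
  have "u (e (0,0) (1,0)) = u p"
  proof (rule cong)
    show "e (0,0) (1,0) t = p t" if "t \<in> {0..1}" for t
      using h0[OF pV[OF that]] by (simp add: e_def k_def linepath_def)
  qed (rule e; simp)+
  moreover have "e (1,0) (1,1) = (\<lambda>t. h (t, pathfinish p))" "e (0,0) (0,1) = (\<lambda>t. h (t, pathstart p))"
    by (auto simp: fun_eq_iff e_def k_def linepath_def pathstart_def pathfinish_def)
  moreover have "u (e (0,1) (1,1)) = \<one>"
  proof -
    have "c \<in> S" using h(2) h1[OF pV[of 0]] pV[of 0] by force
    have "u (e (0,1) (1,1)) = u (\<lambda>_. c)"
    proof (rule cong)
      show "e (0,1) (1,1) t = c" if "t \<in> {0..1}" for t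
        using h1[OF pV[OF that]] by (simp add: e_def k_def linepath_def)
    qed (rule e; simp)+
    then show ?thesis using const[OF \<open>c \<in> S\<close>] by simp
  qed
  ultimately have "u p \<otimes> u (\<lambda>t. h (t, pathfinish p)) = u (\<lambda>t. h (t, pathstart p))"
    using eq closed e by (metis (no_types, lifting) SigmaI atLeastAtMost_iff order_refl r_one zero_le_one)
  moreover have "u (\<lambda>t. h (t, pathfinish p)) \<in> carrier K" "u p \<in> carrier K"
    using closed e \<open>e (1,0) (1,1) = _\<close> \<open>u (e (0,0) (1,0)) = u p\<close>
    by (metis (no_types, lifting) SigmaI atLeastAtMost_iff order_refl zero_le_one)+
  ultimately show ?thesis by (metis inv_solve_right m_closed)
qed

end

section \<open>Loop classes, and the functor of an abstract copy of the fundamental group\<close>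

lemma path_class_eq_iff:
  assumes "path p" "path_image p \<subseteq> S"
  shows "path_class S p = path_class S q \<longleftrightarrow> homotopic_paths S p q"
proof
  assume "path_class S p = path_class S q"
  moreover have "p \<in> path_class S p" using assms by (simp add: path_class_def)
  ultimately show "homotopic_paths S p q"
    by (simp add: path_class_def homotopic_paths_sym)
qed (auto simp: path_class_def intro: homotopic_paths_trans homotopic_paths_sym)

lemma fundamental_group_mult:
  assumes "p \<in> based_loops S x" "q \<in> based_loops S x"
  shows "path_class S p \<otimes>\<^bsub>fundamental_group S x\<^esub> path_class S q = path_class S (p +++ q)"
proof -
  have pq: "path (p +++ q)" "path_image (p +++ q) \<subseteq> S" "pathfinish p = pathstart q"
    using assms by (auto simp: based_loops_def path_image_join)
  have "path_class S (p' +++ q') = path_class S (p +++ q)"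
    if "p' \<in> path_class S p" "q' \<in> path_class S q" for p' q'
  proof -
    have "homotopic_paths S (p +++ q) (p' +++ q')"
      using that pq(3) by (intro homotopic_paths_join) (auto simp: path_class_def)
    then show ?thesis using path_class_eq_iff[OF pq(1,2)] by metis
  qed
  moreover have "p \<in> path_class S p" "q \<in> path_class S q"
    using assms by (auto simp: path_class_def based_loops_def)
  ultimately have "(\<Union>p'\<in>path_class S p. \<Union>q'\<in>path_class S q. path_class S (p' +++ q')) = path_class S (p +++ q)"
    by blast
  then show ?thesis by (simp add: fundamental_group_def)
qed

text \<open>Going back and forth along \<open>r\<close> changes nothing. With \<open>r\<close> the
  reference path to the joint of \<open>p\<close> and \<open>q\<close>, this makes the closing up of
  paths to loops multiplicative.\<close>

lemma homotopic_paths_insert_detour: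
  assumes a: "path a" "path_image a \<subseteq> S" and p: "path p" "path_image p \<subseteq> S"
    and r: "path r" "path_image r \<subseteq> S" and q: "path q" "path_image q \<subseteq> S"
    and b: "path b" "path_image b \<subseteq> S"
    and ends: "pathfinish a = pathstart p" "pathfinish p = pathfinish r" "pathstart q = pathfinish r"
      "pathfinish q = pathstart b"
  shows "homotopic_paths S (a +++ (p +++ q) +++ b) ((a +++ p +++ reversepath r) +++ (r +++ q +++ b))"
proof -
  let ?r = "reversepath r"
  note simps = path_image_join
  have qb: "path (q +++ b)" "path_image (q +++ b) \<subseteq> S" using q b ends by (auto simp: simps)
  note qb = qb q b
  have 1: "homotopic_paths S (?r +++ (r +++ q +++ b)) (q +++ b)"
  proof -
    have "homotopic_paths S (?r +++ (r +++ q +++ b)) ((?r +++ r) +++ q +++ b)"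
      using r qb ends by (intro homotopic_paths_assoc) auto
    also have "homotopic_paths S \<dots> ((\<lambda>_. pathfinish r) +++ q +++ b)"
      using homotopic_paths_reversepath_right[of ?r S] r qb ends by (intro homotopic_paths_join) auto
    also have "homotopic_paths S \<dots> (q +++ b)"
      using qb ends by (intro homotopic_paths_const_left) auto
    finally show ?thesis .
  qed
  have "homotopic_paths S ((a +++ p +++ ?r) +++ (r +++ q +++ b)) (a +++ (p +++ ?r) +++ (r +++ q +++ b))"
    using a p r qb ends by (intro homotopic_paths_sym[OF homotopic_paths_assoc]) (auto simp: simps)
  also have "homotopic_paths S \<dots> (a +++ p +++ (?r +++ (r +++ q +++ b)))"
    using a p r qb ends
    by (intro homotopic_paths_join homotopic_paths_sym[OF homotopic_paths_assoc]) (auto simp: simps)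
  also have "homotopic_paths S \<dots> (a +++ p +++ (q +++ b))"
    using a p ends by (intro homotopic_paths_join[OF _ homotopic_paths_join[OF _ 1]]) auto
  also have "homotopic_paths S \<dots> (a +++ (p +++ q) +++ b)"
    using a p q b ends by (intro homotopic_paths_join homotopic_paths_assoc) auto
  finally show ?thesis by (rule homotopic_paths_sym)
qed

text \<open>Paths are closed up to loops at \<open>x\<close> by reference paths
  \<open>\<tau> y\<close>, and the class is carried back to \<open>G\<close>. The last two
  conclusions record the bijectivity of the isomorphism: on loops \<open>u\<close> is onto
  \<open>G\<close> and detects homotopy.\<close>

lemma fundamental_group_path_functor:
  fixes S :: "'s::topological_space set"
  assumes "group G" "G \<cong> fundamental_group S x" "x \<in> S"
    and connected: "\<And>y. y \<in> S \<Longrightarrow> \<exists>p. path p \<and> path_image p \<subseteq> S \<and> pathstart p = x \<and> pathfinish p = y"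
  obtains u where "path_functor G S u" "\<And>h. h \<in> carrier G \<Longrightarrow> \<exists>p\<in>based_loops S x. u p = h"
    "\<And>p q. p \<in> based_loops S x \<Longrightarrow> q \<in> based_loops S x \<Longrightarrow> u p = u q \<Longrightarrow> homotopic_paths S p q"
proof -
  interpret G: group G by fact
  let ?F = "fundamental_group S x"
  obtain \<theta> where \<theta>: "\<theta> \<in> iso G ?F" using assms(2) unfolding is_iso_def by blast
  then have hom: "\<theta> \<in> hom G ?F" and bij: "bij_betw \<theta> (carrier G) (carrier ?F)"
    by (auto simp: iso_def)
  have cF: "carrier ?F = path_class S ` based_loops S x" by (simp add: fundamental_group_def)
  \<comment> \<open>A constant reference path at \<open>x\<close> ensures that closing up a loop
    does not change its class.\<close>
  let ?R = "\<lambda>y p. path p \<and> path_image p \<subseteq> S \<and> pathstart p = x \<and> pathfinish p = y \<and> (y = x \<longrightarrow> p = (\<lambda>_. x))"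
  have "\<forall>y\<in>S. \<exists>p. ?R y p"
  proof
    fix y assume "y \<in> S"
    then show "\<exists>p. ?R y p"
      using connected[of y] assms(3) by (cases "y = x") (auto simp: path_const)
  qed
  then obtain \<tau> where "\<forall>y\<in>S. ?R y (\<tau> y)" using bchoice[of S ?R] by blast
  then have \<tau>: "\<And>y. y \<in> S \<Longrightarrow> path (\<tau> y)" "\<And>y. y \<in> S \<Longrightarrow> path_image (\<tau> y) \<subseteq> S"
    "\<And>y. y \<in> S \<Longrightarrow> pathstart (\<tau> y) = x" "\<And>y. y \<in> S \<Longrightarrow> pathfinish (\<tau> y) = y" "\<tau> x = (\<lambda>_. x)"
    using assms(3) by auto
  define l where "l p = \<tau> (pathstart p) +++ p +++ reversepath (\<tau> (pathfinish p))" for p :: "real \<Rightarrow> 's"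
  have ends: "pathstart p \<in> S" "pathfinish p \<in> S" if "path_image p \<subseteq> S" for p :: "real \<Rightarrow> 's"
    using that by auto
  have l: "l p \<in> based_loops S x" if "path p" "path_image p \<subseteq> S" for p
    using that \<tau>(1-4) ends[OF that(2)] unfolding l_def based_loops_def by (simp add: path_image_join)
  define u where "u p = inv_into (carrier G) \<theta> (path_class S (l p))" for p
  have u: "u p \<in> carrier G" "\<theta> (u p) = path_class S (l p)" if "path p" "path_image p \<subseteq> S" for p
  proof -
    have "path_class S (l p) \<in> \<theta> ` carrier G" using bij l[OF that] unfolding cF bij_betw_def by auto
    then show "u p \<in> carrier G" "\<theta> (u p) = path_class S (l p)"
      unfolding u_def by (rule inv_into_into, rule f_inv_into_f)
  qed
  have ueqI: "u p = h" if "path p" "path_image p \<subseteq> S" "h \<in> carrier G" "\<theta> h = path_class S (l p)" for p h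
    using u[OF that(1,2)] that(3,4) bij unfolding bij_betw_def by (metis inj_onD)
  have lloop: "homotopic_paths S (l p) p" if "p \<in> based_loops S x" for p
  proof -
    have p: "path p" "path_image p \<subseteq> S" "pathstart p = x" "pathfinish p = x"
      using that by (auto simp: based_loops_def)
    have r: "homotopic_paths S (p +++ (\<lambda>_. x)) p" using p by (intro homotopic_paths_const_right)
    have "homotopic_paths S ((\<lambda>_. x) +++ p +++ (\<lambda>_. x)) ((\<lambda>_. x) +++ p)"
      using r p assms(3) by (intro homotopic_paths_join) (auto simp: path_const)
    also have "homotopic_paths S \<dots> p" using p by (intro homotopic_paths_const_left)
    finally show ?thesis unfolding l_def by (simp add: p \<tau>(5) path_const)
  qed
  have \<theta>loop: "\<theta> (u p) = path_class S p" if "p \<in> based_loops S x" for p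
  proof -
    have p: "path p" "path_image p \<subseteq> S" using that by (auto simp: based_loops_def)
    have "path_class S (l p) = path_class S p"
      using lloop[OF that] l[OF p] path_class_eq_iff[of "l p" S p] by (auto simp: based_loops_def)
    then show ?thesis using u[OF p] by simp
  qed
  show thesis
  proof (rule that)
    show "path_functor G S u"
    proof
      fix p q :: "real \<Rightarrow> 's" assume p: "path p" "path_image p \<subseteq> S" and q: "path q" "path_image q \<subseteq> S"
        and pq: "pathfinish p = pathstart q"
      have j: "path (p +++ q)" "path_image (p +++ q) \<subseteq> S" using p q pq by (auto simp: path_image_join)
      have "\<theta> (u p \<otimes>\<^bsub>G\<^esub> u q) = path_class S (l p) \<otimes>\<^bsub>?F\<^esub> path_class S (l q)"
        using hom_mult[OF hom] u[OF p] u[OF q] by simp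
      also have "\<dots> = path_class S (l p +++ l q)" by (rule fundamental_group_mult[OF l[OF p] l[OF q]])
      also have "\<dots> = path_class S (l (p +++ q))"
      proof -
        have "homotopic_paths S (l (p +++ q)) (l p +++ l q)"
          unfolding l_def using p q pq \<tau>(1-4) ends[OF p(2)] ends[OF q(2)]
          by (simp, intro homotopic_paths_insert_detour) auto
        then show ?thesis using l[OF j] path_class_eq_iff[of "l (p +++ q)" S "l p +++ l q"]
          by (auto simp: based_loops_def)
      qed
      finally show "u (p +++ q) = u p \<otimes>\<^bsub>G\<^esub> u q" using u[OF p] u[OF q] j by (intro ueqI) auto
    next
      fix p q :: "real \<Rightarrow> 's" assume h: "homotopic_paths S p q"
      then have p: "path p" "path_image p \<subseteq> S" and q: "path q" "path_image q \<subseteq> S"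
        and e: "pathstart p = pathstart q" "pathfinish p = pathfinish q"
        by (auto dest: homotopic_paths_imp_path homotopic_paths_imp_subset homotopic_paths_imp_pathstart
            homotopic_paths_imp_pathfinish)
      have "homotopic_paths S (l p) (l q)"
        unfolding l_def e using h q \<tau>(1-4) ends[OF q(2)] e
        by (intro homotopic_paths_join) auto
      then have "path_class S (l p) = path_class S (l q)"
        using l[OF p] path_class_eq_iff[of "l p" S "l q"] by (auto simp: based_loops_def)
      then show "u p = u q" unfolding u_def by simp
    qed (use u in auto)
    show "\<exists>p\<in>based_loops S x. u p = h" if "h \<in> carrier G" for h
    proof -
      have "\<theta> h \<in> carrier ?F" using bij that by (auto simp: bij_betw_def)
      then obtain p where p: "p \<in> based_loops S x" "\<theta> h = path_class S p" unfolding cF by auto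
      then have "\<theta> (u p) = \<theta> h" using \<theta>loop by simp
      moreover have "u p \<in> carrier G" using u p(1) by (auto simp: based_loops_def)
      ultimately have "u p = h" using bij that unfolding bij_betw_def by (metis inj_onD)
      then show ?thesis using p by blast
    qed
    show "homotopic_paths S p q" if "p \<in> based_loops S x" "q \<in> based_loops S x" "u p = u q" for p q
      using \<theta>loop[OF that(1)] \<theta>loop[OF that(2)] that path_class_eq_iff[of p S q] by (simp add: based_loops_def)
  qed
qed

section \<open>The boundary of the polygon and its sectors\<close>

text \<open>The boundary circle in units of one side: corner \<open>m\<close> sits at the integer
  \<open>m\<close>, side \<open>k\<close> is the interval from \<open>k\<close> to
  \<open>k + 1\<close>, and the period is \<open>4 * g\<close>.\<close>

definition rim :: "nat \<Rightarrow> real \<Rightarrow> complex"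
  where "rim g s = cis (2 * pi * s / (4 * real g))"

lemma norm_rim [simp]: "norm (rim g s) = 1"
  by (simp add: rim_def)

lemma rim_nonzero [simp]: "rim g s \<noteq> 0"
  by (simp add: rim_def)

lemma rim_add: "rim g (s + t) = rim g s * rim g t"
  by (simp add: rim_def cis_mult add_divide_distrib distrib_left)

lemma polygon_side_eq_rim: "polygon_side g k t = rim g (real k + t)"
  by (simp add: polygon_side_def rim_def)

lemma continuous_on_rim [continuous_intros]: "continuous_on A f \<Longrightarrow> continuous_on A (\<lambda>x. rim g (f x))"
  unfolding rim_def cis_conv_exp by (cases "g = 0") (auto intro!: continuous_intros)

definition turn_equiv :: "nat \<Rightarrow> real \<Rightarrow> real \<Rightarrow> bool"
  where "turn_equiv g s t \<longleftrightarrow> (\<exists>n::int. s = t + 4 * real g * of_int n)"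

lemma turn_equiv_refl [simp]: "turn_equiv g s s"
  unfolding turn_equiv_def by (rule exI[of _ 0]) simp

lemma turn_equiv_sym: "turn_equiv g s t \<Longrightarrow> turn_equiv g t s"
  unfolding turn_equiv_def by (metis add.inverse_inverse add_diff_cancel_right' diff_conv_add_uminus mult_minus_right of_int_minus)

lemma turn_equiv_nat_less:
  fixes m n :: nat
  assumes "turn_equiv g m n" "m < 4 * g" "n < 4 * g"
  shows "m = n"
proof -
  obtain l :: int where "real m = real n + 4 * real g * l" using assms(1) unfolding turn_equiv_def by auto
  then have "real_of_int (int m) = of_int (int n + 4 * int g * l)" by simp
  then have "int m = int n + 4 * int g * l" by linarith
  then have "int m mod (4 * int g) = int n mod (4 * int g)" by simp
  then show ?thesis using assms(2,3) by simp
qed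

locale polygon =
  fixes g :: nat
  assumes genus: "1 \<le> g"
begin

lemma rim_eq_iff: "rim g s = rim g t \<longleftrightarrow> turn_equiv g s t"
proof -
  have "rim g s = rim g t \<longleftrightarrow>
      (\<exists>n::int. 2 * pi * s / (4 * real g) = 2 * pi * t / (4 * real g) + 2 * pi * n)"
    using sin_cos_eq_iff[of "2 * pi * s / (4 * real g)" "2 * pi * t / (4 * real g)"]
    by (auto simp: rim_def complex_eq_iff)
  also have "\<dots> \<longleftrightarrow> (\<exists>n::int. s = t + 4 * real g * n)"
  proof -
    have "2 * pi * s / (4 * real g) = 2 * pi * t / (4 * real g) + 2 * pi * n \<longleftrightarrow> s = t + 4 * real g * n" for n :: int
    proof -
      have "2 * pi * t / (4 * real g) + 2 * pi * n = 2 * pi * (t + 4 * real g * n) / (4 * real g)"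
        using genus by (simp add: field_simps)
      then show ?thesis using genus by auto
    qed
    then show ?thesis by simp
  qed
  finally show ?thesis unfolding turn_equiv_def .
qed

lemma rim_scaled_eq:
  assumes "of_real r * rim g s = of_real r' * rim g t" "0 < r" "0 < r'"
  shows "r = r'" "turn_equiv g s t"
proof -
  have "norm (of_real r * rim g s) = norm (of_real r' * rim g t)" using assms(1) by simp
  then show "r = r'" using assms(2,3) by (simp add: norm_mult)
  then show "turn_equiv g s t" using assms rim_eq_iff by simp
qed

lemma turn_equiv_fract:
  fixes k l :: int and s t :: real
  assumes "turn_equiv g (k + s) (l + t)" "\<bar>s - t\<bar> < 1"
  shows "s = t" "turn_equiv g k l"
proof -
  obtain n :: int where n: "k + s = l + t + 4 * real g * n" using assms unfolding turn_equiv_def by auto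
  then have "s - t = of_int (l + 4 * int g * n - k)" by simp
  then have "l + 4 * int g * n - k = 0" using assms(2) by linarith
  then have "s - t = 0" using \<open>s - t = _\<close> by linarith
  then show "s = t" by simp
  then show "turn_equiv g k l" using n unfolding turn_equiv_def by auto
qed

lemma turn_equiv_nat_exists: "\<exists>m::nat. m < 4 * g \<and> turn_equiv g (real_of_int i) (real m)"
proof -
  define m where "m = nat (i mod (4 * int g))"
  have "0 \<le> i mod (4 * int g)" "i mod (4 * int g) < 4 * int g" using genus by auto
  then have m: "m < 4 * g" "int m = i mod (4 * int g)" unfolding m_def by linarith+
  have "i = int m + 4 * int g * (i div (4 * int g))" unfolding m(2) by simp
  then have "real_of_int i = real_of_int (int m + 4 * int g * (i div (4 * int g)))" by simp
  then have "turn_equiv g i m" unfolding turn_equiv_def by (intro exI[of _ "i div (4 * int g)"]) simp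
  then show ?thesis using m(1) by blast
qed

text \<open>The first sides of the glued pairs: side \<open>k\<close> is glued to side \<open>k + 2\<close>.\<close>

definition first_side :: "nat \<Rightarrow> bool"
  where "first_side k \<longleftrightarrow> k < 4 * g \<and> k mod 4 < 2"

lemma first_side_bound: "first_side k \<Longrightarrow> k + 3 \<le> 4 * g"
  unfolding first_side_def by presburger

text \<open>The partner of \<open>t\<close> on side \<open>k\<close> is \<open>1 - t\<close> on side
  \<open>k + 2\<close>, at the parameter \<open>k + 2 + (1 - t)\<close>. So both kinds of pairs are
  given by one reflection, \<open>s \<mapsto> 2 * k + 3 - s\<close>.\<close>

lemma side_pairing_iff:
  "side_pairing g z w \<longleftrightarrow> (\<exists>k t. first_side k \<and> 0 \<le> t \<and> t \<le> 1 \<and> z = rim g (real k + t) \<and> w = rim g (real k + 3 - t))"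
proof
  assume "side_pairing g z w"
  then show "\<exists>k t. first_side k \<and> 0 \<le> t \<and> t \<le> 1 \<and> z = rim g (real k + t) \<and> w = rim g (real k + 3 - t)"
  proof cases
    case (pair_a j t)
    then show ?thesis unfolding polygon_side_eq_rim
      by - (rule exI[of _ "4 * j"], rule exI[of _ t], auto simp: first_side_def algebra_simps)
  next
    case (pair_b j t)
    moreover have "(4 * j + 1) mod 4 = 1" by presburger
    ultimately show ?thesis unfolding polygon_side_eq_rim
      by - (rule exI[of _ "4 * j + 1"], rule exI[of _ t], auto simp: first_side_def algebra_simps)
  qed
next
  assume "\<exists>k t. first_side k \<and> 0 \<le> t \<and> t \<le> 1 \<and> z = rim g (real k + t) \<and> w = rim g (real k + 3 - t)"
  then obtain k t where k: "first_side k" "0 \<le> t" "t \<le> 1" "z = rim g (real k + t)" "w = rim g (real k + 3 - t)" by blast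
  define j where "j = k div 4"
  have "k = 4 * j \<or> k = 4 * j + 1" "j < g" using k(1) unfolding first_side_def j_def by presburger+
  then show "side_pairing g z w"
    using side_pairing.intros[of j g t] k unfolding polygon_side_eq_rim
    by (auto simp: algebra_simps)
qed

text \<open>In a block of four sides the gluing links the corners in the order \<open>4 * j\<close>,
  \<open>4 * j + 3\<close>, \<open>4 * j + 2\<close>, \<open>4 * j + 1\<close>,
  \<open>4 * j + 4\<close>, and so reaches the next block. This is the order of the corners around
  the vertex of the surface; it returns in \<open>corner_word\<close>.\<close>

lemma vertices_equiv: "equivclp (side_pairing g) (rim g (real_of_int m)) (rim g 0)"
proof -
  let ?E = "equivclp (side_pairing g)"
  have pair: "?E (rim g (real k + t)) (rim g (real k + 3 - t))" if "first_side k" "0 \<le> t" "t \<le> 1" for k t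
    using that side_pairing_iff by (intro r_into_equivclp) blast
  have j: "?E (rim g (real (4 * j))) (rim g (4 * j + 3))" "?E (rim g (4 * j + 1)) (rim g (4 * j + 2))"
    "?E (rim g (4 * j + 1)) (rim g (real (4 * Suc j)))" "?E (rim g (4 * j + 2)) (rim g (4 * j + 3))" if "j < g" for j
  proof -
    have f: "first_side (4 * j)" "first_side (4 * j + 1)" using that unfolding first_side_def by presburger+
    show "?E (rim g (real (4 * j))) (rim g (4 * j + 3))" "?E (rim g (4 * j + 1)) (rim g (4 * j + 2))"
      using pair[OF f(1), of 0] pair[OF f(1), of 1] by (simp_all add: add.commute)
    show "?E (rim g (4 * j + 1)) (rim g (real (4 * Suc j)))" "?E (rim g (4 * j + 2)) (rim g (4 * j + 3))"
      using pair[OF f(2), of 0] pair[OF f(2), of 1] by (simp_all add: algebra_simps)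
  qed
  have zero: "j \<le> g \<Longrightarrow> ?E (rim g (real (4 * j))) (rim g 0)" for j
  proof (induction j)
    case (Suc j)
    then show ?case using j[of j] by (meson Suc_leD Suc_le_lessD equivclp_sym equivclp_trans)
  qed simp
  have all: "?E (rim g (real n)) (rim g 0)" if "n < 4 * g" for n
  proof -
    define i where "i = n div 4"
    have i: "i < g" "i \<le> g" using that unfolding i_def by auto
    have "n = 4 * i \<or> n = 4 * i + 1 \<or> n = 4 * i + 2 \<or> n = 4 * i + 3" unfolding i_def by presburger
    then have "real n = real (4 * i) \<or> real n = 4 * i + 1 \<or> real n = 4 * i + 2 \<or> real n = 4 * i + 3" by auto
    then show ?thesis
      using zero[OF i(2)] j[OF i(1)] by (elim disjE; simp only:) (meson equivclp_sym equivclp_trans)+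
  qed
  obtain n where n: "n < 4 * g" "turn_equiv g m n" using turn_equiv_nat_exists by blast
  then have "rim g (real_of_int m) = rim g n" using rim_eq_iff by simp
  then show ?thesis using all[OF n(1)] by simp
qed

definition edge_glued :: "complex \<Rightarrow> complex \<Rightarrow> bool"
  where "edge_glued z w \<longleftrightarrow> (\<exists>k t. first_side k \<and> 0 < t \<and> t < 1 \<and> z = rim g (real k + t) \<and> w = rim g (real k + 3 - t))"

definition vertex :: "complex \<Rightarrow> bool"
  where "vertex z \<longleftrightarrow> (\<exists>m::int. z = rim g m)"

lemma not_vertex: "0 < t \<Longrightarrow> t < 1 \<Longrightarrow> \<not> vertex (rim g (real_of_int k + t))"
  using turn_equiv_fract(1)[of k t _ 0] unfolding vertex_def rim_eq_iff by fastforce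

lemma edge_glued_not_vertex: "edge_glued z w \<Longrightarrow> \<not> vertex z \<and> \<not> vertex w"
proof -
  assume "edge_glued z w"
  then obtain k t where k: "first_side k" "0 < t" "t < 1" "z = rim g (real k + t)" "w = rim g (real k + 3 - t)"
    unfolding edge_glued_def by blast
  have "real k + 3 - t = real_of_int (int k + 2) + (1 - t)" by simp
  then show ?thesis using not_vertex[of t "int k"] not_vertex[of "1 - t" "int k + 2"] k
    by (simp only: of_int_of_nat_eq) simp
qed

lemma side_pairing_cases: "side_pairing g z w \<Longrightarrow> edge_glued z w \<or> vertex z \<and> vertex w"
proof -
  assume "side_pairing g z w"
  then obtain k t where k: "first_side k" "0 \<le> t" "t \<le> 1" "z = rim g (real k + t)" "w = rim g (real k + 3 - t)"
    using side_pairing_iff by blast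
  then consider "0 < t" "t < 1" | "t = 0" | "t = 1" by linarith
  then show ?thesis
  proof cases
    case 1 then show ?thesis using k unfolding edge_glued_def by blast
  next
    case 2
    have "z = rim g (of_int (int k))" "w = rim g (of_int (int k + 3))" using k 2 by auto
    then show ?thesis unfolding vertex_def by blast
  next
    case 3
    have "z = rim g (of_int (int k + 1))" "w = rim g (of_int (int k + 2))" using k 3 by (auto simp: add.commute)
    then show ?thesis unfolding vertex_def by blast
  qed
qed

text \<open>On open sides the gluing is a partial injection from first sides to second sides, and no
  second side is a first side. So gluings of edge points cannot be chained to reach a third point,
  which makes the generated equivalence explicit.\<close>

lemma edge_glued_unique:
  "edge_glued z w \<Longrightarrow> edge_glued z w' \<Longrightarrow> w = w'"
  "edge_glued z w \<Longrightarrow> edge_glued z' w \<Longrightarrow> z = z'"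
  "edge_glued z w \<Longrightarrow> \<not> edge_glued w w'"
proof -
  have inj: "t = t' \<and> turn_equiv g k k'" if "rim g (real k + t) = rim g (real k' + t')" "0 < t" "t < 1" "0 < t'" "t' < 1"
    for k k' :: nat and t t'
    using that turn_equiv_fract[of "int k" t "int k'" t'] unfolding rim_eq_iff by auto
  show "w = w'" if zw: "edge_glued z w" "edge_glued z w'"
  proof -
    obtain k t k' t' where k: "first_side k" "0 < t" "t < 1" "z = rim g (real k + t)" "w = rim g (real k + 3 - t)"
      and k': "first_side k'" "0 < t'" "t' < 1" "z = rim g (real k' + t')" "w' = rim g (real k' + 3 - t')"
      using zw unfolding edge_glued_def by blast
    then have "t = t'" "k = k'"
      using inj[of k t k' t'] turn_equiv_nat_less[of g k k'] unfolding first_side_def by auto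
    then show ?thesis using k k' by simp
  qed
  have two: "real k + 3 - t = real (k + 2) + (1 - t)" for k t by simp
  show "z = z'" if zw: "edge_glued z w" "edge_glued z' w"
  proof -
    obtain k t k' t' where k: "first_side k" "0 < t" "t < 1" "z = rim g (real k + t)" "w = rim g (real k + 3 - t)"
      and k': "first_side k'" "0 < t'" "t' < 1" "z' = rim g (real k' + t')" "w = rim g (real k' + 3 - t')"
      using zw unfolding edge_glued_def by blast
    then have "1 - t = 1 - t'" "k + 2 = k' + 2"
      using inj[of "k + 2" "1 - t" "k' + 2" "1 - t'"] turn_equiv_nat_less[of g "k + 2" "k' + 2"]
        first_side_bound[OF k(1)] first_side_bound[OF k'(1)] unfolding two by auto
    then show ?thesis using k k' by simp
  qed
  show "\<not> edge_glued w w'" if zw: "edge_glued z w"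
  proof
    assume "edge_glued w w'"
    then obtain k t k' t' where k: "first_side k" "0 < t" "t < 1" "z = rim g (real k + t)" "w = rim g (real k + 3 - t)"
      and k': "first_side k'" "0 < t'" "t' < 1" "w = rim g (real k' + t')"
      using zw unfolding edge_glued_def by blast
    then have "k + 2 = k'"
      using inj[of "k + 2" "1 - t" k' t'] turn_equiv_nat_less[of g "k + 2" k']
        first_side_bound[OF k(1)] first_side_bound[OF k'(1)] unfolding two by auto
    then show False using k(1) k'(1) unfolding first_side_def by presburger
  qed
qed

lemma equivclp_side_pairing_cases:
  assumes "equivclp (side_pairing g) z w"
  shows "z = w \<or> edge_glued z w \<or> edge_glued w z \<or> vertex z \<and> vertex w"
  using assms
proof (induction rule: equivclp_induct)
  case (step y w)
  from step.hyps(2) have "edge_glued y w \<or> edge_glued w y \<or> vertex y \<and> vertex w"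
    using side_pairing_cases by blast
  then show ?case
    using step.IH edge_glued_unique edge_glued_not_vertex by metis
qed simp

text \<open>A polar rectangle around the boundary point \<open>a\<close>, one side wide and reaching
  to the centre of the disc, which it omits. Integers \<open>a\<close> give neighbourhoods of
  corners, half-integers neighbourhoods of open sides.\<close>

definition sector :: "real \<Rightarrow> complex set"
  where "sector a = {of_real r * rim g s | r s. 0 < r \<and> r \<le> 1 \<and> \<bar>s - a\<bar> < 1 / 2}"

lemma sectorI: "0 < r \<Longrightarrow> r \<le> 1 \<Longrightarrow> \<bar>s - a\<bar> < 1 / 2 \<Longrightarrow> of_real r * rim g s \<in> sector a"
  unfolding sector_def by blast

text \<open>The angular coordinate relative to \<open>a\<close>, in units of one side. Rotating by
  \<open>- a\<close> before taking \<open>Arg\<close> keeps the sector away from the branch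
  cut.\<close>

definition angle :: "real \<Rightarrow> complex \<Rightarrow> real"
  where "angle a z = 4 * real g / (2 * pi) * Arg (z * rim g (- a))"

lemma angle_eq:
  assumes "0 < r" "\<bar>s - a\<bar> < 1 / 2"
  shows "angle a (of_real r * rim g s) = s - a"
proof -
  have "of_real r * rim g s * rim g (- a) = rcis r (2 * pi * (s - a) / (4 * real g))"
    using rim_add[of g s "- a"] by (simp add: rcis_def rim_def mult.assoc)
  moreover have "\<bar>2 * pi * (s - a) / (4 * real g)\<bar> < pi"
  proof -
    have "\<bar>2 * pi * (s - a) / (4 * real g)\<bar> = pi * (\<bar>s - a\<bar> / (2 * real g))" by (simp add: abs_mult)
    also have "\<dots> < pi * 1"
      using assms(2) genus by (intro mult_strict_left_mono) (auto simp: divide_simps)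
    finally show ?thesis by simp
  qed
  ultimately have "Arg (of_real r * rim g s * rim g (- a)) = 2 * pi * (s - a) / (4 * real g)"
    using assms(1) Arg_rcis[of "2 * pi * (s - a) / (4 * real g)" r] unfolding abs_less_iff
    by (metis greaterThanAtMost_iff less_imp_le minus_less_iff)
  then show ?thesis using genus by (simp add: angle_def)
qed

lemma sector_iff: "z \<in> sector a \<longleftrightarrow> z \<in> cball 0 1 \<and> z \<noteq> 0 \<and> \<bar>angle a z\<bar> < 1 / 2"
proof
  assume "z \<in> sector a"
  then obtain r s where "z = of_real r * rim g s" "0 < r" "r \<le> 1" "\<bar>s - a\<bar> < 1 / 2" unfolding sector_def by auto
  then show "z \<in> cball 0 1 \<and> z \<noteq> 0 \<and> \<bar>angle a z\<bar> < 1 / 2" using angle_eq by (simp add: norm_mult)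
next
  assume z: "z \<in> cball 0 1 \<and> z \<noteq> 0 \<and> \<bar>angle a z\<bar> < 1 / 2"
  let ?w = "z * rim g (- a)"
  have "?w = rcis (norm ?w) (Arg ?w)" by (simp add: rcis_cmod_Arg)
  moreover have "Arg ?w = 2 * pi * angle a z / (4 * real g)" using genus by (simp add: angle_def)
  ultimately have "?w = of_real (norm z) * rim g (angle a z)" by (simp add: rcis_def rim_def norm_mult)
  then have "z * (rim g (- a) * rim g a) = of_real (norm z) * (rim g (angle a z) * rim g a)" by (simp add: mult.assoc)
  moreover have "rim g (- a) * rim g a = 1" using rim_add[of g "- a" a] by (simp add: rim_def)
  ultimately have "z = of_real (norm z) * rim g (angle a z + a)" by (simp add: rim_add)
  moreover have "of_real (norm z) * rim g (angle a z + a) \<in> sector a" using z by (intro sectorI) auto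
  ultimately show "z \<in> sector a" by simp
qed

lemma sector_rim: "rim g s \<in> sector a \<longleftrightarrow> (\<exists>b. turn_equiv g b a \<and> \<bar>s - b\<bar> < 1 / 2)"
proof
  assume "rim g s \<in> sector a"
  then obtain r t where r: "rim g s = of_real r * rim g t" "0 < r" "\<bar>t - a\<bar> < 1 / 2" unfolding sector_def by auto
  then have "turn_equiv g s t" using rim_scaled_eq(2)[of 1 s r t] by simp
  then obtain n :: int where "s = t + 4 * real g * n" unfolding turn_equiv_def by auto
  then show "\<exists>b. turn_equiv g b a \<and> \<bar>s - b\<bar> < 1 / 2"
    using r(3) unfolding turn_equiv_def by (intro exI[of _ "a + 4 * real g * n"]) auto
next
  assume "\<exists>b. turn_equiv g b a \<and> \<bar>s - b\<bar> < 1 / 2"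
  then obtain n :: int where n: "\<bar>s - (a + 4 * real g * n)\<bar> < 1 / 2" unfolding turn_equiv_def by auto
  have "rim g s = of_real 1 * rim g (s - 4 * real g * n)"
    using rim_eq_iff[of s "s - 4 * real g * n"] unfolding turn_equiv_def by auto
  also have "\<dots> \<in> sector a" using n by (intro sectorI) (auto simp: algebra_simps)
  finally show "rim g s \<in> sector a" .
qed

lemma sector_cong: "turn_equiv g a b \<Longrightarrow> sector a = sector b"
proof -
  have "sector a \<subseteq> sector b" if "turn_equiv g a b" for a b
  proof
    fix z assume "z \<in> sector a"
    then obtain r s where z: "z = of_real r * rim g s" "0 < r" "r \<le> 1" "\<bar>s - a\<bar> < 1 / 2" unfolding sector_def by auto
    then have "rim g s \<in> sector b" using that sector_rim by blast
    then obtain r' s' where "rim g s = of_real r' * rim g s'" "0 < r'" "\<bar>s' - b\<bar> < 1 / 2" unfolding sector_def by auto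
    then have "rim g s = rim g s'" using rim_scaled_eq(1)[of 1 s r' s'] by simp
    then show "z \<in> sector b" using z \<open>\<bar>s' - b\<bar> < 1 / 2\<close> unfolding sector_def by auto
  qed
  then show "turn_equiv g a b \<Longrightarrow> sector a = sector b" using turn_equiv_sym by blast
qed

lemma sector_disjoint:
  assumes "z \<in> sector a" "z \<in> sector b" "a - b \<in> \<int>"
  shows "turn_equiv g a b"
proof -
  obtain r s r' s' where "z = of_real r * rim g s" "0 < r" "\<bar>s - a\<bar> < 1 / 2"
    "z = of_real r' * rim g s'" "0 < r'" "\<bar>s' - b\<bar> < 1 / 2"
    using assms(1,2) unfolding sector_def by blast
  moreover then have "turn_equiv g s s'" using rim_scaled_eq(2) by metis
  moreover obtain m where "a - b = of_int m" using assms(3) by (auto elim: Ints_cases)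
  ultimately obtain n :: int where n: "\<bar>s' + 4 * real g * n - a\<bar> < 1 / 2" "\<bar>s' - b\<bar> < 1 / 2" "a - b = of_int m"
    unfolding turn_equiv_def by auto
  then have "\<bar>4 * real g * n - m\<bar> < 1" by linarith
  then have "\<bar>of_int (4 * int g * n - m)\<bar> < (1::real)" by simp
  then have "4 * int g * n - m = 0" by linarith
  then have "a = b + 4 * real g * n" using n(3) by (metis (no_types, lifting) diff_add_cancel add.commute eq_iff_diff_eq_0 of_int_mult of_int_numeral of_int_of_nat_eq)
  then show ?thesis unfolding turn_equiv_def by blast
qed

lemma not_nonpos_Real: "0 < Re w \<Longrightarrow> w \<notin> \<real>\<^sub>\<le>\<^sub>0"
  by (auto simp: complex_nonpos_Reals_iff)

text \<open>After the rotation a sector lies within an angle \<open>pi / 2\<close> of the positive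
  axis, hence where \<open>Arg\<close> is continuous.\<close>

lemma sector_Re_pos:
  assumes "z \<in> sector a"
  shows "0 < Re (z * rim g (- a))"
proof -
  have "\<bar>Arg (z * rim g (- a))\<bar> < pi / 2" "z \<noteq> 0"
  proof -
    have "\<bar>angle a z\<bar> < 1 / 2" "z \<noteq> 0" using assms sector_iff by auto
    moreover have "Arg (z * rim g (- a)) = pi * (angle a z / (2 * real g))" using genus by (simp add: angle_def)
    moreover have "\<bar>angle a z / (2 * real g)\<bar> < 1 / 2"
      using \<open>\<bar>angle a z\<bar> < 1 / 2\<close> genus by (simp add: abs_div divide_simps)
    moreover then have "pi * \<bar>angle a z / (2 * real g)\<bar> < pi * (1 / 2)"
      by (intro mult_strict_left_mono) auto
    ultimately show "\<bar>Arg (z * rim g (- a))\<bar> < pi / 2" "z \<noteq> 0"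
      by (simp_all add: abs_mult)
  qed
  then show ?thesis using Arg_Re_pos[of "z * rim g (- a)"] by auto
qed

lemma continuous_on_angle: "continuous_on {z. 0 < Re (z * rim g (- a))} (angle a)"
  unfolding angle_def
  by (intro continuous_intros) (use not_nonpos_Real in blast)

lemma openin_sector: "openin (top_of_set (cball 0 1)) (sector a)"
proof -
  let ?O = "{z. 0 < Re (z * rim g (- a))}"
  have O: "open ?O" by (intro open_Collect_less continuous_intros)
  have "open (?O \<inter> (\<lambda>z. \<bar>angle a z\<bar>) -` {..<1 / 2})"
    by (intro continuous_open_preimage continuous_on_rabs continuous_on_angle O open_lessThan)
  moreover have "sector a = cball 0 1 \<inter> (?O \<inter> (\<lambda>z. \<bar>angle a z\<bar>) -` {..<1 / 2})"
    using sector_Re_pos[of _ a] by (auto simp: sector_iff)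
  ultimately show ?thesis by (metis openin_open)
qed

text \<open>Being linear in polar coordinates, this contraction is compatible with the gluing of sides.\<close>

definition retract :: "real \<Rightarrow> real \<times> complex \<Rightarrow> complex"
  where "retract a = (\<lambda>(l, z). of_real ((1 - l) * norm z + l) * rim g (a + (1 - l) * angle a z))"

lemma retract_eq:
  assumes "0 < r" "\<bar>s - a\<bar> < 1 / 2"
  shows "retract a (l, of_real r * rim g s) = of_real ((1 - l) * r + l) * rim g (a + (1 - l) * (s - a))"
  using assms by (simp add: retract_def angle_eq norm_mult)

lemma continuous_on_retract: "continuous_on ({0..1} \<times> sector a) (retract a)"
proof -
  have "continuous_on (sector a) (angle a)"
    by (rule continuous_on_subset[OF continuous_on_angle]) (auto dest: sector_Re_pos)
  then have "continuous_on ({0..1::real} \<times> sector a) (\<lambda>x. angle a (snd x))"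
    by (rule continuous_on_compose2) (auto intro!: continuous_intros)
  then show ?thesis unfolding retract_def case_prod_beta by (intro continuous_intros)
qed

lemma retract_in_disc:
  assumes "l \<in> {0..1}" "z \<in> cball 0 1"
  shows "retract a (l, z) \<in> cball 0 1"
proof -
  have "(1 - l) * norm z + l \<le> 1" using assms mult_left_le[of "norm z" "1 - l"] by auto
  moreover have "0 \<le> (1 - l) * norm z + l" using assms by auto
  ultimately show ?thesis unfolding retract_def
    by (simp add: norm_mult del: of_real_add of_real_mult of_real_diff)
qed

lemma retract_0: "z \<in> sector a \<Longrightarrow> retract a (0, z) = z"
  and retract_1: "retract a (1, z) = rim g a"
  by (auto simp: sector_def retract_eq) (simp add: retract_def)

lemma retract_cong:
  assumes "turn_equiv g a b" "z \<in> sector a"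
  shows "retract a (l, z) = retract b (l, z)"
proof -
  obtain r s where z: "z = of_real r * rim g s" "0 < r" "\<bar>s - a\<bar> < 1 / 2" using assms unfolding sector_def by auto
  obtain n :: int where n: "a = b + 4 * real g * n" using assms(1) unfolding turn_equiv_def by auto
  have "rim g s = rim g (s - 4 * real g * n)"
    unfolding rim_eq_iff turn_equiv_def by (intro exI[of _ n]) simp
  then have z': "z = of_real r * rim g (s - 4 * real g * n)" using z by simp
  have e: "retract b (l, z) = of_real ((1 - l) * r + l) * rim g (b + (1 - l) * (s - 4 * real g * n - b))"
    unfolding z' using z(2,3) n by (intro retract_eq) (simp_all add: algebra_simps)
  have "rim g (a + (1 - l) * (s - a)) = rim g (b + (1 - l) * (s - 4 * real g * n - b))"
    unfolding rim_eq_iff turn_equiv_def using n by (intro exI[of _ n]) (simp add: algebra_simps)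
  then show ?thesis using e retract_eq[OF z(2,3)] z(1) by simp
qed

lemma sector_path_connected:
  assumes "z \<in> sector a" "w \<in> sector a"
  obtains p where "path p" "path_image p \<subseteq> sector a" "pathstart p = z" "pathfinish p = w"
proof -
  obtain r s r' s' where z: "z = of_real r * rim g s" "0 < r" "r \<le> 1" "\<bar>s - a\<bar> < 1 / 2"
    and w: "w = of_real r' * rim g s'" "0 < r'" "r' \<le> 1" "\<bar>s' - a\<bar> < 1 / 2"
    using assms unfolding sector_def by blast
  define p where "p t = of_real (linepath r r' t) * rim g (linepath s s' t)" for t
  have "path p" unfolding path_def p_def linepath_def by (intro continuous_intros)
  moreover have "path_image p \<subseteq> sector a"
  proof -
    have "linepath r r' t \<in> {0<..1}" "linepath s s' t \<in> ball a (1 / 2)" if "t \<in> {0..1}" for t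
    proof -
      have "linepath r r' t \<in> closed_segment r r'" "linepath s s' t \<in> closed_segment s s'"
        using that linepath_in_path by blast+
      moreover have "closed_segment r r' \<subseteq> {0<..1}" "closed_segment s s' \<subseteq> ball a (1 / 2)"
        using z w by (intro closed_segment_subset; auto simp: dist_real_def abs_minus_commute)+
      ultimately show "linepath r r' t \<in> {0<..1}" "linepath s s' t \<in> ball a (1 / 2)" by blast+
    qed
    then show ?thesis unfolding path_image_def p_def
      by (intro image_subsetI sectorI) (simp_all add: dist_real_def abs_minus_commute)
  qed
  moreover have "pathstart p = z" "pathfinish p = w"
    using z w by (auto simp: p_def pathstart_def pathfinish_def linepath_def)
  ultimately show thesis by (rule that)
qed

end

section \<open>Charts of the glued polygon\<close>

datatype chart = Disc | Edge nat | Corner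

context polygon
begin

text \<open>All real representatives of the centres, so that the set is closed under full turns. The
  partner of side \<open>k\<close> is side \<open>k + 2\<close>, with midpoint
  \<open>k + 5 / 2\<close>.\<close>

fun centres :: "chart \<Rightarrow> real set" where
  "centres Disc = {}"
| "centres (Edge k) = {a. turn_equiv g a (real k + 1 / 2) \<or> turn_equiv g a (real k + 5 / 2)}"
| "centres Corner = \<int>"

definition dom :: "chart \<Rightarrow> complex set"
  where "dom c = (if c = Disc then ball 0 1 else (\<Union>a\<in>centres c. sector a))"

definition charts :: "chart set"
  where "charts = insert Disc (insert Corner (Edge ` Collect first_side))"

text \<open>Sectors are one side wide, so integrally spaced centres make the sectors of a chart
  equal or disjoint. This allows definitions sector by sector.\<close>

lemma centres_diff: "a \<in> centres c \<Longrightarrow> b \<in> centres c \<Longrightarrow> a - b \<in> \<int>"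
proof (cases c)
  case (Edge k)
  assume ab: "a \<in> centres c" "b \<in> centres c"
  have "a - (real k + 1 / 2) \<in> \<int>" if "a \<in> centres c" for a
  proof -
    from that Edge obtain n :: int where "a = real k + 1 / 2 + 4 * real g * n \<or> a = real k + 5 / 2 + 4 * real g * n"
      by (auto simp: turn_equiv_def)
    then have "a - (real k + 1 / 2) = of_int (4 * int g * n) \<or> a - (real k + 1 / 2) = of_int (4 * int g * n + 2)" by auto
    then show ?thesis by (metis Ints_of_int)
  qed
  from Ints_diff[OF this[OF ab(1)] this[OF ab(2)]] show ?thesis by simp
qed auto

lemma dom_sector: "c \<noteq> Disc \<Longrightarrow> z \<in> dom c \<Longrightarrow> \<exists>a\<in>centres c. z \<in> sector a"
  and sector_subset_dom: "a \<in> centres c \<Longrightarrow> sector a \<subseteq> dom c"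
  by (auto simp: dom_def)

lemma sector_subset: "sector a \<subseteq> cball 0 1"
  using sector_iff by auto

lemma dom_subset: "dom c \<subseteq> cball 0 1"
  using sector_subset by (auto simp: dom_def split: if_splits)

lemma openin_dom: "openin (top_of_set (cball 0 1)) (dom c)"
proof (cases "c = Disc")
  case True
  have "openin (top_of_set (cball 0 1)) (cball 0 1 \<inter> ball (0::complex) 1)" by (intro openin_open_Int) simp
  moreover have "cball 0 1 \<inter> ball (0::complex) 1 = ball 0 1" by auto
  ultimately show ?thesis using True by (simp add: dom_def)
qed (auto simp: dom_def intro: openin_sector)

lemma turn_equiv_dist:
  fixes k l :: int and b c t :: real
  assumes "turn_equiv g b (l + c)" "\<bar>k + t - b\<bar> < 1 / 2" "\<bar>t - c\<bar> \<le> 1 / 2"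
  shows "turn_equiv g k l"
proof -
  obtain n :: int where n: "b = l + c + 4 * real g * n" using assms(1) unfolding turn_equiv_def by auto
  then have "\<bar>k - (l + 4 * real g * n)\<bar> < 1" using assms(2,3) by linarith
  then have "\<bar>real_of_int (k - (l + 4 * int g * n))\<bar> < 1" by simp
  then have "k = l + 4 * int g * n" by linarith
  then have "real_of_int k = l + 4 * real g * n" by simp
  then show ?thesis unfolding turn_equiv_def by blast
qed

lemma rim_in_edge_sector:
  assumes "rim g (real_of_int k + t) \<in> sector (real_of_int l + 1 / 2)" "0 \<le> t" "t \<le> 1"
  shows "turn_equiv g k l"
proof -
  have "\<bar>t - 1 / 2\<bar> \<le> 1 / 2" using assms(2,3) by linarith
  then show ?thesis using assms(1) turn_equiv_dist[of _ l "1/2" k t] unfolding sector_rim by blast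
qed

lemma vertex_not_in_edge_sector:
  shows "rim g (real_of_int m) \<notin> sector (real_of_int l + 1 / 2)"
proof
  assume "rim g (real_of_int m) \<in> sector (real_of_int l + 1 / 2)"
  then obtain n :: int where n: "\<bar>m - (l + 1 / 2 + 4 * real g * n)\<bar> < 1 / 2" unfolding sector_rim turn_equiv_def by auto
  define i where "i = m - l - 4 * int g * n"
  have "m - (l + 1 / 2 + 4 * real g * n) = real_of_int i - 1 / 2" by (simp add: i_def)
  with n have "\<bar>real_of_int i - 1 / 2\<bar> < 1 / 2" by simp
  then have "0 < real_of_int i" "real_of_int i < 1" unfolding abs_less_iff by auto
  then have "0 < i" "i < 1" by simp_all
  then show False by linarith
qed

text \<open>A chart meeting the glued pair of boundary points \<open>k + t\<close> and \<open>k + 3 - t\<close> contains both, in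
  sectors whose centres \<open>a\<close> and \<open>2 k + 3 - a\<close> are exchanged by the gluing reflection.\<close>

lemma chart_at_edge:
  assumes k: "first_side k" and t: "0 < t" "t < 1" and c: "c \<in> charts"
    and in_dom: "rim g (real k + t) \<in> dom c \<or> rim g (real k + 3 - t) \<in> dom c"
  obtains a where "\<bar>real k + t - a\<bar> < 1 / 2" "a \<in> centres c" "2 * real k + 3 - a \<in> centres c"
    "c = Edge k \<and> a = real k + 1 / 2 \<or> c = Corner \<and> (a = real k \<or> a = real k + 1)"
proof -
  let ?z = "rim g (real k + t)" and ?w = "rim g (real k + 3 - t)"
  have w: "?w = rim g (real_of_int (int k + 2) + (1 - t))" by (rule arg_cong[of _ _ "rim g"]) simp
  have z: "?z = rim g (real_of_int (int k) + t)" by simp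
  have "c \<noteq> Disc" using in_dom by (auto simp: dom_def)
  then consider k\<^sub>0 where "c = Edge k\<^sub>0" "first_side k\<^sub>0" | "c = Corner" using c by (auto simp: charts_def)
  then show thesis
  proof cases
    case 1
    have "sector a = sector (real_of_int (int k\<^sub>0) + 1 / 2) \<or> sector a = sector (real_of_int (int k\<^sub>0 + 2) + 1 / 2)"
      if "a \<in> centres c" for a
    proof -
      have "real_of_int (int k\<^sub>0 + 2) + 1 / 2 = real k\<^sub>0 + 5 / 2" by simp
      then show ?thesis using that sector_cong unfolding 1 centres.simps mem_Collect_eq of_int_of_nat_eq by metis
    qed
    then have "\<exists>l\<in>{int k\<^sub>0, int k\<^sub>0 + 2}. ?z \<in> sector (real_of_int l + 1 / 2) \<or> ?w \<in> sector (real_of_int l + 1 / 2)"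
      using in_dom dom_sector[OF \<open>c \<noteq> Disc\<close>] by (metis insertI1 insertI2)
    then have "\<exists>l\<in>{int k\<^sub>0, int k\<^sub>0 + 2}. turn_equiv g (int k) l \<or> turn_equiv g (int k + 2) l"
      using rim_in_edge_sector[of "int k" t] rim_in_edge_sector[of "int k + 2" "1 - t"] t unfolding w z
      by (smt (verit, best))
    then have te: "turn_equiv g k k\<^sub>0 \<or> turn_equiv g k (real (k\<^sub>0 + 2)) \<or> turn_equiv g (real (k + 2)) k\<^sub>0 \<or> turn_equiv g (real (k + 2)) (real (k\<^sub>0 + 2))"
      by (auto simp: add.commute)
    have "k = k\<^sub>0 \<or> k = k\<^sub>0 + 2 \<or> k + 2 = k\<^sub>0 \<or> k + 2 = k\<^sub>0 + 2"
    proof -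
      have "k < 4 * g" "k\<^sub>0 < 4 * g" "k + 2 < 4 * g" "k\<^sub>0 + 2 < 4 * g"
        using first_side_bound[OF k] first_side_bound[OF 1(2)] by linarith+
      then show ?thesis
        using turn_equiv_nat_less[of g k k\<^sub>0] turn_equiv_nat_less[of g k "k\<^sub>0 + 2"]
          turn_equiv_nat_less[of g "k + 2" k\<^sub>0] turn_equiv_nat_less[of g "k + 2" "k\<^sub>0 + 2"]
          te by blast
    qed
    \<comment> \<open>First sides are \<open>0\<close> or \<open>1\<close> modulo 4 and their
      partners \<open>2\<close> or \<open>3\<close>, so a first side is never a partner.\<close>
    moreover have "k mod 4 < 2" "k\<^sub>0 mod 4 < 2" using k 1(2) unfolding first_side_def by auto
    moreover have "\<not> (m + 2) mod 4 < 2" if "m mod 4 < 2" for m :: nat using that by presburger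
    ultimately have "k = k\<^sub>0" by auto
    moreover have "\<bar>t - 1 / 2\<bar> < 1 / 2" using t by linarith
    ultimately show thesis using that[of "real k + 1 / 2"] 1 by auto
  next
    case 2
    \<comment> \<open>The midpoint of a side is at distance exactly \<open>1 / 2\<close> from its
      two corners, hence in no open corner sector.\<close>
    have "t \<noteq> 1 / 2"
    proof
      assume h: "t = 1 / 2"
      obtain a where a: "a \<in> \<int>" "?z \<in> sector a \<or> ?w \<in> sector a"
        using in_dom dom_sector[OF \<open>c \<noteq> Disc\<close>] 2 by auto
      then obtain l :: int and n :: int where "\<bar>real k + t - (l + 4 * real g * n)\<bar> < 1 / 2 \<or> \<bar>real k + 3 - t - (l + 4 * real g * n)\<bar> < 1 / 2"
        unfolding sector_rim turn_equiv_def by (auto elim!: Ints_cases)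
      moreover define i where "i = int k - l - 4 * int g * n"
      moreover have "real k + t - (l + 4 * real g * n) = real_of_int i + 1 / 2"
        "real k + 3 - t - (l + 4 * real g * n) = real_of_int i + 5 / 2" by (simp_all add: i_def h)
      ultimately have "\<bar>real_of_int i + 1 / 2\<bar> < 1 / 2 \<or> \<bar>real_of_int i + 5 / 2\<bar> < 1 / 2" by argo
      then have "real_of_int (- 1) < of_int i \<and> of_int i < real_of_int 0 \<or> real_of_int (- 3) < of_int i \<and> of_int i < real_of_int (- 2)"
        unfolding abs_less_iff by auto
      then have "- 1 < i \<and> i < 0 \<or> - 3 < i \<and> i < - 2" by (simp only: of_int_less_iff)
      then show False by linarith
    qed
    then consider "t < 1 / 2" | "t > 1 / 2" by linarith
    then show thesis
    proof cases
      case 1 then show thesis using that[of "real k"] t 2 by auto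
    next
      case 2
      have "2 * real k + 3 - (real k + 1) = of_int (int k + 2)" by simp
      then show thesis using that[of "real k + 1"] t 2 \<open>c = Corner\<close> by auto
    qed
  qed
qed

lemma edge_sectors:
  assumes "\<bar>real k + t - a\<bar> < 1 / 2"
  shows "rim g (real k + t) \<in> sector a" "rim g (real k + 3 - t) \<in> sector (2 * real k + 3 - a)"
proof -
  have "\<bar>real k + 3 - t - (2 * real k + 3 - a)\<bar> < 1 / 2" using assms by linarith
  then show "rim g (real k + t) \<in> sector a" "rim g (real k + 3 - t) \<in> sector (2 * real k + 3 - a)"
    using sectorI[of 1 "real k + t" a] sectorI[of 1 "real k + 3 - t" "2 * real k + 3 - a"] assms by simp_all
qed

lemma vertex_chart:
  assumes "vertex z" "c \<in> charts" "z \<in> dom c"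
  shows "c = Corner"
proof -
  obtain m :: int where m: "z = rim g m" using assms(1) unfolding vertex_def by blast
  have "c \<noteq> Disc" using assms(3) m by (auto simp: dom_def)
  moreover have "c \<noteq> Edge k" for k
  proof
    assume c: "c = Edge k"
    then obtain a where "turn_equiv g a (real k + 1 / 2) \<or> turn_equiv g a (real k + 5 / 2)" "z \<in> sector a"
      using dom_sector[OF \<open>c \<noteq> Disc\<close> assms(3)] by auto
    moreover have "real_of_int (int k) + 1 / 2 = real k + 1 / 2" "real_of_int (int k + 2) + 1 / 2 = real k + 5 / 2" by simp_all
    ultimately show False
      using sector_cong vertex_not_in_edge_sector[of m "int k"] vertex_not_in_edge_sector[of m "int k + 2"] m by metis
  qed
  ultimately show ?thesis using assms(2) by (cases c) auto
qed

lemma vertex_in_corner: "vertex z \<Longrightarrow> z \<in> dom Corner"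
proof -
  assume "vertex z"
  then obtain m :: int where m: "z = rim g m" unfolding vertex_def by blast
  have "z \<in> sector (of_int m)" using sectorI[of 1 "of_int m" "of_int m"] m by simp
  then show ?thesis using sector_subset_dom[of "of_int m" Corner] by auto
qed

lemma rim_vertex_sector: "rim g (real_of_int m) \<in> sector (real_of_int l) \<Longrightarrow> turn_equiv g m l"
  using turn_equiv_dist[of _ l 0 m 0] unfolding sector_rim by auto

end

section \<open>The glued surface, and contractions that descend to it\<close>

locale polygon_quotient = polygon g for g +
  fixes S :: "'s::topological_space set" and q :: "complex \<Rightarrow> 's"
  assumes quotient: "quotient_map (top_of_set (cball 0 1)) (top_of_set S) q"
    and fibre: "z \<in> cball 0 1 \<Longrightarrow> w \<in> cball 0 1 \<Longrightarrow> q z = q w \<longleftrightarrow> equivclp (side_pairing g) z w"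
begin

lemma q_image: "q ` cball 0 1 = S"
  using quotient_imp_surjective_map[OF quotient] by simp

lemma q_continuous: "continuous_on (cball 0 1) q"
  using quotient_imp_continuous_map[OF quotient] by simp

lemma rim_in_disc: "rim g s \<in> cball 0 1" by simp

lemma q_edge: "first_side k \<Longrightarrow> 0 \<le> t \<Longrightarrow> t \<le> 1 \<Longrightarrow> q (rim g (real k + t)) = q (rim g (real k + 3 - t))"
  unfolding fibre[OF rim_in_disc rim_in_disc] using side_pairing_iff by (intro r_into_equivclp) blast

lemma q_vertex: "vertex z \<Longrightarrow> q z = q (rim g 0)"
  using fibre rim_in_disc vertices_equiv unfolding vertex_def by blast

lemma fibre_cases:
  assumes "z \<in> cball 0 1" "w \<in> cball 0 1" "q z = q w"
  shows "z = w \<or> edge_glued z w \<or> edge_glued w z \<or> vertex z \<and> vertex w"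
  using assms fibre equivclp_side_pairing_cases by blast

text \<open>By \<open>chart_at_edge\<close> a chart contains glued edge points in pairs, and
  vertices occur only in the corner chart, which contains all of them. Saturation makes the images
  of charts open in the quotient.\<close>

lemma dom_saturated:
  assumes "c \<in> charts" "z \<in> dom c" "w \<in> cball 0 1" "q z = q w"
  shows "w \<in> dom c"
proof -
  have e: "z \<in> dom c \<longleftrightarrow> w \<in> dom c" if "edge_glued z w" for z w
  proof -
    obtain k t where k: "first_side k" "0 < t" "t < 1" "z = rim g (real k + t)" "w = rim g (real k + 3 - t)"
      using \<open>edge_glued z w\<close> unfolding edge_glued_def by blast
    show ?thesis
    proof (cases "z \<in> dom c \<or> w \<in> dom c")
      case True
      then obtain a where "\<bar>real k + t - a\<bar> < 1 / 2" "a \<in> centres c" "2 * real k + 3 - a \<in> centres c"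
        using chart_at_edge[OF k(1-3) assms(1)] unfolding k(4,5) by blast
      then show ?thesis using edge_sectors[of k t a] sector_subset_dom k(4,5) by blast
    qed blast
  qed
  have "z \<in> cball 0 1" using assms(2) dom_subset by blast
  from fibre_cases[OF this assms(3,4)] show ?thesis
    using e assms vertex_chart[of z c] vertex_in_corner by blast
qed

text \<open>Glued pairs move to glued pairs: while \<open>k + t\<close> moves towards
  \<open>e\<close>, its partner moves towards the reflected centre \<open>2 * k + 3 - e\<close>, and
  a map affine in the angle commutes with the reflection.\<close>

lemma retract_compatible:
  assumes c: "c \<in> charts" and a: "a \<in> centres c" "z \<in> sector a" and b: "b \<in> centres c" "w \<in> sector b"
    and zw: "q z = q w" and l: "l \<in> {0..1}"
  shows "q (retract a (l, z)) = q (retract b (l, w))"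
proof -
  have same: "q (retract a (l, z)) = q (retract b (l, z))" if "a \<in> centres c" "b \<in> centres c" "z \<in> sector a" "z \<in> sector b" for a b z
    using retract_cong[of a b z l] sector_disjoint[of z a b] that centres_diff by simp
  have edge: "q (retract a (l, z)) = q (retract b (l, w))"
    if "a \<in> centres c" "z \<in> sector a" "b \<in> centres c" "w \<in> sector b" "edge_glued z w" for a b z w
  proof -
    obtain k t where k: "first_side k" "0 < t" "t < 1" "z = rim g (real k + t)" "w = rim g (real k + 3 - t)"
      using \<open>edge_glued z w\<close> unfolding edge_glued_def by blast
    have "z \<in> dom c" using that(1,2) sector_subset_dom by blast
    then obtain e where e: "\<bar>real k + t - e\<bar> < 1 / 2" "e \<in> centres c" "2 * real k + 3 - e \<in> centres c"
      "c = Edge k \<and> e = real k + 1 / 2 \<or> c = Corner \<and> (e = real k \<or> e = real k + 1)"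
      using chart_at_edge[OF k(1-3) c] unfolding k(4,5) by blast
    note s = edge_sectors[OF e(1), folded k(4,5)]
    \<comment> \<open>A convex combination of \<open>t\<close> and \<open>e - k\<close>, which is
      \<open>0\<close>, \<open>1 / 2\<close> or \<open>1\<close>; so the moving point stays on the
      side.\<close>
    define t' where "t' = e - k + (1 - l) * (k + t - e)"
    have "t' = (1 - l) * t + l * (e - k)" unfolding t'_def by (simp add: algebra_simps)
    moreover have "0 \<le> e - k" "e - k \<le> 1" using e(4) by auto
    ultimately have "0 \<le> t'" "t' \<le> 1"
      using l k(2,3) convex_bound_le[of t 1 "e - k" "1 - l" l] by auto
    have "retract e (l, z) = rim g (real k + t')"
      using retract_eq[of 1 "real k + t" e l] e(1) by (simp add: k(4) t'_def)
    moreover have "retract (2 * real k + 3 - e) (l, w) = rim g (real k + 3 - t')"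
    proof -
      have "\<bar>real k + 3 - t - (2 * real k + 3 - e)\<bar> < 1 / 2" using e(1) by linarith
      from retract_eq[of 1, OF _ this, of l] show ?thesis by (simp add: k(5) t'_def algebra_simps)
    qed
    ultimately have "q (retract e (l, z)) = q (retract (2 * real k + 3 - e) (l, w))"
      using q_edge[OF k(1) \<open>0 \<le> t'\<close> \<open>t' \<le> 1\<close>] by simp
    then show ?thesis using same that s e(2,3) by metis
  qed
  \<comment> \<open>A vertex in a corner sector is its centre, which the contraction fixes.\<close>
  have vert: "vertex (retract a (l, z))" if "a \<in> centres c" "z \<in> sector a" "vertex z" for a z
  proof -
    have "c = Corner" using vertex_chart[OF that(3) c] that sector_subset_dom by blast
    then have "a \<in> \<int>" using that(1) by simp
    then obtain i :: int where i: "a = of_int i" by (rule Ints_cases)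
    obtain m :: int where m: "z = rim g m" using \<open>vertex z\<close> unfolding vertex_def by blast
    have "turn_equiv g i m" using rim_vertex_sector that(2) turn_equiv_sym unfolding i m by blast
    then have "retract a (l, z) = retract m (l, z)" using retract_cong that(2) i by blast
    also have "\<dots> = rim g m" using retract_eq[of 1 m m l] m by simp
    finally show ?thesis unfolding vertex_def by blast
  qed
  have "z \<in> cball 0 1" "w \<in> cball 0 1" using a b sector_subset by blast+
  from fibre_cases[OF this zw] show ?thesis
    using same[of a b z] a b edge[OF a b] edge[OF b a] vert[OF a] vert[OF b] q_vertex by metis
qed

text \<open>A set-theoretic section, not continuous in general; on an edge it picks either of the
  two representatives.\<close>

definition sec :: "'s \<Rightarrow> complex" where "sec y = (SOME z. z \<in> cball 0 1 \<and> q z = y)"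

lemma sec: "y \<in> S \<Longrightarrow> sec y \<in> cball 0 1 \<and> q (sec y) = y"
proof -
  assume "y \<in> S"
  then have "\<exists>z. z \<in> cball 0 1 \<and> q z = y" using q_image by blast
  then show ?thesis unfolding sec_def by (rule someI_ex)
qed

lemma sec_dom: "c \<in> charts \<Longrightarrow> y \<in> q ` dom c \<Longrightarrow> sec y \<in> dom c"
proof -
  assume c: "c \<in> charts" and "y \<in> q ` dom c"
  then obtain z where z: "z \<in> dom c" "y = q z" by blast
  then have "y \<in> S" using dom_subset q_image by blast
  then show ?thesis using dom_saturated[OF c z(1), of "sec y"] sec[of y] z(2) by metis
qed

lemma openin_chart:
  assumes "V \<subseteq> cball 0 1" "openin (top_of_set (cball 0 1)) V" "\<And>z w. z \<in> V \<Longrightarrow> w \<in> cball 0 1 \<Longrightarrow> q z = q w \<Longrightarrow> w \<in> V"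
  shows "openin (top_of_set S) (q ` V)" "{z \<in> cball 0 1. q z \<in> q ` V} = V"
proof -
  show e: "{z \<in> cball 0 1. q z \<in> q ` V} = V"
  proof (intro equalityI subsetI)
    fix z assume "z \<in> {z \<in> cball 0 1. q z \<in> q ` V}"
    then obtain w where w: "w \<in> V" "q w = q z" and z: "z \<in> cball 0 1" by (metis (no_types, lifting) imageE mem_Collect_eq)
    then show "z \<in> V" using assms(3)[OF w(1) z w(2)] by simp
  qed (use assms(1) in auto)
  then show "openin (top_of_set S) (q ` V)"
  proof -
    have "q ` V \<subseteq> S" using assms(1) q_image by blast
    moreover have "\<And>U. U \<subseteq> S \<Longrightarrow> openin (top_of_set (cball 0 1)) {z \<in> cball 0 1. q z \<in> U} = openin (top_of_set S) U"
      using quotient unfolding quotient_map_def topspace_euclidean_subtopology by blast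
    ultimately have "openin (top_of_set (cball 0 1)) {z \<in> cball 0 1. q z \<in> q ` V} = openin (top_of_set S) (q ` V)"
      by blast
    then show ?thesis unfolding e using assms(2) by blast
  qed
qed

lemma contraction_descends:
  assumes V: "V \<subseteq> cball 0 1" "openin (top_of_set (cball 0 1)) V"
      "\<And>z w. z \<in> V \<Longrightarrow> w \<in> cball 0 1 \<Longrightarrow> q z = q w \<Longrightarrow> w \<in> V"
    and H: "continuous_on ({0..1::real} \<times> V) H" "H ` ({0..1} \<times> V) \<subseteq> cball 0 1"
    and compat: "\<And>l z w. l \<in> {0..1} \<Longrightarrow> z \<in> V \<Longrightarrow> w \<in> V \<Longrightarrow> q z = q w \<Longrightarrow> q (H (l, z)) = q (H (l, w))"
  obtains h where "continuous_on ({0..1::real} \<times> q ` V) h" "h ` ({0..1} \<times> q ` V) \<subseteq> S"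
    "\<And>l z. l \<in> {0..1} \<Longrightarrow> z \<in> V \<Longrightarrow> h (l, q z) = q (H (l, z))"
proof -
  note o = openin_chart[OF V]
  have sub: "q ` V \<subseteq> S" using V(1) q_image by blast
  have "quotient_map (subtopology (top_of_set (cball 0 1)) V) (subtopology (top_of_set S) (q ` V)) q"
    using o by (intro quotient_map_restriction[OF quotient]) auto
  then have "quotient_map (top_of_set V) (top_of_set (q ` V)) q"
    using V(1) sub by (simp add: subtopology_subtopology inf.absorb2)
  \<comment> \<open>The unit interval is locally compact and Hausdorff, so its product with a
    quotient map is a quotient map. This is what lets a homotopy descend.\<close>
  then have "quotient_map (prod_topology (top_of_set {0..1::real}) (top_of_set V))
      (prod_topology (top_of_set {0..1}) (top_of_set (q ` V))) (\<lambda>(x, y). (x, q y))"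
    by (intro quotient_map_prod_right)
      (auto simp: Hausdorff_space_subtopology compact_space_subtopology compact_imp_locally_compact_space
        Hausdorff_space_euclidean)
  then have quo: "quotient_map (top_of_set ({0..1::real} \<times> V)) (top_of_set ({0..1} \<times> q ` V)) (\<lambda>(x, y). (x, q y))"
    by simp
  have "continuous_on ({0..1::real} \<times> V) (\<lambda>x. q (H x))"
    using H by (intro continuous_on_compose2[OF q_continuous H(1)])
  moreover have "(\<lambda>x. q (H x)) ` ({0..1} \<times> V) \<subseteq> S" using H(2) q_image by blast
  ultimately have "continuous_map (top_of_set ({0..1::real} \<times> V)) (top_of_set S) (\<lambda>x. q (H x))"
    by (simp add: continuous_map_in_subtopology image_subset_iff_funcset)
  note cont = this
  have comp: "q (H x) = q (H y)" if "x \<in> topspace (top_of_set ({0..1::real} \<times> V))" "y \<in> topspace (top_of_set ({0..1} \<times> V))"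
    "(\<lambda>(x, y). (x, q y)) x = (\<lambda>(x, y). (x, q y)) y" for x y
    using that compat[of "fst x" "snd x" "snd y"] by (auto simp: case_prod_beta)
  show thesis
  proof (rule quotient_map_lift_exists[OF quo cont])
    fix h assume h: "continuous_map (top_of_set ({0..1} \<times> q ` V)) (top_of_set S) h"
      "\<And>x. x \<in> topspace (top_of_set ({0..1} \<times> V)) \<Longrightarrow> h (case x of (x, y) \<Rightarrow> (x, q y)) = q (H x)"
    show thesis
    proof (rule that)
      show "continuous_on ({0..1} \<times> q ` V) h" "h ` ({0..1} \<times> q ` V) \<subseteq> S"
        using h(1) by (simp_all add: continuous_map_in_subtopology image_subset_iff_funcset)
      show "h (l, q z) = q (H (l, z))" if "l \<in> {0..1}" "z \<in> V" for l z
        using h(2)[of "(l, z)"] that by simp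
    qed
  qed (rule comp)
qed

end

section \<open>Potentials of a path functor on the charts\<close>

locale polygon_functor = polygon_quotient g S q + path_functor G S u
  for g and S :: "'s::topological_space set" and q :: "complex \<Rightarrow> 's" and G :: "('b, 'm) monoid_scheme" (structure)
    and u :: "(real \<Rightarrow> 's) \<Rightarrow> 'b"
begin

text \<open>The trivialisation of \<open>u\<close> over the whole disc by radii. In general it does
  not descend to \<open>S\<close>: its values at two glued points differ by the transition of the
  edge.\<close>

definition eta :: "complex \<Rightarrow> 'b" where "eta z = u (q \<circ> linepath 0 z)"

lemma disc_path:
  assumes "path r" "path_image r \<subseteq> cball 0 1"
  shows "path (q \<circ> r)" "path_image (q \<circ> r) \<subseteq> S"
  using assms q_continuous q_image
  by (auto simp: path_image_compose intro!: path_continuous_image elim: continuous_on_subset)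

lemma eta_closed: "z \<in> cball 0 1 \<Longrightarrow> eta z \<in> carrier G"
  unfolding eta_def by (intro closed disc_path) (auto simp: closed_segment_subset simp del: mem_cball)

lemma eta_path:
  assumes "path r" "path_image r \<subseteq> cball 0 1"
  shows "u (q \<circ> r) = inv (eta (pathstart r)) \<otimes> eta (pathfinish r)"
proof -
  let ?z = "pathstart r" and ?w = "pathfinish r"
  have zw: "?z \<in> cball 0 1" "?w \<in> cball 0 1" using assms(2) by auto
  have im: "path_image (linepath 0 z) \<subseteq> cball 0 1" if "z \<in> cball 0 1" for z :: complex
    using that by (simp add: closed_segment_subset del: mem_cball)
  let ?p = "reversepath (linepath 0 ?z) +++ linepath 0 ?w"
  have p: "path ?p" "path_image ?p \<subseteq> cball 0 1" using im[OF zw(1)] im[OF zw(2)] by (simp_all add: path_image_join del: path_image_linepath reversepath_linepath)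
  have "homotopic_paths (cball 0 1) r ?p"
  proof (rule homotopic_paths_linear)
    fix t :: real assume "t \<in> {0..1}"
    then have "r t \<in> cball 0 1" "?p t \<in> cball 0 1" using assms(2) p(2) unfolding path_image_def by blast+
    then show "closed_segment (r t) (?p t) \<subseteq> cball 0 1" by (intro closed_segment_subset) auto
  qed (use assms p in auto)
  then have "u (q \<circ> r) = u (q \<circ> ?p)"
    using q_continuous q_image by (intro homotopic homotopic_paths_continuous_image) auto
  also have "\<dots> = u (reversepath (q \<circ> linepath 0 ?z)) \<otimes> u (q \<circ> linepath 0 ?w)"
    unfolding path_compose_join path_compose_reversepath
    using disc_path[OF _ im[OF zw(1)]] disc_path[OF _ im[OF zw(2)]]
    by (intro join) (auto simp: pathstart_compose pathfinish_compose)
  also have "\<dots> = inv (eta ?z) \<otimes> eta ?w"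
    unfolding eta_def using disc_path[OF _ im[OF zw(1)]] by (simp add: reverse)
  finally show ?thesis .
qed

lemma potential_exists:
  assumes V: "V \<subseteq> cball 0 1" "openin (top_of_set (cball 0 1)) V"
      "\<And>z w. z \<in> V \<Longrightarrow> w \<in> cball 0 1 \<Longrightarrow> q z = q w \<Longrightarrow> w \<in> V"
    and H: "continuous_on ({0..1::real} \<times> V) H" "H ` ({0..1} \<times> V) \<subseteq> cball 0 1"
    and compat: "\<And>l z w. l \<in> {0..1} \<Longrightarrow> z \<in> V \<Longrightarrow> w \<in> V \<Longrightarrow> q z = q w \<Longrightarrow> q (H (l, z)) = q (H (l, w))"
    and ends: "\<And>z. z \<in> V \<Longrightarrow> H (0, z) = z" "\<And>z. z \<in> V \<Longrightarrow> q (H (1, z)) = x"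
  shows "\<exists>\<psi>. (\<forall>y\<in>q ` V. \<psi> y \<in> carrier G) \<and>
    (\<forall>p. path p \<longrightarrow> path_image p \<subseteq> q ` V \<longrightarrow> u p = inv (\<psi> (pathstart p)) \<otimes> \<psi> (pathfinish p))"
proof -
  obtain h where h: "continuous_on ({0..1::real} \<times> q ` V) h" "h ` ({0..1} \<times> q ` V) \<subseteq> S"
    "\<And>l z. l \<in> {0..1} \<Longrightarrow> z \<in> V \<Longrightarrow> h (l, q z) = q (H (l, z))"
    by (rule contraction_descends[OF V H compat]) (assumption+, erule that, assumption+)
  define \<psi> where "\<psi> y = inv (u (\<lambda>t. h (t, y)))" for y
  have cl: "u (\<lambda>t. h (t, y)) \<in> carrier G" if "y \<in> q ` V" for y
  proof (rule closed)
    show "path (\<lambda>t. h (t, y))" unfolding path_def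
      using that by (intro continuous_on_compose2[OF h(1)] continuous_intros) auto
    show "path_image (\<lambda>t. h (t, y)) \<subseteq> S" unfolding path_image_def using that h(2) by blast
  qed
  have "u p = inv (\<psi> (pathstart p)) \<otimes> \<psi> (pathfinish p)" if p: "path p" "path_image p \<subseteq> q ` V" for p
  proof -
    have "u p = u (\<lambda>t. h (t, pathstart p)) \<otimes> inv (u (\<lambda>t. h (t, pathfinish p)))"
      using h(3) ends by (intro contraction[OF h(1,2) _ _ p, of x]) auto
    moreover have "pathstart p \<in> q ` V" "pathfinish p \<in> q ` V" using p(2) by auto
    ultimately show ?thesis unfolding \<psi>_def using cl by simp
  qed
  then show ?thesis using cl unfolding \<psi>_def by (intro exI[of _ \<psi>]) (auto simp: \<psi>_def)
qed

lemma chart_potential: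
  assumes "c \<in> charts"
  shows "\<exists>\<psi>. (\<forall>y\<in>q ` dom c. \<psi> y \<in> carrier G) \<and>
    (\<forall>p. path p \<longrightarrow> path_image p \<subseteq> q ` dom c \<longrightarrow> u p = inv (\<psi> (pathstart p)) \<otimes> \<psi> (pathfinish p))"
proof (cases "c = Disc")
  case True
  let ?H = "\<lambda>x::real\<times>complex. (1 - fst x) *\<^sub>R snd x"
  \<comment> \<open>In the open disc \<open>q\<close> identifies no points, so compatibility with
    the gluing is automatic.\<close>
  have inj: "z = w" if "z \<in> dom c" "w \<in> dom c" "q z = q w" for z w
  proof -
    have "norm z < 1" "norm w < 1" using that True by (auto simp: dom_def)
    moreover have "norm z = 1" if "edge_glued z w \<or> edge_glued w z \<or> vertex z" for z w
      using that unfolding edge_glued_def vertex_def by auto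
    moreover have "z = w \<or> edge_glued z w \<or> edge_glued w z \<or> vertex z \<and> vertex w"
      using that dom_subset[of c] by (intro fibre_cases) blast+
    ultimately show ?thesis by (metis less_irrefl)
  qed
  show ?thesis
  proof (rule potential_exists[where H = ?H and x = "q 0"])
    show "?H ` ({0..1} \<times> dom c) \<subseteq> cball 0 1"
    proof clarify
      fix l :: real and z assume lz: "l \<in> {0..1}" "z \<in> dom c"
      then have "z \<in> cball 0 1" using dom_subset by blast
      then have "norm z \<le> 1" by simp
      then show "?H (l, z) \<in> cball 0 1" using lz mult_mono[of "1 - l" 1 "norm z" 1] by simp
    qed
    show "q (?H (l, z)) = q (?H (l, w))" if "z \<in> dom c" "w \<in> dom c" "q z = q w" for l z w
      using inj[OF that] by simp
  qed (use dom_subset openin_dom dom_saturated[OF assms] in \<open>auto intro!: continuous_intros\<close>)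
next
  case False
  have op: "openin (top_of_set ({0..1::real} \<times> dom c)) ({0..1} \<times> sector a)" if "a \<in> centres c" for a
  proof -
    have "openin (top_of_set (dom c)) (sector a)"
      using openin_sector[of a] sector_subset_dom[OF that] dom_subset by (rule openin_subset_trans)
    then have "openin (prod_topology (top_of_set {0..1::real}) (top_of_set (dom c))) ({0..1} \<times> sector a)"
      by (simp only: openin_prod_Times_iff) (metis openin_topspace topspace_euclidean_subtopology)
    then show ?thesis by simp
  qed
  \<comment> \<open>Sectors of one chart meet only if their centres agree up to full turns, and then
    the contractions coincide, so they can be pasted.\<close>
  have agree: "retract a x = retract b x" if "a \<in> centres c" "b \<in> centres c"
    "x \<in> {0..1} \<times> sector a" "x \<in> {0..1} \<times> sector b" for a b and x :: "real \<times> complex"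
    using that retract_cong[of a b "snd x" "fst x"] sector_disjoint[of "snd x" a b] centres_diff
    by (auto simp: mem_Times_iff)
  have cov: "topspace (top_of_set ({0..1::real} \<times> dom c)) \<subseteq> (\<Union>a\<in>centres c. {0..1} \<times> sector a)"
    using dom_sector[OF False] by auto
  have ct: "continuous_map (subtopology (top_of_set ({0..1::real} \<times> dom c)) ({0..1} \<times> sector a)) euclidean (retract a)"
    if "a \<in> centres c" for a
  proof -
    have "({0..1::real} \<times> dom c) \<inter> ({0..1} \<times> sector a) = {0..1} \<times> sector a" using sector_subset_dom[OF that] by blast
    then show ?thesis using continuous_on_retract by (simp add: subtopology_subtopology)
  qed
  obtain H where H: "continuous_map (top_of_set ({0..1::real} \<times> dom c)) euclidean H"
    "\<And>x a. a \<in> centres c \<Longrightarrow> x \<in> topspace (top_of_set ({0..1} \<times> dom c)) \<inter> ({0..1} \<times> sector a) \<Longrightarrow> H x = retract a x"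
    using pasting_lemma_exists[where I = "centres c" and T = "\<lambda>a. {0..1} \<times> sector a" and f = retract and Y = euclidean, OF cov op ct]
      agree by blast
  have H': "H (l, z) = retract a (l, z)" if "a \<in> centres c" "l \<in> {0..1}" "z \<in> sector a" for l z a
    using H(2)[of a "(l, z)"] that sector_subset_dom by auto
  \<comment> \<open>The contraction ends at the sector centres. These have one common image: the
    midpoints of two glued sides, or the vertex.\<close>
  obtain a\<^sub>0 where same: "\<And>a. a \<in> centres c \<Longrightarrow> q (rim g a) = q (rim g a\<^sub>0)"
  proof (cases c)
    case (Edge k)
    then have k: "first_side k" using assms by (auto simp: charts_def)
    have "q (rim g a) = q (rim g (real k + 1 / 2))" if "a \<in> centres c" for a
    proof -
      have "rim g a = rim g (real k + 1 / 2) \<or> rim g a = rim g (real k + 3 - 1 / 2)"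
        using that Edge rim_eq_iff by (auto simp: add.commute)
      then show ?thesis using q_edge[OF k, of "1/2"] by auto
    qed
    then show ?thesis by (rule that)
  next
    case Corner
    have "q (rim g a) = q (rim g 0)" if "a \<in> centres c" for a
      using that Corner q_vertex unfolding vertex_def by (auto elim!: Ints_cases)
    then show ?thesis by (rule that)
  qed (use False in simp)
  show ?thesis
  proof (rule potential_exists[where H = H and x = "q (rim g a\<^sub>0)"])
    show "continuous_on ({0..1} \<times> dom c) H" using H(1) by simp
    show "H ` ({0..1} \<times> dom c) \<subseteq> cball 0 1"
    proof clarify
      fix l :: real and z assume lz: "l \<in> {0..1}" "z \<in> dom c"
      then obtain a where "a \<in> centres c" "z \<in> sector a" using dom_sector[OF False] by blast
      then have "H (l, z) = retract a (l, z)" "z \<in> cball 0 1" using H' lz(1) sector_subset by blast+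
      then show "H (l, z) \<in> cball 0 1" using retract_in_disc[OF lz(1)] by simp
    qed
    show "q (H (l, z)) = q (H (l, w))" if "l \<in> {0..1}" "z \<in> dom c" "w \<in> dom c" "q z = q w" for l z w
      using dom_sector[OF False that(2)] dom_sector[OF False that(3)] H' retract_compatible[OF assms] that by metis
    show "H (0, z) = z" if "z \<in> dom c" for z
      using dom_sector[OF False that] H'[of _ 0 z] retract_0 by auto
    show "q (H (1, z)) = q (rim g a\<^sub>0)" if "z \<in> dom c" for z
      using dom_sector[OF False that] H'[of _ 1 z] retract_1 same by auto
  qed (use dom_subset openin_dom dom_saturated[OF assms] in auto)
qed

end

section \<open>Transition data\<close>

lemma (in group) inv_mult_eq_mult_inv:
  assumes "a \<otimes> x = b \<otimes> y" "a \<in> carrier G" "b \<in> carrier G" "x \<in> carrier G" "y \<in> carrier G"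
  shows "inv a \<otimes> b = x \<otimes> inv y"
proof -
  have "b = b \<otimes> y \<otimes> inv y" using assms(2-) by (simp add: m_assoc)
  also have "\<dots> = a \<otimes> (x \<otimes> inv y)" unfolding assms(1)[symmetric] using assms(2-) by (simp add: m_assoc)
  finally have "inv a \<otimes> b = inv a \<otimes> (a \<otimes> (x \<otimes> inv y))" by simp
  then show ?thesis using assms(2-) by simp
qed

context polygon
begin

text \<open>Data for a flat bundle with structure group \<open>M\<close>: \<open>X k\<close> is the transition across the edge
  glued along side \<open>k\<close>, and \<open>\<delta> m\<close> compares the sector at the corner \<open>m\<close> with the one at corner \<open>0\<close>.
  Going around the vertex, \<open>\<delta> (4 * g) = \<delta> 0\<close> is the surface relation.\<close>

definition crossing_data :: "('k, 'm) monoid_scheme \<Rightarrow> (nat \<Rightarrow> 'k) \<Rightarrow> (nat \<Rightarrow> 'k) \<Rightarrow> bool"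
  where "crossing_data M X \<delta> \<longleftrightarrow>
    (\<forall>k. first_side k \<longrightarrow> X k \<in> carrier M) \<and> (\<forall>m\<le>4 * g. \<delta> m \<in> carrier M) \<and> \<delta> (4 * g) = \<delta> 0 \<and>
    (\<forall>k. first_side k \<longrightarrow> \<delta> (k + 3) = \<delta> k \<otimes>\<^bsub>M\<^esub> X k \<and> \<delta> (k + 2) = \<delta> (k + 1) \<otimes>\<^bsub>M\<^esub> X k)"

text \<open>The trivialisation of a chart relative to that of the disc. It lives on the polygon, not
  on the surface: at glued boundary points its values differ by the transition of the edge.\<close>

definition gauge :: "'k \<Rightarrow> (nat \<Rightarrow> 'k) \<Rightarrow> (nat \<Rightarrow> 'k) \<Rightarrow> chart \<Rightarrow> complex \<Rightarrow> 'k"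
  where "gauge e X \<delta> c z = (case c of Disc \<Rightarrow> e
    | Edge k \<Rightarrow> if z \<in> sector (real k + 1 / 2) then e else X k
    | Corner \<Rightarrow> \<delta> (SOME m. m < 4 * g \<and> z \<in> sector (real m)))"

lemma sector_corner_unique:
  assumes "z \<in> sector (real m)" "z \<in> sector (real n)" "m < 4 * g" "n < 4 * g"
  shows "m = n"
  using sector_disjoint[OF assms(1,2)] assms(3,4) turn_equiv_nat_less by auto

lemma gauge_corner:
  assumes "z \<in> sector (real m)" "m \<le> 4 * g" "\<delta> (4 * g) = \<delta> 0"
  shows "gauge e X \<delta> Corner z = \<delta> m"
proof -
  define n where "n = (if m = 4 * g then 0 else m)"
  have "turn_equiv g (4 * real g) 0" unfolding turn_equiv_def by (intro exI[of _ 1]) simp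
  then have "sector (real (4 * g)) = sector (real 0)" using sector_cong by simp
  then have n: "n < 4 * g" "z \<in> sector (real n)" "\<delta> n = \<delta> m"
    unfolding n_def by (cases "m = 4 * g"; use assms genus in simp)+
  then have "(SOME m. m < 4 * g \<and> z \<in> sector (real m)) = n"
    using sector_corner_unique by (intro some_equality) blast+
  then show ?thesis using n by (simp add: gauge_def)
qed

lemma corner_sector:
  assumes "a \<in> centres Corner"
  obtains m where "m < 4 * g" "sector a = sector (real m)"
proof -
  obtain i :: int where i: "a = of_int i" using assms by (auto elim: Ints_cases)
  obtain m where m: "m < 4 * g" "turn_equiv g a m" using turn_equiv_nat_exists[of i] unfolding i by blast
  then show thesis using that[OF m(1)] sector_cong by blast
qed

lemma gauge_edge:
  "z \<in> sector (real k + 1 / 2) \<Longrightarrow> gauge e X \<delta> (Edge k) z = e"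
  "z \<in> sector (real k + 5 / 2) \<Longrightarrow> gauge e X \<delta> (Edge k) z = X k"
proof -
  assume z: "z \<in> sector (real k + 5 / 2)"
  have "z \<notin> sector (real k + 1 / 2)"
  proof
    assume "z \<in> sector (real k + 1 / 2)"
    then have "turn_equiv g (real k + 5 / 2) (real k + 1 / 2)"
      using sector_disjoint[OF z] by simp
    \<comment> \<open>Centres two sides apart cannot agree, as the number of sides is a multiple of
      4.\<close>
    then obtain n :: int where "2 = 4 * real g * n" unfolding turn_equiv_def by auto
    then have "real_of_int 2 = real_of_int (4 * int g * n)" by simp
    then have "2 = 4 * (int g * n)" by linarith
    then show False by presburger
  qed
  then show "gauge e X \<delta> (Edge k) z = X k" by (simp add: gauge_def)
qed (simp add: gauge_def)

lemma gauge_sector_const: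
  assumes "a \<in> centres c" "z \<in> sector a" "w \<in> sector a"
  shows "gauge e X \<delta> c z = gauge e X \<delta> c w"
proof (cases c)
  case (Edge k)
  then have "sector a = sector (real k + 1 / 2) \<or> sector a = sector (real k + 5 / 2)"
    using assms(1) sector_cong by auto
  then show ?thesis using gauge_edge assms unfolding Edge by metis
next
  case Corner
  then obtain m where "m < 4 * g" "sector a = sector (real m)" using corner_sector assms(1) by blast
  then have "m' < 4 * g \<and> z \<in> sector (real m') \<longleftrightarrow> m' < 4 * g \<and> w \<in> sector (real m')" for m'
    using assms sector_corner_unique by metis
  then show ?thesis unfolding Corner gauge_def by simp
qed (use assms in simp)

lemma gauge_closed:
  fixes M (structure)
  assumes "group M" "crossing_data M X \<delta>" "c \<in> charts" "z \<in> dom c"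
  shows "gauge \<one> X \<delta> c z \<in> carrier M"
proof (cases c)
  case Disc
  then show ?thesis using assms(1) by (simp add: gauge_def group.is_monoid monoid.one_closed)
next
  case (Edge k)
  then have "first_side k" using assms(3) by (auto simp: charts_def)
  then show ?thesis using assms(1,2) Edge
    by (simp add: gauge_def crossing_data_def group.is_monoid monoid.one_closed)
next
  case Corner
  then obtain a where "a \<in> centres Corner" "z \<in> sector a" using dom_sector[of c z] assms(4) by auto
  then obtain m where "m < 4 * g" "z \<in> sector (real m)" using corner_sector by metis
  then show ?thesis using assms(2) gauge_corner[of z m \<delta>] unfolding Corner crossing_data_def by simp
qed

text \<open>When the point is near corner \<open>k\<close>, its partner is near
  \<open>k + 3\<close>; near \<open>k + 1\<close>, the partner is near \<open>k + 2\<close>. These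
  are the two equations on \<open>\<delta>\<close> for each edge. In the edge chart the rule is
  built into \<open>gauge\<close>.\<close>

lemma gauge_crossing:
  fixes M (structure)
  assumes "group M" "crossing_data M X \<delta>" "c \<in> charts"
    and k: "first_side k" "0 < t" "t < 1" and "rim g (real k + t) \<in> dom c"
  shows "gauge \<one> X \<delta> c (rim g (real k + 3 - t)) = gauge \<one> X \<delta> c (rim g (real k + t)) \<otimes> X k"
proof -
  interpret M: group M by fact
  have X: "X k \<in> carrier M" and \<delta>: "\<delta> (4 * g) = \<delta> 0"
    "\<delta> (k + 3) = \<delta> k \<otimes> X k" "\<delta> (k + 2) = \<delta> (k + 1) \<otimes> X k"
    using assms(2) k(1) unfolding crossing_data_def by auto
  obtain a where a: "\<bar>real k + t - a\<bar> < 1 / 2"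
    "c = Edge k \<and> a = real k + 1 / 2 \<or> c = Corner \<and> (a = real k \<or> a = real k + 1)"
    using chart_at_edge[OF k assms(3)] assms(7) by metis
  note s = edge_sectors[OF a(1)]
  from a(2) consider "c = Edge k" "a = real k + 1 / 2" | "c = Corner" "a = real k" | "c = Corner" "a = real (k + 1)" by auto
  then show ?thesis
  proof cases
    case 1
    have e: "2 * real k + 3 - a = real k + 5 / 2" using 1 by simp
    show ?thesis using X unfolding 1(1) by (simp add: gauge_edge(1)[OF s(1)[unfolded 1(2)]] gauge_edge(2)[OF s(2)[unfolded e]])
  next
    case 2
    have e: "2 * real k + 3 - a = real (k + 3)" using 2 by simp
    show ?thesis
      using gauge_corner[of _ k, OF s(1)[unfolded 2(2)] _ \<delta>(1)] gauge_corner[of _ "k + 3", OF s(2)[unfolded e] _ \<delta>(1)]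
        first_side_bound[OF k(1)] \<delta>(2) unfolding 2(1) by simp
  next
    case 3
    have e: "2 * real k + 3 - a = real (k + 2)" using 3 by simp
    show ?thesis
      using gauge_corner[of _ "k + 1", OF s(1)[unfolded 3(2)] _ \<delta>(1)] gauge_corner[of _ "k + 2", OF s(2)[unfolded e] _ \<delta>(1)]
        first_side_bound[OF k(1)] \<delta>(3) unfolding 3(1) by simp
  qed
qed

lemma gauge_hom:
  assumes "c \<in> charts" "z \<in> dom c" and one: "\<pi> e = e'" and X: "\<And>k. first_side k \<Longrightarrow> \<pi> (X k) = X' k"
    and \<delta>: "\<And>m. m \<le> 4 * g \<Longrightarrow> \<pi> (\<delta> m) = \<delta>' m" and cyc: "\<delta> (4 * g) = \<delta> 0" "\<delta>' (4 * g) = \<delta>' 0"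
  shows "\<pi> (gauge e X \<delta> c z) = gauge e' X' \<delta>' c z"
proof (cases c)
  case (Edge k)
  then have "first_side k" using assms(1) by (auto simp: charts_def)
  then show ?thesis using X one Edge by (simp add: gauge_def)
next
  case Corner
  then obtain a where "a \<in> centres Corner" "z \<in> sector a" using dom_sector[of c z] assms(2) by auto
  then obtain m where "m < 4 * g" "z \<in> sector (real m)" using corner_sector by metis
  then show ?thesis using cyc \<delta> unfolding Corner by (simp add: gauge_corner)
qed (use one in \<open>simp add: gauge_def\<close>)

end

section \<open>The flat atlas of given crossing data\<close>

context polygon_quotient
begin

text \<open>Passing to the glued point multiplies both values on the right by the same transition,
  which cancels in the quotient. Vertices lie in the corner chart only, hence in no overlap of
  different charts.\<close>

lemma transition_well_defined:
  fixes M (structure)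
  assumes M: "group M" "crossing_data M X \<delta>" and c: "c \<in> charts" "c' \<in> charts" "c \<noteq> c'"
    and z: "z \<in> dom c" "z \<in> dom c'" and w: "w \<in> cball 0 1" "q z = q w"
  defines "\<kappa> \<equiv> gauge \<one> X \<delta>"
  shows "\<kappa> c' z \<otimes> inv \<kappa> c z = \<kappa> c' w \<otimes> inv \<kappa> c w"
proof -
  interpret M: group M by fact
  have e: "\<kappa> c' z \<otimes> inv \<kappa> c z = \<kappa> c' w \<otimes> inv \<kappa> c w"
    if "edge_glued z w" "z \<in> dom c" "z \<in> dom c'" for z w
  proof -
    obtain k t where k: "first_side k" "0 < t" "t < 1" "z = rim g (real k + t)" "w = rim g (real k + 3 - t)"
      using \<open>edge_glued z w\<close> unfolding edge_glued_def by blast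
    have X: "X k \<in> carrier M" using M(2) k(1) unfolding crossing_data_def by auto
    have cl: "\<kappa> c z \<in> carrier M" "\<kappa> c' z \<in> carrier M"
      unfolding \<kappa>_def using gauge_closed[OF M] c that by auto
    have "\<kappa> c w = \<kappa> c z \<otimes> X k" "\<kappa> c' w = \<kappa> c' z \<otimes> X k"
      unfolding \<kappa>_def k(4,5) using gauge_crossing[OF M _ k(1-3)] c that(2,3) unfolding k(4) by auto
    then show ?thesis using cl X by (simp add: M.inv_mult_group M.m_assoc)
  qed
  have "z \<in> cball 0 1" using z(1) dom_subset by blast
  from fibre_cases[OF this w] show ?thesis
  proof (elim disjE conjE)
    assume "edge_glued z w" then show ?thesis using e z by blast
  next
    assume "edge_glued w z" then show ?thesis
      using e[of w z] dom_saturated[OF c(1) z(1) w] dom_saturated[OF c(2) z(2) w] by simp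
  next
    assume "vertex z" then show ?thesis using vertex_chart z c by blast
  qed simp
qed

text \<open>The potentials may jump with \<open>sec\<close>, but their quotient for two charts does
  not depend on the representative and is locally constant on the overlap, hence constant along
  every path in it.\<close>

lemma flat_atlas_gauge:
  fixes M (structure)
  assumes M: "group M" "crossing_data M X \<delta>"
  shows "flat_atlas M S charts (\<lambda>c. q ` dom c) (\<lambda>c y. gauge \<one> X \<delta> c (sec y))"
proof -
  interpret M: group M by fact
  define \<kappa> where "\<kappa> = gauge \<one> X \<delta>"
  have cl: "\<kappa> c z \<in> carrier M" if "c \<in> charts" "z \<in> dom c" for c z
    unfolding \<kappa>_def using gauge_closed[OF M that] .
  have op: "openin (top_of_set (cball 0 1)) {z \<in> dom c. \<kappa> c z = v}" for c v
  proof (cases "c = Disc")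
    case True
    then have "{z \<in> dom c. \<kappa> c z = v} = dom c \<or> {z \<in> dom c. \<kappa> c z = v} = {}"
      unfolding \<kappa>_def gauge_def by auto
    then show ?thesis using openin_dom by (metis openin_empty)
  next
    case False
    have "\<exists>T. openin (top_of_set (cball 0 1)) T \<and> z \<in> T \<and> T \<subseteq> {z \<in> dom c. \<kappa> c z = v}"
      if z: "z \<in> {z \<in> dom c. \<kappa> c z = v}" for z
    proof -
      obtain a where a: "a \<in> centres c" "z \<in> sector a" using dom_sector[OF False] z by blast
      have "sector a \<subseteq> {z \<in> dom c. \<kappa> c z = v}"
      proof
        fix w assume w: "w \<in> sector a"
        then have "\<kappa> c z = \<kappa> c w" unfolding \<kappa>_def by (rule gauge_sector_const[OF a])
        then show "w \<in> {z \<in> dom c. \<kappa> c z = v}" using w z sector_subset_dom[OF a(1)] by auto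
      qed
      then show ?thesis using openin_sector a(2) by blast
    qed
    then show ?thesis using openin_subopen by blast
  qed
  show ?thesis
    unfolding \<kappa>_def[symmetric]
  proof
    fix c assume c: "c \<in> charts"
    show "openin (top_of_set S) (q ` dom c)"
      using openin_chart(1)[OF dom_subset openin_dom] dom_saturated[OF c] by blast
    show "\<kappa> c (sec y) \<in> carrier M" if "y \<in> q ` dom c" for y
      using cl[OF c] sec_dom[OF c that] .
  next
    show "S \<subseteq> (\<Union>c\<in>charts. q ` dom c)"
    proof
      fix y assume "y \<in> S"
      then obtain z where z: "z \<in> cball 0 1" "q z = y" using q_image by blast
      have "\<exists>c\<in>charts. z \<in> dom c"
      proof (cases "norm z < 1")
        case True then show ?thesis by (intro bexI[of _ Disc]) (auto simp: dom_def charts_def)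
      next
        case False
        then have "norm z = 1" using z(1) by simp
        define s where "s = 4 * real g * Arg z / (2 * pi)"
        have "rim g s = z"
        proof -
          have "2 * pi * s / (4 * real g) = Arg z" using genus by (simp add: s_def)
          then have "rim g s = cis (Arg z)" by (simp add: rim_def)
          also have "z \<noteq> 0" using \<open>norm z = 1\<close> by auto
          then have "cis (Arg z) = z" using \<open>norm z = 1\<close> by (simp add: cis_Arg sgn_eq)
          finally show ?thesis .
        qed
        define k t where "k = \<lfloor>s\<rfloor>" and "t = s - \<lfloor>s\<rfloor>"
        have t: "0 \<le> t" "t < 1" "s = real_of_int k + t" unfolding k_def t_def by linarith+
        show ?thesis
        \<comment> \<open>The open corner sectors cover the boundary except for the midpoints of the
          sides, which lie in the edge charts.\<close>
        proof (cases "t = 1 / 2")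
          case False
          have "rim g s \<in> sector (if t < 1 / 2 then of_int k else of_int (k + 1))"
            using sectorI[of 1 s "if t < 1 / 2 then of_int k else of_int (k + 1)"] t False by (auto simp: abs_less_iff)
          then have "z \<in> dom Corner" using \<open>rim g s = z\<close> sector_subset_dom[of "if t < 1 / 2 then of_int k else of_int (k + 1)" Corner]
            by (auto split: if_splits)
          then show ?thesis by (intro bexI[of _ Corner]) (auto simp: charts_def)
        next
          case True
          obtain m where m: "m < 4 * g" "turn_equiv g k m" using turn_equiv_nat_exists by blast
          then have te: "turn_equiv g s (real m + 1 / 2)" unfolding t(3) True turn_equiv_def by auto
          have in_sector: "z \<in> sector (real m + 1 / 2)"
            using te rim_eq_iff[of s "real m + 1 / 2"] sectorI[of 1 "real m + 1 / 2" "real m + 1 / 2"] \<open>rim g s = z\<close> by auto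
          \<comment> \<open>If \<open>m\<close> is the second side of its pair, the chart is named
            after side \<open>m - 2\<close>.\<close>
          define k' where "k' = (if m mod 4 < 2 then m else m - 2)"
          have "first_side k' \<and> (m = k' \<or> m = k' + 2)"
          proof (cases "m mod 4 < 2")
            case True then show ?thesis using m(1) by (simp add: k'_def first_side_def)
          next
            case False
            define i where "i = m div 4"
            have "m mod 4 < 4" by simp
            then have "m mod 4 = 2 \<or> m mod 4 = 3" using False by linarith
            then have "m = 4 * i + 2 \<or> m = 4 * i + 3" unfolding i_def using mult_div_mod_eq[of 4 m] by linarith
            then have "k' = 4 * i \<and> m = k' + 2 \<or> k' = 4 * i + 1 \<and> m = k' + 2" using False unfolding k'_def by auto
            then have "k' mod 4 < 2 \<and> m = k' + 2" by (elim disjE conjE; simp add: mod_Suc)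
            then show ?thesis using m(1) by (simp add: first_side_def)
          qed
          then have "z \<in> dom (Edge k')" "Edge k' \<in> charts"
            using in_sector sector_subset_dom[of "real m + 1 / 2" "Edge k'"] by (auto simp: charts_def add.commute)
          then show ?thesis by blast
        qed
      qed
      then show "y \<in> (\<Union>c\<in>charts. q ` dom c)" using z by blast
    qed
  next
    fix c c' r assume c: "c \<in> charts" "c' \<in> charts" and r: "path r" "path_image r \<subseteq> q ` dom c \<inter> q ` dom c'"
    let ?\<kappa> = "\<lambda>c y. \<kappa> c (sec y)"
    show "inv ?\<kappa> c (pathstart r) \<otimes> ?\<kappa> c (pathfinish r) = inv ?\<kappa> c' (pathstart r) \<otimes> ?\<kappa> c' (pathfinish r)"
    proof (cases "c = c'")
      case False
      define tr where "tr y = ?\<kappa> c' y \<otimes> inv ?\<kappa> c y" for y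
      \<comment> \<open>Level sets of the quotient, taken in the polygon: being open and saturated,
        they have open images in \<open>S\<close>.\<close>
      define W where "W v = {z \<in> dom c \<inter> dom c'. \<kappa> c' z \<otimes> inv \<kappa> c z = v}" for v
      have tr: "tr (q z) = \<kappa> c' z \<otimes> inv \<kappa> c z" if "z \<in> dom c" "z \<in> dom c'" for z
      proof -
        have "q z \<in> S" using that dom_subset q_image by blast
        then have "sec (q z) \<in> cball 0 1" "q z = q (sec (q z))" using sec[of "q z"] by auto
        then show ?thesis using transition_well_defined[OF M c False that] unfolding tr_def \<kappa>_def by simp
      qed
      have Wo: "openin (top_of_set (cball 0 1)) (W v)" for v
      proof -
        have "W v = (\<Union>(a, b)\<in>{(a, b). a \<otimes> inv b = v}. {z \<in> dom c'. \<kappa> c' z = a} \<inter> {z \<in> dom c. \<kappa> c z = b})"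
          unfolding W_def by auto
        moreover have "openin (top_of_set (cball 0 1)) \<dots>" using op by (intro openin_Union) auto
        ultimately show ?thesis by simp
      qed
      have Wsat: "w \<in> W v" if "z \<in> W v" "w \<in> cball 0 1" "q z = q w" for z w v
      proof -
        have "z \<in> dom c" "z \<in> dom c'" using that(1) unfolding W_def by auto
        moreover then have "w \<in> dom c" "w \<in> dom c'" using dom_saturated c that by blast+
        ultimately show ?thesis using tr[of z] tr[of w] that unfolding W_def by auto
      qed
      have Wsub: "W v \<subseteq> cball 0 1" for v using dom_subset unfolding W_def by blast
      have Wopen: "openin (top_of_set S) (q ` W v)" for v
        by (rule openin_chart(1)[OF Wsub Wo Wsat])
      have WI: "y \<in> q ` W (tr y)" if y: "y \<in> q ` dom c \<inter> q ` dom c'" for y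
      proof -
        obtain z where z: "z \<in> dom c" "y = q z" using y by blast
        obtain z' where z': "z' \<in> dom c'" "y = q z'" using y by blast
        have "z \<in> cball 0 1" using z(1) dom_subset by blast
        then have "z \<in> dom c'" using dom_saturated[OF c(2) z'(1)] z(2) z'(2) by simp
        then show ?thesis using z tr[of z] unfolding W_def by auto
      qed
      have WD: "tr y = v" if y: "y \<in> q ` W v" for y v
        using y tr unfolding W_def by auto
      have "tr (r 0) = tr (r 1)"
      proof (rule connected_local_const[where A = "{0..1}" and f = "\<lambda>s. tr (r s)"])
        show "\<forall>a\<in>{0..1}. \<forall>\<^sub>F b in at a within {0..1}. tr (r a) = tr (r b)"
        proof
          fix a :: real assume a: "a \<in> {0..1}"
          have "r ` {0..1} \<subseteq> S" using r(2) dom_subset q_image unfolding path_image_def by blast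
          then have "openin (top_of_set {0..1}) ({0..1} \<inter> r -` (q ` W (tr (r a))))"
            using continuous_openin_preimage[OF r(1)[unfolded path_def] _ Wopen] by (simp add: image_subset_iff_funcset)
          then obtain T where T: "open T" "{0..1} \<inter> r -` (q ` W (tr (r a))) = {0..1} \<inter> T" by (auto simp: openin_open)
          have "a \<in> T" using T(2) a WI[of "r a"] r(2) unfolding path_image_def by blast
          have "tr (r a) = tr (r b)" if "b \<in> T" "b \<in> {0..1}" for b
          proof -
            have "b \<in> {0..1} \<inter> r -` (q ` W (tr (r a)))" using that unfolding T(2) by blast
            then show ?thesis using WD[of "r b" "tr (r a)"] by simp
          qed
          then show "\<forall>\<^sub>F b in at a within {0..1}. tr (r a) = tr (r b)"
            unfolding eventually_at_topological using T(1) \<open>a \<in> T\<close> by blast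
        qed
      qed auto
      then have eq: "tr (pathstart r) = tr (pathfinish r)" by (simp add: pathstart_def pathfinish_def)
      have ends: "pathstart r \<in> q ` dom c \<inter> q ` dom c'" "pathfinish r \<in> q ` dom c \<inter> q ` dom c'" using r(2) by auto
      have k: "?\<kappa> c y \<in> carrier M" "?\<kappa> c' y \<in> carrier M" if "y \<in> q ` dom c \<inter> q ` dom c'" for y
        using that cl sec_dom c by auto
      have "?\<kappa> c' (pathstart r) \<otimes> inv ?\<kappa> c (pathstart r) \<otimes> ?\<kappa> c (pathfinish r)
        = ?\<kappa> c' (pathfinish r)"
        using eq k[OF ends(1)] k[OF ends(2)] unfolding tr_def by (simp add: M.m_assoc)
      then show ?thesis
        using k[OF ends(1)] k[OF ends(2)] by (simp add: M.m_assoc M.inv_solve_left)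
    qed simp
  qed
qed

end

section \<open>Crossing data of a path functor\<close>

context polygon_functor
begin

text \<open>In the polygon both the chart potential \<open>\<psi> c\<close> and \<open>eta\<close>
  are potentials of \<open>u\<close>, so on a sector they differ by a constant left factor
  \<open>\<kappa> c a\<close>. Quotients of these factors within a chart are the transition data.
  Then \<open>gauge\<close> times \<open>eta\<close> is \<open>\<psi> c\<close> up to one left
  factor, which cancels in \<open>u p\<close>.\<close>

lemma functor_crossing_data:
  obtains X \<delta> where "crossing_data G X \<delta>" "\<delta> 0 = \<one>"
    "\<And>c p. c \<in> charts \<Longrightarrow> path p \<Longrightarrow> path_image p \<subseteq> q ` dom c \<Longrightarrow>
      u p = inv (gauge \<one> X \<delta> c (sec (pathstart p)) \<otimes> eta (sec (pathstart p))) \<otimes>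
        (gauge \<one> X \<delta> c (sec (pathfinish p)) \<otimes> eta (sec (pathfinish p)))"
proof -
  define P where "P = (\<lambda>c \<psi>. (\<forall>y\<in>q ` dom c. \<psi> y \<in> carrier G) \<and>
    (\<forall>p. path p \<longrightarrow> path_image p \<subseteq> q ` dom c \<longrightarrow> u p = inv (\<psi> (pathstart p)) \<otimes> \<psi> (pathfinish p)))"
  have "\<forall>c\<in>charts. \<exists>\<psi>. P c \<psi>" using chart_potential unfolding P_def by blast
  from bchoice[OF this] obtain \<psi> where \<psi>: "\<forall>c\<in>charts. P c (\<psi> c)" by blast
  then have cl: "\<psi> c (q z) \<in> carrier G" if "c \<in> charts" "z \<in> dom c" for c z using that unfolding P_def by blast
  have u: "u p = inv (\<psi> c (pathstart p)) \<otimes> \<psi> c (pathfinish p)"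
    if "c \<in> charts" "path p" "path_image p \<subseteq> q ` dom c" for c p using \<psi> that unfolding P_def by blast
  define \<kappa> where "\<kappa> c a = \<psi> c (q (rim g a)) \<otimes> inv (eta (rim g a))" for c a
  have etac: "eta z \<in> carrier G" if "c \<in> charts" "z \<in> dom c" for c z using eta_closed dom_subset that by blast
  have mid: "rim g a \<in> sector a" for a using sectorI[of 1 a a] by simp
  have move: "\<psi> c (q w) \<otimes> inv (eta w) = \<psi> c (q z) \<otimes> inv (eta z)"
    if c: "c \<in> charts" and r: "path r" "path_image r \<subseteq> dom c" "pathstart r = z" "pathfinish r = w" for c r z w
  proof -
    have zw: "z \<in> dom c" "w \<in> dom c" using r by auto
    have "path_image (q \<circ> r) \<subseteq> q ` dom c" using r(2) by (auto simp: path_image_compose)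
    moreover have rD: "path_image r \<subseteq> cball 0 1" using r(2) dom_subset by blast
    ultimately have "inv (\<psi> c (q z)) \<otimes> \<psi> c (q w) = inv (eta z) \<otimes> eta w"
      using u[OF c disc_path(1)[OF r(1) rD]] eta_path[OF r(1) rD]
      by (simp add: pathstart_compose pathfinish_compose r(3,4))
    then have "\<psi> c (q w) = \<psi> c (q z) \<otimes> (inv (eta z) \<otimes> eta w)"
      using cl[OF c zw(1)] cl[OF c zw(2)] by (metis inv_cancel_left(2))
    then show ?thesis using cl[OF c zw(1)] etac[OF c zw(1)] etac[OF c zw(2)] by (simp add: m_assoc)
  qed
  have \<kappa>cl: "\<kappa> c a \<in> carrier G" if "c \<in> charts" "a \<in> centres c" for c a
    unfolding \<kappa>_def using cl[OF that(1)] etac[OF that(1)] mid sector_subset_dom[OF that(2)] by blast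
  have \<kappa>: "\<psi> c (q z) = \<kappa> c a \<otimes> eta z" if c: "c \<in> charts" and a: "a \<in> centres c" "z \<in> sector a" for c a z
  proof -
    obtain r where r: "path r" "path_image r \<subseteq> sector a" "pathstart r = z" "pathfinish r = rim g a"
      using sector_path_connected[OF a(2) mid] by blast
    then have "\<kappa> c a = \<psi> c (q z) \<otimes> inv (eta z)"
      unfolding \<kappa>_def using move[OF c r(1) _ r(3,4)] sector_subset_dom[OF a(1)] by blast
    moreover have "z \<in> dom c" using a sector_subset_dom by blast
    ultimately show ?thesis using cl[OF c] etac[OF c] by (simp add: m_assoc)
  qed
  \<comment> \<open>The left side depends on the chart and its sectors but not on the point, the
    right side on the point but not on the chart. Comparing charts at a common point identifies
    their data.\<close>
  have edge: "inv (\<kappa> c a) \<otimes> \<kappa> c (2 * real k + 3 - a) = eta (rim g (real k + t)) \<otimes> inv (eta (rim g (real k + 3 - t)))"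
    if c: "c \<in> charts" and a: "a \<in> centres c" "2 * real k + 3 - a \<in> centres c" "\<bar>real k + t - a\<bar> < 1 / 2"
      and k: "first_side k" "0 < t" "t < 1" for c a k t
  proof -
    note s = edge_sectors[OF a(3)]
    have "\<kappa> c a \<otimes> eta (rim g (real k + t)) = \<kappa> c (2 * real k + 3 - a) \<otimes> eta (rim g (real k + 3 - t))"
      using \<kappa>[OF c a(1) s(1)] \<kappa>[OF c a(2) s(2)] q_edge[OF k(1), of t] k by simp
    moreover have "eta (rim g (real k + t)) \<in> carrier G" "eta (rim g (real k + 3 - t)) \<in> carrier G"
      using eta_closed rim_in_disc by blast+
    ultimately show ?thesis using \<kappa>cl[OF c a(1)] \<kappa>cl[OF c a(2)] inv_mult_eq_mult_inv by blast
  qed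
  have corner: "Corner \<in> charts" by (simp add: charts_def)
  define X where "X k = inv (\<kappa> (Edge k) (real k + 1 / 2)) \<otimes> \<kappa> (Edge k) (real k + 5 / 2)" for k
  define \<delta> where "\<delta> m = inv (\<kappa> Corner 0) \<otimes> \<kappa> Corner (real m)" for m :: nat
  have chart_edge: "Edge k \<in> charts" if "first_side k" for k using that by (auto simp: charts_def)
  have Xcl: "X k \<in> carrier G" if "first_side k" for k
    unfolding X_def using \<kappa>cl[OF chart_edge[OF that]] by simp
  have \<kappa>C: "\<kappa> Corner (real m) \<in> carrier G" for m using \<kappa>cl[OF corner] by simp
  have \<kappa>0: "\<kappa> Corner 0 \<in> carrier G" using \<kappa>C[of 0] by simp
  have \<delta>cl: "\<delta> m \<in> carrier G" for m unfolding \<delta>_def using \<kappa>C \<kappa>0 by simp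
  have X: "X k = eta (rim g (real k + t)) \<otimes> inv (eta (rim g (real k + 3 - t)))"
    if k: "first_side k" "0 < t" "t < 1" for k t
  proof -
    have "\<bar>real k + t - (real k + 1 / 2)\<bar> < 1 / 2" using k(2,3) by linarith
    moreover have e: "2 * real k + 3 - (real k + 1 / 2) = real k + 5 / 2" by simp
    ultimately show ?thesis
      using edge[OF chart_edge[OF k(1)], of "real k + 1 / 2" k t] k unfolding X_def e by simp
  qed
  have cross: "inv (\<kappa> Corner (real k)) \<otimes> \<kappa> Corner (real (k + 3)) = X k"
    "inv (\<kappa> Corner (real (k + 1))) \<otimes> \<kappa> Corner (real (k + 2)) = X k" if k: "first_side k" for k
  proof -
    have e: "2 * real k + 3 - real k = real (k + 3)" "2 * real k + 3 - real (k + 1) = real (k + 2)" by simp_all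
    \<comment> \<open>Sample points in the two halves of the side, near the corner pairs
      \<open>k\<close>, \<open>k + 3\<close> and \<open>k + 1\<close>, \<open>k + 2\<close>. The
      edge chart contains the whole open edge and gives the same \<open>X k\<close> at both.\<close>
    have b: "\<bar>real k + 1 / 4 - real k\<bar> < 1 / 2" "\<bar>real k + 3 / 4 - real (k + 1)\<bar> < 1 / 2" by simp_all
    show "inv (\<kappa> Corner (real k)) \<otimes> \<kappa> Corner (real (k + 3)) = X k"
      using edge[OF corner _ _ b(1) k] X[OF k, of "1/4"] unfolding e by simp
    show "inv (\<kappa> Corner (real (k + 1))) \<otimes> \<kappa> Corner (real (k + 2)) = X k"
      using edge[OF corner _ _ b(2) k] X[OF k, of "3/4"] unfolding e by simp
  qed
  have step: "inv (\<kappa> Corner 0) \<otimes> y = inv (\<kappa> Corner 0) \<otimes> x \<otimes> (inv x \<otimes> y)"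
    if "x \<in> carrier G" "y \<in> carrier G" for x y
    using that \<kappa>0 by (simp add: m_assoc)
  have cyc: "\<delta> (4 * g) = \<delta> 0"
  proof -
    have "turn_equiv g (4 * real g) 0" unfolding turn_equiv_def by (intro exI[of _ 1]) simp
    then have "rim g (real (4 * g)) = rim g (real 0)" using rim_eq_iff by simp
    then show ?thesis unfolding \<delta>_def \<kappa>_def by simp
  qed
  have data: "crossing_data G X \<delta>"
    unfolding crossing_data_def
  proof (intro conjI allI impI)
    fix k assume k: "first_side k"
    show "\<delta> (k + 3) = \<delta> k \<otimes> X k"
      unfolding cross(1)[OF k, symmetric] \<delta>_def using step \<kappa>C by blast
    show "\<delta> (k + 2) = \<delta> (k + 1) \<otimes> X k"
      unfolding cross(2)[OF k, symmetric] \<delta>_def using step \<kappa>C by blast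
  qed (use Xcl \<delta>cl cyc in auto)
  have gauge: "\<exists>e\<in>carrier G. \<forall>z\<in>dom c. \<psi> c (q z) = e \<otimes> (gauge \<one> X \<delta> c z \<otimes> eta z)" if c: "c \<in> charts" for c
  proof (cases c)
    case Disc
    have "0 \<in> dom c" using Disc by (simp add: dom_def)
    have "\<psi> c (q z) = \<psi> c (q 0) \<otimes> inv (eta 0) \<otimes> (gauge \<one> X \<delta> c z \<otimes> eta z)" if z: "z \<in> dom c" for z
    proof -
      have "path_image (linepath 0 z) \<subseteq> dom c"
        using z Disc by (simp add: dom_def closed_segment_subset del: mem_ball)
      then have "\<psi> c (q z) \<otimes> inv (eta z) = \<psi> c (q 0) \<otimes> inv (eta 0)" by (intro move[OF c, of "linepath 0 z"]) auto
      then have "\<psi> c (q 0) \<otimes> inv (eta 0) \<otimes> eta z = \<psi> c (q z)"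
        using cl[OF c z] etac[OF c z] by (simp flip: \<open>_ = \<psi> c (q 0) \<otimes> inv (eta 0)\<close> add: m_assoc)
      then show ?thesis using etac[OF c z] Disc by (simp add: gauge_def)
    qed
    then show ?thesis using cl[OF c \<open>0 \<in> dom c\<close>] etac[OF c \<open>0 \<in> dom c\<close>]
      by (intro bexI[of _ "\<psi> c (q 0) \<otimes> inv (eta 0)"]) auto
  next
    case (Edge k)
    then have k: "first_side k" using c by (auto simp: charts_def)
    have cl': "\<kappa> c (real k + 1 / 2) \<in> carrier G" "\<kappa> c (real k + 5 / 2) \<in> carrier G"
      using \<kappa>cl[OF c] Edge by auto
    have "\<psi> c (q z) = \<kappa> c (real k + 1 / 2) \<otimes> (gauge \<one> X \<delta> c z \<otimes> eta z)" if z: "z \<in> dom c" for z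
    proof -
      obtain a where "a \<in> centres c" "z \<in> sector a" using dom_sector[of c z] z Edge by auto
      then consider "z \<in> sector (real k + 1 / 2)" | "z \<in> sector (real k + 5 / 2)"
        using sector_cong Edge by auto
      then show ?thesis
      proof cases
        case 1
        then show ?thesis using \<kappa>[OF c _ 1] etac[OF c z] Edge by (simp add: gauge_edge(1))
      next
        case 2
        then show ?thesis using \<kappa>[OF c _ 2] etac[OF c z] cl' Edge
          by (simp add: gauge_edge(2) X_def m_assoc)
      qed
    qed
    then show ?thesis using cl' by blast
  next
    case Corner
    have "\<psi> c (q z) = \<kappa> c 0 \<otimes> (gauge \<one> X \<delta> c z \<otimes> eta z)" if z: "z \<in> dom c" for z
    proof -
      obtain a where "a \<in> centres Corner" "z \<in> sector a" using dom_sector[of c z] z Corner by auto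
      then obtain m where m: "m < 4 * g" "z \<in> sector (real m)" using corner_sector by metis
      have "gauge \<one> X \<delta> c z = inv (\<kappa> Corner 0) \<otimes> \<kappa> Corner (real m)"
        unfolding Corner \<delta>_def[symmetric] using m(1) by (intro gauge_corner m(2) cyc) simp
      then show ?thesis using \<kappa>[OF c _ m(2)] etac[OF c z] \<kappa>C[of m] \<kappa>0 Corner by (simp add: m_assoc)
    qed
    then show ?thesis using \<kappa>0 Corner by blast
  qed
  show thesis
  proof (rule that[OF data])
    show "\<delta> 0 = \<one>" unfolding \<delta>_def using \<kappa>0 by simp
    fix c p assume c: "c \<in> charts" and p: "path p" "path_image p \<subseteq> q ` dom c"
    obtain e where e: "e \<in> carrier G" "\<forall>z\<in>dom c. \<psi> c (q z) = e \<otimes> (gauge \<one> X \<delta> c z \<otimes> eta z)" using gauge[OF c] by blast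
    have ends: "pathstart p \<in> q ` dom c" "pathfinish p \<in> q ` dom c" using p(2) by auto
    define a b where "a = gauge \<one> X \<delta> c (sec (pathstart p)) \<otimes> eta (sec (pathstart p))"
      and "b = gauge \<one> X \<delta> c (sec (pathfinish p)) \<otimes> eta (sec (pathfinish p))"
    have S: "pathstart p \<in> S" "pathfinish p \<in> S" using ends dom_subset q_image by blast+
    have "\<psi> c (pathstart p) = e \<otimes> a" "\<psi> c (pathfinish p) = e \<otimes> b"
      using e(2) sec_dom[OF c ends(1)] sec_dom[OF c ends(2)] sec[OF S(1)] sec[OF S(2)] unfolding a_def b_def by metis+
    moreover have "a \<in> carrier G" "b \<in> carrier G"
      unfolding a_def b_def using gauge_closed[OF is_group data c] etac[OF c] sec_dom[OF c] ends by auto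
    ultimately show "u p = inv a \<otimes> b"
      using u[OF c p] e(1) by (simp add: inv_mult_group m_assoc)
  qed
qed

end

section \<open>Twisted products and splittings\<close>

definition twisted_group :: "('e, 'm) monoid_scheme \<Rightarrow> 'e \<Rightarrow> ('e \<times> int \<times> int) monoid"
  where "twisted_group \<Gamma> z =
    \<lparr>carrier = carrier \<Gamma> \<times> UNIV,
     mult = (\<lambda>(a, i, j) (b, i', j'). (a \<otimes>\<^bsub>\<Gamma>\<^esub> b \<otimes>\<^bsub>\<Gamma>\<^esub> z [^]\<^bsub>\<Gamma>\<^esub> (i * j'), i + i', j + j')),
     one = (\<one>\<^bsub>\<Gamma>\<^esub>, 0, 0)\<rparr>"

locale central_element = group \<Gamma> for \<Gamma> :: "('e, 'm) monoid_scheme" (structure) +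
  fixes z assumes z: "z \<in> carrier \<Gamma>"
    and central: "a \<in> carrier \<Gamma> \<Longrightarrow> z \<otimes> a = a \<otimes> z"
begin

lemma central_int_pow: "a \<in> carrier \<Gamma> \<Longrightarrow> z [^] (n::int) \<otimes> a = a \<otimes> z [^] n"
proof -
  assume a: "a \<in> carrier \<Gamma>"
  have nat: "z [^] (m::nat) \<otimes> a = a \<otimes> z [^] m" for m
  proof (induction m)
    case (Suc m)
    have "z [^] Suc m \<otimes> a = z [^] m \<otimes> (z \<otimes> a)" using a z by (simp add: m_assoc)
    also have "\<dots> = (z [^] m \<otimes> a) \<otimes> z" using a z central[OF a] by (simp add: m_assoc)
    finally show ?case using Suc a z by (simp add: m_assoc)
  qed (use a in simp)
  show ?thesis
  proof (cases n rule: int_cases2)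
    case (nonneg m) then show ?thesis using nat[of m] by (simp only: int_pow_int)
  next
    case (nonpos m)
    have "inv (z [^] m) \<otimes> a = a \<otimes> inv (z [^] m)"
      using nat[of m] a z
      by (metis inv_closed inv_solve_left inv_solve_right m_assoc m_closed nat_pow_closed)
    then show ?thesis using z by (simp only: nonpos int_pow_neg_int)
  qed
qed

abbreviation "K \<equiv> twisted_group \<Gamma> z"

lemma twisted_carrier: "carrier K = carrier \<Gamma> \<times> UNIV"
  and twisted_mult: "(a, i, j) \<otimes>\<^bsub>K\<^esub> (b, i', j') = (a \<otimes> b \<otimes> z [^] (i * j'), i + i', j + j')"
  and twisted_one: "\<one>\<^bsub>K\<^esub> = (\<one>, 0, 0)"
  by (simp_all add: twisted_group_def)

lemma group_twisted: "group K"
proof (rule groupI)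
  fix a b c assume "a \<in> carrier K" "b \<in> carrier K" "c \<in> carrier K"
  then obtain x i j y i' j' w i'' j'' where e: "a = (x, i, j)" "b = (y, i', j')" "c = (w, i'', j'')"
    and c: "x \<in> carrier \<Gamma>" "y \<in> carrier \<Gamma>" "w \<in> carrier \<Gamma>"
    by (auto simp: twisted_carrier)
  have "x \<otimes> y \<otimes> z [^] (i * j') \<otimes> w \<otimes> z [^] ((i + i') * j'') =
    x \<otimes> y \<otimes> (z [^] (i * j') \<otimes> w) \<otimes> z [^] ((i + i') * j'')"
    using c z by (simp add: m_assoc)
  also have "\<dots> = x \<otimes> y \<otimes> w \<otimes> (z [^] (i * j') \<otimes> z [^] ((i + i') * j''))"
    using c z central_int_pow[OF c(3)] by (simp add: m_assoc)
  \<comment> \<open>The cocycle condition, from bilinearity: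
    \<open>i * j' + (i + i') * j'' = i' * j'' + i * (j' + j'')\<close>.\<close>
  also have "z [^] (i * j') \<otimes> z [^] ((i + i') * j'') = z [^] (i' * j'') \<otimes> z [^] (i * (j' + j''))"
    using z by (simp add: int_pow_mult[symmetric] algebra_simps)
  finally show "a \<otimes>\<^bsub>K\<^esub> b \<otimes>\<^bsub>K\<^esub> c = a \<otimes>\<^bsub>K\<^esub> (b \<otimes>\<^bsub>K\<^esub> c)"
    unfolding e twisted_mult using c z by (simp add: m_assoc)
next
  fix a assume "a \<in> carrier K"
  then obtain x i j where e: "a = (x, i, j)" "x \<in> carrier \<Gamma>" by (auto simp: twisted_carrier)
  have "inv x \<otimes> z [^] (i * j) \<otimes> x = z [^] (i * j)"
    using e z central_int_pow[of x "i * j"] by (simp add: m_assoc)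
  then have "inv x \<otimes> z [^] (i * j) \<otimes> x \<otimes> z [^] (- i * j) = \<one>"
    using z by (simp add: int_pow_neg)
  then show "\<exists>b\<in>carrier K. b \<otimes>\<^bsub>K\<^esub> a = \<one>\<^bsub>K\<^esub>"
    using e z by (intro bexI[of _ "(inv x \<otimes> z [^] (i * j), - i, - j)"])
      (auto simp: twisted_mult twisted_carrier twisted_one)
qed (auto simp: twisted_carrier twisted_mult twisted_one z)

sublocale twisted: group K by (rule group_twisted)

lemma twisted_inv: "x \<in> carrier \<Gamma> \<Longrightarrow> inv\<^bsub>K\<^esub> (x, i, j) = (inv x \<otimes> z [^] (i * j), - i, - j)"
proof (rule twisted.inv_equality)
  assume x: "x \<in> carrier \<Gamma>"
  have "inv x \<otimes> z [^] (i * j) \<otimes> x = z [^] (i * j)"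
    using x z central_int_pow[of x "i * j"] by (simp add: m_assoc)
  then have "inv x \<otimes> z [^] (i * j) \<otimes> x \<otimes> z [^] (- i * j) = \<one>"
    using z by (simp add: int_pow_neg)
  then show "(inv x \<otimes> z [^] (i * j), - i, - j) \<otimes>\<^bsub>K\<^esub> (x, i, j) = \<one>\<^bsub>K\<^esub>"
    by (auto simp: twisted_mult twisted_carrier twisted_one)
qed (auto simp: twisted_carrier z)

end

section \<open>Cyclic quotients and splittings\<close>

lemma group_exponent:
  assumes "group A" "finite (carrier A)"
  shows "0 < group_exponent A" "a \<in> carrier A \<Longrightarrow> a [^]\<^bsub>A\<^esub> group_exponent A = \<one>\<^bsub>A\<^esub>"
proof -
  interpret A: group A by fact
  \<comment> \<open>The order of the group is one exponent, so the least one is attained.\<close>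
  have "0 < order A \<and> (\<forall>a\<in>carrier A. a [^]\<^bsub>A\<^esub> order A = \<one>\<^bsub>A\<^esub>)"
    using assms(2) A.pow_order_eq_1 A.order_gt_0_iff_finite by auto
  then have "0 < group_exponent A \<and> (\<forall>a\<in>carrier A. a [^]\<^bsub>A\<^esub> group_exponent A = \<one>\<^bsub>A\<^esub>)"
    unfolding group_exponent_def by (rule LeastI)
  then show "0 < group_exponent A" "a \<in> carrier A \<Longrightarrow> a [^]\<^bsub>A\<^esub> group_exponent A = \<one>\<^bsub>A\<^esub>"
    by auto
qed

text \<open>The image of \<open>\<xi>\<close> is a subgroup of the integers, generated by some
  \<open>\<xi> g\<^sub>0\<close>. So modulo \<open>H\<close> every element is a power of
  \<open>g\<^sub>0\<close> whose exponent matters only modulo \<open>e\<close>. The image may be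
  small, even zero, hence a bound on the index and not an equality.\<close>

lemma cyclic_cover:
  fixes G (structure) and \<xi> :: "'g \<Rightarrow> int" and e :: nat
  assumes "group G" and hom: "\<And>h k. h \<in> carrier G \<Longrightarrow> k \<in> carrier G \<Longrightarrow> \<xi> (h \<otimes> k) = \<xi> h + \<xi> k"
    and "0 < e"
  defines "H \<equiv> {h \<in> carrier G. int e dvd \<xi> h}"
  shows "H \<lhd> G" "finite (rcosets H)" "card (rcosets H) \<le> e" "cyclic_group (G Mod H)"
proof -
  interpret group G by fact
  have one: "\<xi> \<one> = 0" using hom[of \<one> \<one>] by simp
  have inv: "\<xi> (inv h) = - \<xi> h" if "h \<in> carrier G" for h
    using hom[of h "inv h"] that one by simp
  have sub: "subgroup H G"
    by (rule subgroupI) (auto simp: H_def hom inv one intro!: exI[of _ \<one>])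
  have pow: "\<xi> (h [^] (n::int)) = n * \<xi> h" if "h \<in> carrier G" for h n
  proof -
    have nat: "\<xi> (h [^] (m::nat)) = m * \<xi> h" for m
      by (induction m) (use that one hom in \<open>auto simp: algebra_simps\<close>)
    show ?thesis
      by (cases n rule: int_cases2) (use that nat inv in \<open>simp_all add: int_pow_int int_pow_neg_int\<close>)
  qed
  show normal: "H \<lhd> G"
    unfolding normal_inv_iff using sub by (auto simp: H_def hom inv)
  then interpret normal H G .
  obtain g\<^sub>0 where g\<^sub>0: "g\<^sub>0 \<in> carrier G" "\<And>h. h \<in> carrier G \<Longrightarrow> \<xi> g\<^sub>0 dvd \<xi> h"
  proof (cases "\<exists>h\<in>carrier G. 0 < \<xi> h")
    case False
    have "\<xi> h = 0" if "h \<in> carrier G" for h using False that inv[OF that] inv_closed[OF that]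
      by (metis linorder_neqE_linordered_idom neg_0_less_iff_less)
    then show ?thesis using that[of \<one>] by simp
  next
    case True
    define P where "P n \<longleftrightarrow> (\<exists>h\<in>carrier G. \<xi> h = int n \<and> 0 < n)" for n
    have "\<exists>n. P n" using True unfolding P_def by (metis pos_int_cases)
    then have "P (LEAST n. P n)" by (rule LeastI_ex)
    then obtain g\<^sub>0 where g: "g\<^sub>0 \<in> carrier G" "\<xi> g\<^sub>0 = int (LEAST n. P n)" "0 < (LEAST n. P n)"
      unfolding P_def by blast
    have pos: "0 < \<xi> g\<^sub>0" using g(2,3) by linarith
    have "\<xi> g\<^sub>0 dvd \<xi> h" if h: "h \<in> carrier G" for h
    proof (rule ccontr)
      assume "\<not> \<xi> g\<^sub>0 dvd \<xi> h"
      let ?r = "\<xi> h mod \<xi> g\<^sub>0"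
      have r: "0 < ?r" "?r < \<xi> g\<^sub>0"
        using \<open>\<not> \<xi> g\<^sub>0 dvd \<xi> h\<close> pos_mod_bound[OF pos, of "\<xi> h"] pos_mod_sign[OF pos, of "\<xi> h"]
        unfolding dvd_eq_mod_eq_0 by linarith+
      \<comment> \<open>The remainder is again a value of \<open>\<xi>\<close>, below the least
        positive one.\<close>
      have "\<xi> (h \<otimes> g\<^sub>0 [^] (- (\<xi> h div \<xi> g\<^sub>0))) = ?r"
        using hom[OF h int_pow_closed[OF g(1)]] pow[OF g(1)] by (simp add: minus_div_mult_eq_mod)
      then have "P (nat ?r)" unfolding P_def using r g h
        by (intro bexI[of _ "h \<otimes> g\<^sub>0 [^] (- (\<xi> h div \<xi> g\<^sub>0))"]) auto
      then have "(LEAST n. P n) \<le> nat ?r" by (rule Least_le)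
      then show False using r g by linarith
    qed
    then show ?thesis using that g by blast
  qed
  have coset: "\<exists>n::int. \<forall>m::int. int e dvd n - m \<longrightarrow> H #> h = H #> g\<^sub>0 [^] m" if "h \<in> carrier G" for h
  proof -
    obtain n where n: "\<xi> h = \<xi> g\<^sub>0 * n" using g\<^sub>0(2)[OF \<open>h \<in> carrier G\<close>] by (elim dvdE)
    have "H #> h = H #> g\<^sub>0 [^] m" if "int e dvd n - m" for m
    proof -
      have "\<xi> (h \<otimes> inv (g\<^sub>0 [^] m)) = \<xi> g\<^sub>0 * (n - m)"
        using n g\<^sub>0(1) \<open>h \<in> carrier G\<close> by (simp add: hom inv pow algebra_simps)
      then have "h \<otimes> inv (g\<^sub>0 [^] m) \<in> H" unfolding H_def using that g\<^sub>0(1) \<open>h \<in> carrier G\<close> by auto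
      then have "h \<in> H #> g\<^sub>0 [^] m"
        using g\<^sub>0(1) \<open>h \<in> carrier G\<close> sub by (simp add: subgroup.rcos_module is_group)
      then show ?thesis using repr_independence[OF _ _ sub] g\<^sub>0(1) by (metis int_pow_closed)
    qed
    then show ?thesis by blast
  qed
  have "rcosets H \<subseteq> (\<lambda>m::nat. H #> g\<^sub>0 [^] int m) ` {..<e}"
  proof
    fix C assume "C \<in> rcosets H"
    then obtain h where h: "h \<in> carrier G" "C = H #> h" unfolding RCOSETS_def by auto
    then obtain n where n: "\<And>m::int. int e dvd n - m \<Longrightarrow> H #> h = H #> g\<^sub>0 [^] m" using coset by blast
    have "H #> h = H #> g\<^sub>0 [^] int (nat (n mod e))" using assms(3) by (intro n) simp
    moreover have "nat (n mod e) < e" using assms(3) by (simp add: nat_less_iff)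
    ultimately show "C \<in> (\<lambda>m::nat. H #> g\<^sub>0 [^] int m) ` {..<e}" unfolding h(2) by blast
  qed
  then show "finite (rcosets H)" "card (rcosets H) \<le> e"
    by (auto intro: finite_subset dest: surj_card_le[rotated])
  interpret Q: group "G Mod H" by (rule factorgroup_is_group)
  have hom': "(\<lambda>h. H #> h) \<in> hom G (G Mod H)" by (rule r_coset_hom_Mod)
  have powc: "H #> g\<^sub>0 [^] n = (H #> g\<^sub>0) [^]\<^bsub>G Mod H\<^esub> n" for n :: int
    using hom' g\<^sub>0(1) group_hom.hom_int_pow[of G "G Mod H" "\<lambda>h. H #> h"] Q.is_group is_group
    unfolding group_hom_def group_hom_axioms_def by metis
  have c0: "H #> g\<^sub>0 \<in> carrier (G Mod H)" using hom' g\<^sub>0(1) by (auto simp: hom_def)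
  have "carrier (G Mod H) = range (\<lambda>n::int. (H #> g\<^sub>0) [^]\<^bsub>G Mod H\<^esub> n)"
  proof (intro equalityI subsetI)
    fix C assume "C \<in> carrier (G Mod H)"
    then obtain h where h: "h \<in> carrier G" "C = H #> h" by (auto simp: FactGroup_def RCOSETS_def)
    then obtain n where "\<And>m::int. int e dvd n - m \<Longrightarrow> H #> h = H #> g\<^sub>0 [^] m" using coset by blast
    from this[of n] show "C \<in> range (\<lambda>n::int. (H #> g\<^sub>0) [^]\<^bsub>G Mod H\<^esub> n)" using h powc by auto
  qed (use c0 in auto)
  then show "cyclic_group (G Mod H)" using Q.cyclic_group c0 by blast
qed

text \<open>A multiplicative section on \<open>H\<close> gives the isomorphism
  \<open>(a, h) \<mapsto> \<iota> a \<otimes> s h\<close>, where centrality makes it a homomorphism.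
  The definition asks for the opposite direction, so its inverse is the witness.\<close>

lemma trivial_extensionI:
  fixes \<Gamma> (structure)
  assumes ext: "central_extension A \<iota> \<Gamma> \<phi> G" and H: "subgroup H G"
    and s: "\<And>h. h \<in> H \<Longrightarrow> s h \<in> carrier \<Gamma>" "\<And>h. h \<in> H \<Longrightarrow> \<phi> (s h) = h"
      "\<And>h k. h \<in> H \<Longrightarrow> k \<in> H \<Longrightarrow> s (h \<otimes>\<^bsub>G\<^esub> k) = s h \<otimes> s k"
  shows "trivial_extension A \<iota> (preimage_group \<Gamma> \<phi> H) \<phi> (G\<lparr>carrier := H\<rparr>)"
proof -
  interpret A: group A using ext by (simp add: central_extension_def)
  interpret \<Gamma>: group \<Gamma> using ext by (simp add: central_extension_def)
  interpret G: group G using ext by (simp add: central_extension_def)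
  interpret H: subgroup H G by fact
  have \<iota>: "\<iota> \<in> hom A \<Gamma>" "inj_on \<iota> (carrier A)" and \<phi>: "\<phi> \<in> hom \<Gamma> G"
    and ker: "\<iota> ` carrier A = kernel \<Gamma> G \<phi>"
    and cent: "\<And>a x. a \<in> carrier A \<Longrightarrow> x \<in> carrier \<Gamma> \<Longrightarrow> \<iota> a \<otimes> x = x \<otimes> \<iota> a"
    using ext by (auto simp: central_extension_def mon_def epi_def)
  interpret \<iota>: group_hom A \<Gamma> \<iota> using \<iota> by unfold_locales
  interpret \<phi>: group_hom \<Gamma> G \<phi> using \<phi> by unfold_locales
  have \<phi>\<iota>: "\<phi> (\<iota> a) = \<one>\<^bsub>G\<^esub>" if "a \<in> carrier A" for a
    using ker that by (auto simp: kernel_def)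
  have s1: "s \<one>\<^bsub>G\<^esub> = \<one>"
    using s(1)[of "\<one>\<^bsub>G\<^esub>"] s(3)[of "\<one>\<^bsub>G\<^esub>" "\<one>\<^bsub>G\<^esub>"] by simp
  define \<theta> where "\<theta> = (\<lambda>(a, h). \<iota> a \<otimes> s h)"
  let ?P = "preimage_group \<Gamma> \<phi> H" and ?T = "A \<times>\<times> (G\<lparr>carrier := H\<rparr>)"
  have cP: "carrier ?P = {x \<in> carrier \<Gamma>. \<phi> x \<in> H}" by (simp add: preimage_group_def)
  have cT: "carrier ?T = carrier A \<times> H" by (simp add: DirProd_def)
  have \<phi>\<theta>: "\<phi> (\<theta> (a, h)) = h" if "a \<in> carrier A" "h \<in> H" for a h
    using that s \<phi>\<iota> by (simp add: \<theta>_def)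
  have hom: "\<theta> \<in> hom ?T ?P"
  proof (rule homI)
    fix x assume "x \<in> carrier ?T"
    then show "\<theta> x \<in> carrier ?P"
      using \<phi>\<theta>[of "fst x" "snd x"] s by (auto simp: cP cT \<theta>_def)
  next
    fix x y assume "x \<in> carrier ?T" "y \<in> carrier ?T"
    then obtain a h b k where e: "x = (a, h)" "y = (b, k)"
      and c: "a \<in> carrier A" "h \<in> H" "b \<in> carrier A" "k \<in> H" by (auto simp: cT)
    have "\<theta> (x \<otimes>\<^bsub>?T\<^esub> y) = \<iota> a \<otimes> (\<iota> b \<otimes> s h) \<otimes> s k"
      using c s by (simp add: e \<theta>_def DirProd_def \<Gamma>.m_assoc)
    also have "\<dots> = \<theta> x \<otimes>\<^bsub>?P\<^esub> \<theta> y"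
      using c s cent[of b "s h"] by (simp add: e \<theta>_def preimage_group_def \<Gamma>.m_assoc)
    finally show "\<theta> (x \<otimes>\<^bsub>?T\<^esub> y) = \<theta> x \<otimes>\<^bsub>?P\<^esub> \<theta> y" .
  qed
  have inj: "inj_on \<theta> (carrier ?T)"
  proof (rule inj_onI)
    fix x y assume "x \<in> carrier ?T" "y \<in> carrier ?T" and eq: "\<theta> x = \<theta> y"
    then obtain a h b k where e: "x = (a, h)" "y = (b, k)"
      and c: "a \<in> carrier A" "h \<in> H" "b \<in> carrier A" "k \<in> H" by (auto simp: cT)
    have "h = k" using eq \<phi>\<theta> c unfolding e by metis
    moreover then have "\<iota> a = \<iota> b" using eq c s by (simp add: e \<theta>_def)
    ultimately show "x = y" using \<iota>(2) c by (auto simp: e inj_on_def)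
  qed
  have surj: "\<theta> ` carrier ?T = carrier ?P"
  proof (intro equalityI subsetI)
    fix x assume "x \<in> carrier ?P"
    then have x: "x \<in> carrier \<Gamma>" "\<phi> x \<in> H" by (auto simp: cP)
    have "x \<otimes> inv s (\<phi> x) \<in> kernel \<Gamma> G \<phi>"
      using x s by (simp add: kernel_def)
    then obtain a where a: "a \<in> carrier A" "\<iota> a = x \<otimes> inv s (\<phi> x)" using ker by (metis imageE)
    then have "\<theta> (a, \<phi> x) = x" using x s by (simp add: \<theta>_def \<Gamma>.m_assoc)
    then show "x \<in> \<theta> ` carrier ?T" using a x by (force simp: cT)
  qed (use hom in \<open>auto simp: hom_def\<close>)
  have gT: "group ?T" by (intro DirProd_group A.is_group H.subgroup_is_group G.is_group)
  have iso: "\<theta> \<in> iso ?T ?P" using hom inj surj by (simp add: iso_def bij_betw_def)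
  then have iso': "inv_into (carrier ?T) \<theta> \<in> iso ?P ?T" by (rule group.iso_set_sym[OF gT])
  have "inv_into (carrier ?T) \<theta> (\<iota> a) = (a, \<one>\<^bsub>G\<^esub>)" if "a \<in> carrier A" for a
    using that s1 by (intro inv_into_f_eq[OF inj]) (auto simp: cT \<theta>_def)
  moreover have "snd (inv_into (carrier ?T) \<theta> x) = \<phi> x" if "x \<in> carrier ?P" for x
  proof -
    have "inv_into (carrier ?T) \<theta> x \<in> carrier ?T" "\<theta> (inv_into (carrier ?T) \<theta> x) = x"
      using that surj by (metis inv_into_into f_inv_into_f)+
    then show ?thesis
      using \<phi>\<theta>[of "fst (inv_into (carrier ?T) \<theta> x)" "snd (inv_into (carrier ?T) \<theta> x)"] unfolding cT mem_Times_iff by simp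
  qed
  ultimately show ?thesis
    unfolding trivial_extension_def extensions_isomorphic_def using iso' by auto
qed

lemma central_extension_splits_on_cyclic_cover:
  fixes \<Gamma> (structure)
  assumes ext: "central_extension A \<iota> \<Gamma> \<phi> G" and A: "finite (carrier A)" and c: "c \<in> carrier A"
    and \<Phi>: "\<Phi> \<in> hom G (twisted_group \<Gamma> (\<iota> c))" "\<And>h. h \<in> carrier G \<Longrightarrow> \<phi> (fst (\<Phi> h)) = h"
  shows "\<exists>H. subgroup H G \<and> finite (rcosets\<^bsub>G\<^esub> H) \<and> card (rcosets\<^bsub>G\<^esub> H) \<le> group_exponent A \<and>
    trivial_extension A \<iota> (preimage_group \<Gamma> \<phi> H) \<phi> (G\<lparr>carrier := H\<rparr>) \<and>
    H \<lhd> G \<and> cyclic_group (G Mod H)"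
proof -
  interpret A: group A using ext by (simp add: central_extension_def)
  interpret \<Gamma>: group \<Gamma> using ext by (simp add: central_extension_def)
  interpret G: group G using ext by (simp add: central_extension_def)
  have \<iota>: "\<iota> \<in> hom A \<Gamma>"
    and cent: "\<And>a x. a \<in> carrier A \<Longrightarrow> x \<in> carrier \<Gamma> \<Longrightarrow> \<iota> a \<otimes> x = x \<otimes> \<iota> a"
    using ext by (auto simp: central_extension_def mon_def)
  interpret \<iota>: group_hom A \<Gamma> \<iota> using \<iota> by unfold_locales
  let ?e = "group_exponent A"
  interpret central_element \<Gamma> "\<iota> c" using c cent by unfold_locales auto
  define \<xi> where "\<xi> h = fst (snd (\<Phi> h))" for h
  define H where "H = {h \<in> carrier G. int ?e dvd \<xi> h}"
  have cl: "fst (\<Phi> h) \<in> carrier \<Gamma>" if "h \<in> carrier G" for h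
    using \<Phi>(1) that by (auto simp: hom_def twisted_carrier Pi_iff mem_Times_iff)
  have mult: "\<Phi> (h \<otimes>\<^bsub>G\<^esub> k) = (fst (\<Phi> h) \<otimes> fst (\<Phi> k) \<otimes> \<iota> c [^] (\<xi> h * snd (snd (\<Phi> k))),
      \<xi> h + \<xi> k, snd (snd (\<Phi> h)) + snd (snd (\<Phi> k)))" if "h \<in> carrier G" "k \<in> carrier G" for h k
  proof -
    have "\<Phi> (h \<otimes>\<^bsub>G\<^esub> k) = \<Phi> h \<otimes>\<^bsub>K\<^esub> \<Phi> k" using hom_mult[OF \<Phi>(1)] that by auto
    then show ?thesis unfolding \<xi>_def
      by (metis (no_types, lifting) prod.collapse twisted_mult)
  qed
  have e: "0 < ?e" using group_exponent(1)[OF A.is_group A] .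
  have \<iota>e: "\<iota> c [^] (int ?e * n) = \<one>" for n
  proof -
    have "\<iota> c [^] ?e = \<one>"
      using group_exponent(2)[OF A.is_group A c] c by (metis \<iota>.hom_nat_pow \<iota>.hom_one)
    then have "\<iota> c [^] int ?e = \<one>" by (simp add: int_pow_int)
    then show ?thesis using c by (simp add: \<Gamma>.int_pow_pow[symmetric])
  qed
  have \<xi>: "\<xi> (h \<otimes>\<^bsub>G\<^esub> k) = \<xi> h + \<xi> k" if "h \<in> carrier G" "k \<in> carrier G" for h k
    using mult[OF that] unfolding \<xi>_def by simp
  note cyc = cyclic_cover[OF G.is_group \<xi> e, folded H_def]
  have sub: "subgroup H G" using cyc(1) by (rule normal_imp_subgroup)
  have "trivial_extension A \<iota> (preimage_group \<Gamma> \<phi> H) \<phi> (G\<lparr>carrier := H\<rparr>)"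
  proof (rule trivial_extensionI[OF ext sub, where s = "\<lambda>h. fst (\<Phi> h)"])
    fix h k assume hk: "h \<in> H" "k \<in> H"
    \<comment> \<open>The left factor alone makes the exponent of the twist a multiple of the
      exponent of \<open>A\<close>.\<close>
    then obtain n where "\<xi> h = int ?e * n" unfolding H_def by auto
    then show "fst (\<Phi> (h \<otimes>\<^bsub>G\<^esub> k)) = fst (\<Phi> h) \<otimes> fst (\<Phi> k)"
      using mult[of h k] hk \<iota>e[of "n * snd (snd (\<Phi> k))"] cl unfolding H_def by (simp add: mult.assoc)
  qed (use cl \<Phi>(2) in \<open>auto simp: H_def\<close>)
  then show ?thesis using cyc sub by blast
qed

section \<open>The surface relator\<close>

text \<open>The product of the transitions on a walk around the vertex. A handle contributes the
  commutator of \<open>a\<close> and \<open>inv b\<close> instead of the boundary word, since the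
  generators here belong to loops crossing the edges, not to the edges themselves.\<close>

primrec relator :: "('k, 'm) monoid_scheme \<Rightarrow> (nat \<Rightarrow> 'k) \<Rightarrow> nat \<Rightarrow> 'k" where
  "relator M X 0 = \<one>\<^bsub>M\<^esub>"
| "relator M X (Suc j) = relator M X j \<otimes>\<^bsub>M\<^esub>
    (X (4 * j) \<otimes>\<^bsub>M\<^esub> inv\<^bsub>M\<^esub> X (4 * j + 1) \<otimes>\<^bsub>M\<^esub> inv\<^bsub>M\<^esub> X (4 * j) \<otimes>\<^bsub>M\<^esub> X (4 * j + 1))"

text \<open>The solution of the crossing equations with the unit at corner \<open>0\<close>. Within
  a block the word grows in the order of remainders \<open>0\<close>, \<open>3\<close>,
  \<open>2\<close>, \<open>1\<close>, the order of the corners around the vertex.\<close>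

definition corner_word :: "('k, 'm) monoid_scheme \<Rightarrow> (nat \<Rightarrow> 'k) \<Rightarrow> nat \<Rightarrow> 'k"
  where "corner_word M X m = (let j = m div 4; r = m mod 4; a = X (4 * j); b = X (4 * j + 1) in
    relator M X j \<otimes>\<^bsub>M\<^esub>
      (if r = 0 then \<one>\<^bsub>M\<^esub> else if r = 1 then a \<otimes>\<^bsub>M\<^esub> inv\<^bsub>M\<^esub> b \<otimes>\<^bsub>M\<^esub> inv\<^bsub>M\<^esub> a
       else if r = 2 then a \<otimes>\<^bsub>M\<^esub> inv\<^bsub>M\<^esub> b else a))"

lemma corner_word_simps:
  "corner_word M X (4 * j) = relator M X j \<otimes>\<^bsub>M\<^esub> \<one>\<^bsub>M\<^esub>"
  "corner_word M X (4 * j + 1) = relator M X j \<otimes>\<^bsub>M\<^esub>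
    (X (4 * j) \<otimes>\<^bsub>M\<^esub> inv\<^bsub>M\<^esub> X (4 * j + 1) \<otimes>\<^bsub>M\<^esub> inv\<^bsub>M\<^esub> X (4 * j))"
  "corner_word M X (4 * j + 2) = relator M X j \<otimes>\<^bsub>M\<^esub> (X (4 * j) \<otimes>\<^bsub>M\<^esub> inv\<^bsub>M\<^esub> X (4 * j + 1))"
  "corner_word M X (4 * j + 3) = relator M X j \<otimes>\<^bsub>M\<^esub> X (4 * j)"
proof -
  have "(4 * j + 1) div 4 = j" "(4 * j + 2) div 4 = j" "(4 * j + 3) div 4 = j"
    "(4 * j + 1) mod 4 = 1" "(4 * j + 2) mod 4 = 2" "(4 * j + 3) mod 4 = 3" by presburger+
  then show "corner_word M X (4 * j) = relator M X j \<otimes>\<^bsub>M\<^esub> \<one>\<^bsub>M\<^esub>"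
    "corner_word M X (4 * j + 1) = relator M X j \<otimes>\<^bsub>M\<^esub>
      (X (4 * j) \<otimes>\<^bsub>M\<^esub> inv\<^bsub>M\<^esub> X (4 * j + 1) \<otimes>\<^bsub>M\<^esub> inv\<^bsub>M\<^esub> X (4 * j))"
    "corner_word M X (4 * j + 2) = relator M X j \<otimes>\<^bsub>M\<^esub> (X (4 * j) \<otimes>\<^bsub>M\<^esub> inv\<^bsub>M\<^esub> X (4 * j + 1))"
    "corner_word M X (4 * j + 3) = relator M X j \<otimes>\<^bsub>M\<^esub> X (4 * j)"
    unfolding corner_word_def Let_def by simp_all
qed

context polygon
begin

lemma first_sides: "j < g \<Longrightarrow> first_side (4 * j)" "j < g \<Longrightarrow> first_side (4 * j + 1)"
  unfolding first_side_def by presburger+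

lemma first_side_cases:
  assumes "first_side k"
  obtains j where "j < g" "k = 4 * j" | j where "j < g" "k = 4 * j + 1"
proof -
  define j where "j = k div 4"
  have "k = 4 * j \<or> k = 4 * j + 1" "j < g" using assms unfolding first_side_def j_def by presburger+
  then show thesis using that by blast
qed

lemma relator_closed:
  fixes M (structure)
  assumes "group M" "X \<in> Collect first_side \<rightarrow> carrier M"
  shows "j \<le> g \<Longrightarrow> relator M X j \<in> carrier M"
proof (induction j)
  case (Suc j)
  interpret group M by fact
  show ?case using Suc assms(2) first_sides[of j] by (simp add: Pi_iff)
qed (use assms in \<open>simp add: group.is_monoid monoid.one_closed\<close>)

lemma corner_word_closed:
  fixes M (structure)
  assumes "group M" "X \<in> Collect first_side \<rightarrow> carrier M" "m \<le> 4 * g"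
  shows "corner_word M X m \<in> carrier M"
proof -
  interpret group M by fact
  define j where "j = m div 4"
  \<comment> \<open>For \<open>m = 4 * g\<close> the block \<open>j = g\<close> contains no sides;
    only the relator enters.\<close>
  have j: "j \<le> g" "m mod 4 \<noteq> 0 \<Longrightarrow> j < g" using assms(3) unfolding j_def by presburger+
  have "relator M X j \<in> carrier M" using relator_closed[OF assms(1,2) j(1)] .
  then show ?thesis
    using j(2) first_sides[of j] assms(2) unfolding corner_word_def Let_def j_def[symmetric]
    by (cases "m mod 4 = 0") (auto simp: Pi_iff)
qed

lemma corner_word_crossing:
  fixes M (structure)
  assumes M: "group M" "X \<in> Collect first_side \<rightarrow> carrier M" and k: "first_side k"
  shows "corner_word M X (k + 3) = corner_word M X k \<otimes> X k"
    "corner_word M X (k + 2) = corner_word M X (k + 1) \<otimes> X k"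
proof -
  interpret group M by fact
  have "corner_word M X (k + 3) = corner_word M X k \<otimes> X k \<and>
    corner_word M X (k + 2) = corner_word M X (k + 1) \<otimes> X k"
    using k
  proof (cases rule: first_side_cases)
    case (1 j)
    have cl: "relator M X j \<in> carrier M" "X (4 * j) \<in> carrier M" "X (4 * j + 1) \<in> carrier M"
      using relator_closed[OF M, of j] first_sides[of j] M(2) 1 by (auto simp: Pi_iff)
    show ?thesis unfolding 1(2) corner_word_simps using cl by (simp add: m_assoc)
  next
    case (2 j)
    have cl: "relator M X j \<in> carrier M" "X (4 * j) \<in> carrier M" "X (4 * j + 1) \<in> carrier M"
      using relator_closed[OF M, of j] first_sides[of j] M(2) 2 by (auto simp: Pi_iff)
    have e: "4 * j + 1 + 3 = 4 * Suc j" "4 * j + 1 + 2 = 4 * j + 3" "4 * j + 1 + 1 = 4 * j + 2" by simp_all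
    show ?thesis unfolding 2(2) e corner_word_simps relator.simps using cl by (simp add: m_assoc)
  qed
  then show "corner_word M X (k + 3) = corner_word M X k \<otimes> X k"
    "corner_word M X (k + 2) = corner_word M X (k + 1) \<otimes> X k" by auto
qed

text \<open>The hypothesis on the relator is the closing condition at corner
  \<open>4 * g\<close>.\<close>

lemma crossing_data_corner_word:
  fixes M (structure)
  assumes M: "group M" "X \<in> Collect first_side \<rightarrow> carrier M" and "relator M X g = \<one>"
  shows "crossing_data M X (corner_word M X)"
proof -
  interpret group M by fact
  have "corner_word M X (4 * g) = corner_word M X 0"
    using corner_word_simps(1)[of M X g] corner_word_simps(1)[of M X 0] assms(3) by simp
  then show ?thesis
    unfolding crossing_data_def using corner_word_crossing[OF M] corner_word_closed[OF M] M(2) by (auto simp: Pi_iff)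
qed

text \<open>From corner \<open>4 * j\<close> the equations determine \<open>4 * j + 3\<close>,
  \<open>4 * j + 2\<close>, \<open>4 * j + 1\<close> and \<open>4 * j + 4\<close> in turn. The
  middle two need cancellation on the right, because there the walk crosses the edge against the
  direction of \<open>X\<close>.\<close>

lemma crossing_data_eq_corner_word:
  fixes M (structure)
  assumes M: "group M" "crossing_data M X \<delta>" "\<delta> 0 = \<one>"
  shows "m \<le> 4 * g \<Longrightarrow> \<delta> m = corner_word M X m" "relator M X g = \<one>"
proof -
  interpret group M by fact
  have XP: "X \<in> Collect first_side \<rightarrow> carrier M" using M(2) unfolding crossing_data_def by blast
  then have X: "X k \<in> carrier M" if "first_side k" for k using that by blast
  have \<delta>cl: "\<delta> m \<in> carrier M" if "m \<le> 4 * g" for m using M(2) that unfolding crossing_data_def by blast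
  have \<delta>: "\<delta> (k + 3) = \<delta> k \<otimes> X k" "\<delta> (k + 2) = \<delta> (k + 1) \<otimes> X k" if "first_side k" for k
    using M(2) that unfolding crossing_data_def by blast+
  note C = corner_word_crossing[OF M(1) XP] and Ccl = corner_word_closed[OF M(1) XP]
  have block: "\<delta> (4 * j + 1) = corner_word M X (4 * j + 1) \<and> \<delta> (4 * j + 2) = corner_word M X (4 * j + 2) \<and>
    \<delta> (4 * j + 3) = corner_word M X (4 * j + 3) \<and> \<delta> (4 * Suc j) = corner_word M X (4 * Suc j)"
    if j: "j < g" "\<delta> (4 * j) = corner_word M X (4 * j)" for j
  proof -
    note f = first_sides[OF j(1)]
    have e: "4 * j + 1 + 3 = 4 * Suc j" "4 * j + 1 + 2 = 4 * j + 3" "4 * j + 1 + 1 = 4 * j + 2" by simp_all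
    have le: "4 * j + 1 \<le> 4 * g" "4 * j + 2 \<le> 4 * g" using j(1) by auto
    have 3: "\<delta> (4 * j + 3) = corner_word M X (4 * j + 3)" using \<delta>(1)[OF f(1)] C(1)[OF f(1)] j(2) by simp
    have "\<delta> (4 * j + 2) \<otimes> X (4 * j + 1) = corner_word M X (4 * j + 2) \<otimes> X (4 * j + 1)"
      using \<delta>(2)[OF f(2)] C(2)[OF f(2)] 3 unfolding e by simp
    then have 2: "\<delta> (4 * j + 2) = corner_word M X (4 * j + 2)"
      using \<delta>cl[OF le(2)] Ccl[OF le(2)] X[OF f(2)] by simp
    have "\<delta> (4 * j + 1) \<otimes> X (4 * j) = corner_word M X (4 * j + 1) \<otimes> X (4 * j)"
      using \<delta>(2)[OF f(1)] C(2)[OF f(1)] 2 by simp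
    then have 1: "\<delta> (4 * j + 1) = corner_word M X (4 * j + 1)"
      using \<delta>cl[OF le(1)] Ccl[OF le(1)] X[OF f(1)] by simp
    have "\<delta> (4 * Suc j) = corner_word M X (4 * Suc j)" using \<delta>(1)[OF f(2)] C(1)[OF f(2)] 1 unfolding e by simp
    with 1 2 3 show ?thesis by blast
  qed
  have zero: "j \<le> g \<Longrightarrow> \<delta> (4 * j) = corner_word M X (4 * j)" for j
  proof (induction j)
    case 0
    then show ?case using M(3) corner_word_simps(1)[of M X 0] by simp
  next
    case (Suc j)
    then show ?case using block[of j] by simp
  qed
  show eq: "\<delta> m = corner_word M X m" if "m \<le> 4 * g" for m
  proof -
    define j where "j = m div 4"
    have "m = 4 * j \<or> m = 4 * j + 1 \<or> m = 4 * j + 2 \<or> m = 4 * j + 3" unfolding j_def by presburger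
    moreover have "j \<le> g" using that unfolding j_def by auto
    moreover have "j < g" if "m = 4 * j + i" "0 < i" for i using that \<open>m \<le> 4 * g\<close> by auto
    ultimately show ?thesis using zero[of j] block[of j] by (elim disjE) simp_all
  qed
  have "\<delta> (4 * g) = \<one>" using M(2,3) unfolding crossing_data_def by simp
  then show "relator M X g = \<one>"
    using eq[of "4 * g"] corner_word_simps(1)[of M X g] relator_closed[OF M(1) XP, of g] by simp
qed

lemma relator_hom:
  assumes "group_hom M N \<pi>" "X \<in> Collect first_side \<rightarrow> carrier M" "\<forall>k. first_side k \<longrightarrow> \<pi> (X k) = Y k"
  shows "j \<le> g \<Longrightarrow> \<pi> (relator M X j) = relator N Y j"
proof -
  interpret group_hom M N \<pi> by fact
  show "j \<le> g \<Longrightarrow> \<pi> (relator M X j) = relator N Y j"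
  proof (induction j)
    case (Suc j)
    have "relator M X j \<in> carrier M" using relator_closed[OF G.is_group assms(2)] Suc by simp
    moreover have "X (4 * j) \<in> carrier M" "X (4 * j + 1) \<in> carrier M" "\<pi> (X (4 * j)) = Y (4 * j)" "\<pi> (X (4 * j + 1)) = Y (4 * j + 1)"
      using assms(2,3) first_sides[of j] Suc by (auto simp: Pi_iff)
    ultimately show ?case using Suc by simp
  qed simp
qed

lemma corner_word_hom:
  assumes "group_hom M N \<pi>" "X \<in> Collect first_side \<rightarrow> carrier M" "\<forall>k. first_side k \<longrightarrow> \<pi> (X k) = Y k" "m \<le> 4 * g"
  shows "\<pi> (corner_word M X m) = corner_word N Y m"
proof -
  interpret group_hom M N \<pi> by fact
  define j where "j = m div 4"
  have j: "j \<le> g" "m mod 4 \<noteq> 0 \<Longrightarrow> j < g" using assms(4) unfolding j_def by presburger+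
  have p: "relator M X j \<in> carrier M" using relator_closed[OF G.is_group assms(2) j(1)] .
  note h = relator_hom[OF assms(1-3) j(1)]
  have pN: "relator N Y j \<in> carrier N" using hom_closed[OF p] h by simp
  show ?thesis
  proof (cases "m mod 4 = 0")
    case True
    then show ?thesis using p h pN by (simp add: corner_word_def Let_def j_def[symmetric])
  next
    case False
    then have "X (4 * j) \<in> carrier M" "X (4 * j + 1) \<in> carrier M" "\<pi> (X (4 * j)) = Y (4 * j)" "\<pi> (X (4 * j + 1)) = Y (4 * j + 1)"
      using assms(2,3) first_sides[of j] j(2) by (auto simp: Pi_iff)
    then show ?thesis using p h False by (simp add: corner_word_def Let_def j_def[symmetric])
  qed
qed

text \<open>Twisting by the Heisenberg cocycle changes the surface relator by exactly \<open>inv z\<close>.\<close>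

lemma relator_twisted:
  fixes \<Gamma> (structure)
  assumes "central_element \<Gamma> z" "Y \<in> Collect first_side \<rightarrow> carrier \<Gamma>"
  defines "X \<equiv> \<lambda>k. (Y k, if k = 0 then 1 else 0, if k = 1 then 1 else 0)"
  assumes "Suc j \<le> g"
  shows "relator (twisted_group \<Gamma> z) X (Suc j) = (relator \<Gamma> Y (Suc j) \<otimes> inv z, 0, 0)"
  using assms(4)
proof (induction j)
  case 0
  interpret central_element \<Gamma> z by fact
  define a b where "a = Y 0" and "b = Y 1"
  have cl: "a \<in> carrier \<Gamma>" "b \<in> carrier \<Gamma>" using assms(2) first_sides[of 0] genus unfolding a_def b_def by (auto simp: Pi_iff)
  have "X (4 * 0) = (a, 1, 0)" "X (4 * 0 + 1) = (b, 0, 1)" unfolding X_def a_def b_def by simp_all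
  \<comment> \<open>Only the product of \<open>a\<close> with \<open>inv b\<close> meets a nonzero
    cocycle, \<open>z\<close> to the power \<open>1 * (-1)\<close>; in the other products one of the
    two coordinates involved is \<open>0\<close>.\<close>
  then have "relator K X (Suc 0) =
      (\<one> \<otimes> (a \<otimes> inv b \<otimes> z [^] (-1::int) \<otimes> inv a \<otimes> b), 0, 0)"
    using cl z by (simp add: twisted_mult twisted_inv twisted_one)
  also have "a \<otimes> inv b \<otimes> z [^] (-1::int) \<otimes> inv a \<otimes> b =
      a \<otimes> inv b \<otimes> (z [^] (-1::int) \<otimes> (inv a \<otimes> b))"
    using cl z by (simp add: m_assoc)
  also have "\<dots> = a \<otimes> inv b \<otimes> inv a \<otimes> b \<otimes> inv z"
    using cl z central_int_pow[of "inv a \<otimes> b" "-1"] int_pow_neg[of z 1] by (simp add: m_assoc)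
  finally show ?case using cl z by (simp add: a_def b_def)
next
  case (Suc j)
  interpret central_element \<Gamma> z by fact
  let ?j = "Suc j"
  define a b p where "a = Y (4 * ?j)" and "b = Y (4 * ?j + 1)" and "p = relator \<Gamma> Y ?j"
  have cl: "a \<in> carrier \<Gamma>" "b \<in> carrier \<Gamma>" using assms(2) first_sides[of ?j] Suc unfolding a_def b_def by (auto simp: Pi_iff)
  have p: "p \<in> carrier \<Gamma>" unfolding p_def using relator_closed[OF is_group assms(2), of ?j] Suc by simp
  have X: "X (4 * ?j) = (a, 0, 0)" "X (4 * ?j + 1) = (b, 0, 0)" unfolding X_def a_def b_def by simp_all
  have IH: "relator K X ?j = (p \<otimes> inv z, 0, 0)" unfolding p_def using Suc by simp
  have "relator K X (Suc ?j) =
      (p \<otimes> inv z \<otimes> (a \<otimes> inv b \<otimes> inv a \<otimes> b), 0, 0)"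
    unfolding relator.simps(2)[of K X ?j] X IH using cl z p by (simp add: twisted_mult twisted_inv twisted_one)
  also have "p \<otimes> inv z \<otimes> (a \<otimes> inv b \<otimes> inv a \<otimes> b) =
      p \<otimes> (a \<otimes> inv b \<otimes> inv a \<otimes> b) \<otimes> inv z"
    using cl z p central_int_pow[of "a \<otimes> inv b \<otimes> inv a \<otimes> b" "-1"] int_pow_neg[of z 1]
    by (simp add: m_assoc)
  finally show ?case by (simp add: a_def b_def p_def)
qed

end

section \<open>The homomorphism from the surface group to the twisted product\<close>

text \<open>The functor \<open>u\<close> supplies the data \<open>X\<close>, and their twisted lifts
  give a functor into the twisted product. The projection of the latter, and \<open>u\<close>
  corrected by the values \<open>e\<close>, are both the holonomy of one atlas in \<open>G\<close>,
  so they agree.\<close>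

lemma central_extension_hom_twisted:
  fixes G :: "'g monoid" (structure) and \<Gamma> :: "'e monoid" and S :: "'s::topological_space set"
  assumes surface: "closed_orientable_surface g S" "x \<in> S"
    and surface_group: "group G" "G \<cong> fundamental_group S x"
    and ext: "central_extension A \<iota> \<Gamma> \<phi> G"
  shows "\<exists>c\<in>carrier A. \<exists>\<Phi>\<in>hom G (twisted_group \<Gamma> (\<iota> c)). \<forall>h\<in>carrier G. \<phi> (fst (\<Phi> h)) = h"
proof -
  obtain q where q: "quotient_map (top_of_set (cball (0::complex) 1)) (top_of_set S) q"
    "\<forall>z\<in>cball 0 1. \<forall>w\<in>cball 0 1. q z = q w \<longleftrightarrow> equivclp (side_pairing g) z w"
    and "1 \<le> g"
    using surface(1) unfolding closed_orientable_surface_def by blast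
  then interpret polygon_quotient g S q by unfold_locales auto
  interpret \<Gamma>: group \<Gamma> using ext by (simp add: central_extension_def)
  interpret G: group G by fact
  have \<iota>: "\<iota> \<in> hom A \<Gamma>" and \<phi>: "\<phi> \<in> hom \<Gamma> G" "\<phi> ` carrier \<Gamma> = carrier G"
    and ker: "\<iota> ` carrier A = kernel \<Gamma> G \<phi>"
    and cent: "\<And>a y. a \<in> carrier A \<Longrightarrow> y \<in> carrier \<Gamma> \<Longrightarrow> \<iota> a \<otimes>\<^bsub>\<Gamma>\<^esub> y = y \<otimes>\<^bsub>\<Gamma>\<^esub> \<iota> a"
    using ext by (auto simp: central_extension_def mon_def epi_def)
  interpret \<phi>: group_hom \<Gamma> G \<phi> using \<phi> by unfold_locales
  have conn: "\<exists>p. path p \<and> path_image p \<subseteq> S \<and> pathstart p = x \<and> pathfinish p = y" if "y \<in> S" for y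
  proof -
    let ?p = "q \<circ> linepath (sec x) (sec y)"
    have im: "path_image (linepath (sec x) (sec y)) \<subseteq> cball 0 1"
      using sec[OF surface(2)] sec[OF that] by (simp add: closed_segment_subset del: mem_cball)
    then have "path ?p" "path_image ?p \<subseteq> S"
      using q_continuous q_image
      by (auto simp: path_image_compose intro!: path_continuous_image elim: continuous_on_subset)
    moreover have "pathstart ?p = x" "pathfinish ?p = y"
      using sec[OF surface(2)] sec[OF that] by (simp_all add: pathstart_compose pathfinish_compose)
    ultimately show ?thesis by blast
  qed
  obtain u where u: "path_functor G S u" "\<And>h. h \<in> carrier G \<Longrightarrow> \<exists>p\<in>based_loops S x. u p = h"
    "\<And>p r. p \<in> based_loops S x \<Longrightarrow> r \<in> based_loops S x \<Longrightarrow> u p = u r \<Longrightarrow> homotopic_paths S p r"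
    using fundamental_group_path_functor[OF surface_group surface(2) conn] by blast
  interpret u: path_functor G S u by fact
  interpret polygon_functor g S q G u by unfold_locales
  obtain X \<delta> where X: "crossing_data G X \<delta>" "\<delta> 0 = \<one>"
    "\<And>c p. c \<in> charts \<Longrightarrow> path p \<Longrightarrow> path_image p \<subseteq> q ` dom c \<Longrightarrow>
      u p = inv (gauge \<one> X \<delta> c (sec (pathstart p)) \<otimes> eta (sec (pathstart p))) \<otimes>
        (gauge \<one> X \<delta> c (sec (pathfinish p)) \<otimes> eta (sec (pathfinish p)))"
    using functor_crossing_data by blast
  have Xcl: "X k \<in> carrier G" if "first_side k" for k using X(1) that unfolding crossing_data_def by blast
  have "\<exists>y\<in>carrier \<Gamma>. \<phi> y = h" if "h \<in> carrier G" for h using \<phi>(2) that by (metis imageE)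
  then obtain lift where lift: "\<And>h. h \<in> carrier G \<Longrightarrow> lift h \<in> carrier \<Gamma>" "\<And>h. h \<in> carrier G \<Longrightarrow> \<phi> (lift h) = h"
    by metis
  define Y where "Y k = lift (X k)" for k
  have Y: "Y k \<in> carrier \<Gamma>" "\<phi> (Y k) = X k" if "first_side k" for k
    unfolding Y_def using lift Xcl[OF that] by auto
  have YP: "Y \<in> Collect first_side \<rightarrow> carrier \<Gamma>" "\<forall>k. first_side k \<longrightarrow> \<phi> (Y k) = X k" using Y by auto
  have "\<phi> (relator \<Gamma> Y g) = \<one>"
    using relator_hom[OF \<phi>.group_hom_axioms YP] crossing_data_eq_corner_word(2)[OF G.is_group X(1,2)] by simp
  moreover have "relator \<Gamma> Y g \<in> carrier \<Gamma>" using relator_closed[OF \<Gamma>.is_group YP(1)] by simp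
  ultimately have "relator \<Gamma> Y g \<in> \<iota> ` carrier A" unfolding ker kernel_def by simp
  \<comment> \<open>\<open>c\<close> measures how far the lifts are from satisfying the surface
    relation.\<close>
  then obtain c where c: "c \<in> carrier A" "relator \<Gamma> Y g = \<iota> c" by auto
  have \<iota>c: "\<iota> c \<in> carrier \<Gamma>" "\<phi> (\<iota> c) = \<one>" using c(1) ker by (auto simp: kernel_def)
  interpret T: central_element \<Gamma> "\<iota> c" using \<iota>c cent[OF c(1)] by unfold_locales auto
  let ?K = "twisted_group \<Gamma> (\<iota> c)"
  define Z where "Z = (\<lambda>k. (Y k, if k = 0 then 1 else 0 :: int, if k = 1 then 1 else 0 :: int))"
  have Zcl: "Z \<in> Collect first_side \<rightarrow> carrier ?K" using Y(1) by (auto simp: Z_def T.twisted_carrier)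
  have rel: "relator ?K Z g = \<one>\<^bsub>?K\<^esub>"
  proof -
    obtain j where j: "g = Suc j" using genus by (cases g) auto
    have "relator ?K Z (Suc j) = (relator \<Gamma> Y (Suc j) \<otimes>\<^bsub>\<Gamma>\<^esub> inv\<^bsub>\<Gamma>\<^esub> (\<iota> c), 0, 0)"
      unfolding Z_def using j by (intro relator_twisted T.central_element_axioms YP(1)) auto
    then show ?thesis using c(2) \<iota>c unfolding j[symmetric] by (simp add: T.twisted_one)
  qed
  define \<epsilon> where "\<epsilon> = corner_word ?K Z"
  have data: "crossing_data ?K Z \<epsilon>" unfolding \<epsilon>_def by (rule crossing_data_corner_word[OF T.group_twisted Zcl rel])
  define \<pi> where "\<pi> = (\<lambda>y::'e \<times> int \<times> int. \<phi> (fst y))"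
  have "\<phi> (\<iota> c [^]\<^bsub>\<Gamma>\<^esub> n) = \<one>" for n :: int using \<iota>c by (simp add: \<phi>.hom_int_pow)
  then have \<pi>hom: "\<pi> \<in> hom ?K G"
    using \<iota>c by (intro homI) (auto simp: \<pi>_def T.twisted_carrier T.twisted_mult)
  interpret \<pi>: group_hom ?K G \<pi> using \<pi>hom T.group_twisted G.is_group
    by (simp add: group_hom_def group_hom_axioms_def)
  have \<pi>\<epsilon>: "\<pi> (\<epsilon> m) = \<delta> m" if "m \<le> 4 * g" for m
  proof -
    have "\<forall>k. first_side k \<longrightarrow> \<pi> (Z k) = X k" using Y(2) by (simp add: \<pi>_def Z_def)
    then show ?thesis
      unfolding \<epsilon>_def using corner_word_hom[OF \<pi>.group_hom_axioms Zcl _ that] crossing_data_eq_corner_word(1)[OF G.is_group X(1,2) that]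
      by simp
  qed
  interpret FK: flat_atlas ?K S charts "\<lambda>c. q ` dom c" "\<lambda>c y. gauge \<one>\<^bsub>?K\<^esub> Z \<epsilon> c (sec y)"
    by (rule flat_atlas_gauge[OF T.group_twisted data])
  interpret FG: flat_atlas G S charts "\<lambda>c. q ` dom c" "\<lambda>c y. gauge \<one> X \<delta> c (sec y)"
    by (rule flat_atlas_gauge[OF G.is_group X(1)])
  interpret hol: path_functor ?K S FK.holonomy by (rule FK.path_functor_holonomy)
  have ends: "pathstart p \<in> S" "pathfinish p \<in> S" if "path_image p \<subseteq> S" for p :: "real \<Rightarrow> 's" using that by auto
  \<comment> \<open>On charts \<open>u\<close> is given by the gauge together with
    \<open>eta\<close>; multiplying by these values at both ends removes \<open>eta\<close>.\<close>
  define e where "e y = eta (sec y)" for y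
  have e: "e y \<in> carrier G" if "y \<in> S" for y unfolding e_def using eta_closed sec[OF that] by blast
  have dS: "q ` dom c \<subseteq> S" for c using dom_subset q_image by blast
  have eq1: "\<pi> (FK.holonomy p) = FG.holonomy p" if p: "path p" "path_image p \<subseteq> S" for p
  proof (rule FG.path_functor_eq_holonomy[OF _ _ p])
    show "path_functor G S (\<lambda>p. \<pi> (FK.holonomy p))"
      using hol.closed hol.join hol.homotopic by unfold_locales (auto simp: \<pi>.hom_mult)
    fix c p assume c: "c \<in> charts" and p: "path p" "path_image p \<subseteq> q ` dom c"
    have dom: "sec (pathstart p) \<in> dom c" "sec (pathfinish p) \<in> dom c" using sec_dom[OF c] p(2) by auto
    have "\<pi> (gauge \<one>\<^bsub>?K\<^esub> Z \<epsilon> c z) = gauge \<one> X \<delta> c z" if "z \<in> dom c" for z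
      using \<pi>\<epsilon> Y(2) data X(1)
      by (intro gauge_hom[OF c that]) (auto simp: crossing_data_def \<pi>_def Z_def T.twisted_one)
    then show "\<pi> (FK.holonomy p) = inv gauge \<one> X \<delta> c (sec (pathstart p)) \<otimes> gauge \<one> X \<delta> c (sec (pathfinish p))"
      using FK.holonomy_chart[OF p(1) c p(2)] dom gauge_closed[OF T.group_twisted data c] by simp
  qed
  have eq2: "e (pathstart p) \<otimes> u p \<otimes> inv e (pathfinish p) = FG.holonomy p" if p: "path p" "path_image p \<subseteq> S" for p
  proof (rule FG.path_functor_eq_holonomy[OF _ _ p])
    show "path_functor G S (\<lambda>p. e (pathstart p) \<otimes> u p \<otimes> inv e (pathfinish p))"
    proof
      fix p r :: "real \<Rightarrow> 's" assume p: "path p" "path_image p \<subseteq> S" and r: "path r" "path_image r \<subseteq> S"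
        and pr: "pathfinish p = pathstart r"
      show "e (pathstart (p +++ r)) \<otimes> u (p +++ r) \<otimes> inv e (pathfinish (p +++ r)) =
        e (pathstart p) \<otimes> u p \<otimes> inv e (pathfinish p) \<otimes>
        (e (pathstart r) \<otimes> u r \<otimes> inv e (pathfinish r))"
        using u.join[OF p r pr] u.closed[OF p] u.closed[OF r] e[OF ends(1)[OF p(2)]] e[OF ends(1)[OF r(2)]] e[OF ends(2)[OF r(2)]] pr
        by (simp add: G.m_assoc)
    next
      fix p r :: "real \<Rightarrow> 's" assume h: "homotopic_paths S p r"
      show "e (pathstart p) \<otimes> u p \<otimes> inv e (pathfinish p) = e (pathstart r) \<otimes> u r \<otimes> inv e (pathfinish r)"
        using u.homotopic[OF h] homotopic_paths_imp_pathstart[OF h] homotopic_paths_imp_pathfinish[OF h] by simp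
    qed (use u.closed e ends in auto)
    fix c p assume c: "c \<in> charts" and p: "path p" "path_image p \<subseteq> q ` dom c"
    define a b where "a = gauge \<one> X \<delta> c (sec (pathstart p))" and "b = gauge \<one> X \<delta> c (sec (pathfinish p))"
    have "a \<in> carrier G" "b \<in> carrier G"
      unfolding a_def b_def using gauge_closed[OF G.is_group X(1) c] sec_dom[OF c] p(2) by auto
    moreover have "e (pathstart p) \<in> carrier G" "e (pathfinish p) \<in> carrier G"
      using e ends[of p] p(2) dS[of c] by auto
    moreover have "u p = inv (a \<otimes> e (pathstart p)) \<otimes> (b \<otimes> e (pathfinish p))"
      using X(3)[OF c p] unfolding a_def b_def e_def .
    ultimately show "e (pathstart p) \<otimes> u p \<otimes> inv e (pathfinish p) = inv a \<otimes> b"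
      by (simp add: G.inv_mult_group G.m_assoc)
  qed
  have ex: "e x \<in> carrier G" using e surface(2) .
  \<comment> \<open>A lift of \<open>e x\<close>, by which the conjugation at the base point is
    undone inside the twisted product.\<close>
  define w where "w = (lift (e x), 0::int, 0::int)"
  have w: "w \<in> carrier ?K" "\<pi> w = e x" using lift[OF ex] by (auto simp: w_def T.twisted_carrier \<pi>_def)
  obtain loop where loop: "\<And>h. h \<in> carrier G \<Longrightarrow> loop h \<in> based_loops S x" "\<And>h. h \<in> carrier G \<Longrightarrow> u (loop h) = h"
    using u(2) by metis
  have loopD: "path p" "path_image p \<subseteq> S" "pathstart p = x" "pathfinish p = x" if "p \<in> based_loops S x" for p
    using that by (auto simp: based_loops_def)
  define \<Phi> where "\<Phi> h = inv\<^bsub>?K\<^esub> w \<otimes>\<^bsub>?K\<^esub> FK.holonomy (loop h) \<otimes>\<^bsub>?K\<^esub> w" for h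
  have hcl: "FK.holonomy (loop h) \<in> carrier ?K" if "h \<in> carrier G" for h
    using hol.closed loopD[OF loop(1)[OF that]] by blast
  have "\<Phi> \<in> hom G ?K"
  proof (rule homI)
    fix h k assume hk: "h \<in> carrier G" "k \<in> carrier G"
    note lh = loopD[OF loop(1)[OF hk(1)]] and lk = loopD[OF loop(1)[OF hk(2)]]
    have "loop h +++ loop k \<in> based_loops S x" using lh lk by (simp add: based_loops_def path_image_join)
    moreover have "u (loop h +++ loop k) = u (loop (h \<otimes> k))"
      using u.join[OF lh(1,2) lk(1,2)] lh(4) lk(3) loop(2) hk by simp
    \<comment> \<open>The loops are chosen separately for each element; that \<open>u\<close>
      detects homotopy makes the choice multiplicative up to homotopy.\<close>
    ultimately have "homotopic_paths S (loop (h \<otimes> k)) (loop h +++ loop k)"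
      using u(3) loop(1) hk by (metis G.m_closed)
    then have "FK.holonomy (loop (h \<otimes> k)) = FK.holonomy (loop h) \<otimes>\<^bsub>?K\<^esub> FK.holonomy (loop k)"
      using hol.homotopic hol.join[OF lh(1,2) lk(1,2)] lh(4) lk(3) by simp
    then show "\<Phi> (h \<otimes> k) = \<Phi> h \<otimes>\<^bsub>?K\<^esub> \<Phi> k"
      unfolding \<Phi>_def using hcl[OF hk(1)] hcl[OF hk(2)] w(1) by (simp add: T.twisted.m_assoc)
  qed (use hcl w(1) in \<open>simp add: \<Phi>_def\<close>)
  moreover have "\<phi> (fst (\<Phi> h)) = h" if h: "h \<in> carrier G" for h
  proof -
    note lh = loopD[OF loop(1)[OF h]]
    have "\<pi> (FK.holonomy (loop h)) = e x \<otimes> h \<otimes> inv e x"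
      using eq1[OF lh(1,2)] eq2[OF lh(1,2)] lh(3,4) loop(2)[OF h] by simp
    then have "\<pi> (\<Phi> h) = h"
      unfolding \<Phi>_def using hcl[OF h] w ex h by (simp add: G.m_assoc)
    then show ?thesis by (simp add: \<pi>_def)
  qed
  ultimately show ?thesis using c(1) by blast
qed

theorem lemma3p1:
  fixes A :: "'a monoid" and \<Gamma> :: "'e monoid" and G\<^sub>1 :: "'g monoid"
    and \<iota> :: "'a \<Rightarrow> 'e" and \<phi> :: "'e \<Rightarrow> 'g"
    and S :: "'s::topological_space set" and x :: 's and g :: nat
  assumes A: "comm_group A" "finite (carrier A)"
    and surface: "closed_orientable_surface g S" "2 \<le> g" "x \<in> S"
    and surface_group: "group G\<^sub>1" "G\<^sub>1 \<cong> fundamental_group S x"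
    and ext: "central_extension A \<iota> \<Gamma> \<phi> G\<^sub>1"
  shows "\<exists>H. subgroup H G\<^sub>1 \<and>
    finite (rcosets\<^bsub>G\<^sub>1\<^esub> H) \<and> card (rcosets\<^bsub>G\<^sub>1\<^esub> H) \<le> group_exponent A \<and>
    trivial_extension A \<iota> (preimage_group \<Gamma> \<phi> H) \<phi> (G\<^sub>1\<lparr>carrier := H\<rparr>) \<and>
    H \<lhd> G\<^sub>1 \<and> cyclic_group (G\<^sub>1 Mod H)"
proof -
  obtain c \<Phi> where "c \<in> carrier A" "\<Phi> \<in> hom G\<^sub>1 (twisted_group \<Gamma> (\<iota> c))"
    "\<And>h. h \<in> carrier G\<^sub>1 \<Longrightarrow> \<phi> (fst (\<Phi> h)) = h"
    using central_extension_hom_twisted[OF surface(1,3) surface_group ext] by blast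
  then show ?thesis by (rule central_extension_splits_on_cyclic_cover[OF ext A(2)])
qed

end
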